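(* For every $\beta\ge1$ there exists a unique probability measure $\mu_\beta$ on $\Omega_B$ satisfying the scaling condition $$\mu_\beta((m,n)Y)=n^{-\beta}\mu_\beta(Y)\quad\text{for any Borel set } Y\subset\Omega_B\text{ and any }(m,n)\in\mathbb Z\rtimes\mathbb N^\times.$$ There are no probability measures on $\Omega_B$ satisfying this condition for $\beta<1$. Equivalently, for every $\beta\ge1$ there exists a unique $\sigma$-KMS$_\beta$-state on $C(\Omega_B)\rtimes(\mathbb Z\rtimes\mathbb N^\times)$ which factors through the conditional expectation onto $C(\Omega_B)$. There are no $\sigma$-KMS$_\beta$-states for $\beta<1$.
   Context: Notation: $\mathbb N^\times=\{1,2,3,\dots\}$ (multiplicative semigroup); semidirect products have product $(m,k)(n,l)=(m+kn,kl)$. $\hat{\mathbb Z}=\prod_p\mathbb Z_p$, $\hat{\mathbb Z}^*=\prod_p\mathbb Z_p^*$, $\mathbb A_f$ is the ring of finite adeles; $\mathbb A_f/\hat{\mathbb Z}^*$ is the orbit space for the multiplication action, and $a\hat{\mathbb Z}$ is well defined for $a\in\mathbb A_f/\hat{\mathbb Z}^*$. Let $\tilde\Omega_B=\{(r,a):a\in\mathbb A_f/\hat{\mathbb Z}^*,\ r\in\mathbb A_f/a\hat{\mathbb Z}\}$ with the quotient topology from $\mathbb A_f\times(\mathbb A_f/\hat{\mathbb Z}^* )$, and let $\Omega_B=\{(r,a):a\in\hat{\mathbb Z}/\hat{\mathbb Z}^*,\ r\in\hat{\mathbb Z}/a\hat{\mathbb Z}\}$, a compact open subset. The group $\mathbb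 Q\rtimes\mathbb Q^*_+$ acts on $\tilde\Omega_B$ by $(m,k)(r,a)=(m+kr,ka)$, which restricts to an action of $\mathbb Z\rtimes\mathbb N^\times$ on $\Omega_B$ by injective maps. $C(\Omega_B)\rtimes(\mathbb Z\rtimes\mathbb N^\times)$ is the universal unital C$^*$-algebra generated by the image of a unital $*$-homomorphism $\iota$ of $C(\Omega_B)$ and isometries $v_x$, $x\in\mathbb Z\rtimes\mathbb N^\times$, with $v_xv_y=v_{xy}$ and $v_x\iota(f)v_x^*=\iota(f(x^{-1}\cdot))$, where $f(x^{-1}\cdot)$ is taken to be $0$ outside $x\Omega_B$. It is canonically identified with the corner $\mathbf 1_{\Omega_B}(C_0(\tilde\Omega_B)\rtimes(\mathbb Q\rtimes\mathbb Q^*_+))\mathbf 1_{\Omega_B}$ of the group crossed product ($\iota(f)\mapsto f$ extended by zero, $v_x\mapsto u_x\mathbf 1_{\Omega_B}$ with $u_g$ the implementing unitaries), and the conditional expectation onto $C(\Omega_B)$ is the restriction to this corner of the canonical conditional expectation $C_0(\tilde\Omega_B)\rtimes(\mathbb Q\rtimes\mathbb Q^*_+)\to C_0(\tilde\Omega_B)$. The dynamics $\sigma$ on $C(\Omega_B)\rtimes(\mathbb Z\rtimes\mathbb N^\times)$ is given by $\sigma_t(\iota(f))=\iota(f)$, $\sigma_t(v_{(m,k)})=k^{it}v_{(m,k)}$. For $\beta\in\mathbb R$, a $\sigma$-KMS$_\beta$-state is a $\sigma$-invariant state $\varphi$ with $\varphi(xy)=\varphi(y\sigma_{i\beta}(x))$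 for all $\sigma$-analytic elements $x,y$. A probability measure $\mu$ on $\Omega_B$ with the scaling condition corresponds to the $\sigma$-KMS$_\beta$-state obtained by composing the state $f\mapsto\int f\,d\mu$ on $C(\Omega_B)$ with the conditional expectation. *)

theory Defs
  imports
    "HOL-Probability.Probability"
    "HOL-Algebra.Ring"
    "HOL-Computational_Algebra.Primes"
begin

section \<open>Finite adeles\<close>

definition padic_val :: "nat \<Rightarrow> rat \<Rightarrow> int" where
  "padic_val p x =
     int (multiplicity (int p) (fst (quotient_of x)))
   - int (multiplicity (int p) (snd (quotient_of x)))"

definition padic_abs :: "nat \<Rightarrow> rat \<Rightarrow> real" where
  "padic_abs p x = (if x = 0 then 0 else real p powi (- padic_val p x))"

definition padic_Cauchy :: "nat \<Rightarrow> (nat \<Rightarrow> rat) \<Rightarrow> bool" where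
  "padic_Cauchy p X \<longleftrightarrow>
     (\<forall>e>0. \<exists>N. \<forall>m\<ge>N. \<forall>n\<ge>N. padic_abs p (X m - X n) < e)"

definition padic_null :: "nat \<Rightarrow> (nat \<Rightarrow> rat) \<Rightarrow> bool" where
  "padic_null p X \<longleftrightarrow> (\<lambda>n. padic_abs p (X n)) \<longlonglongrightarrow> 0"

lemma padic_val_divide:
  assumes p: "prime p" and ab: "a \<noteq> 0" "b \<noteq> 0"
  shows "padic_val p (rat_of_int a / rat_of_int b)
       = int (multiplicity (int p) a) - int (multiplicity (int p) b)"
proof -
  define c d where "c = fst (quotient_of (rat_of_int a / rat_of_int b))"
    and "d = snd (quotient_of (rat_of_int a / rat_of_int b))"
  have q: "quotient_of (rat_of_int a / rat_of_int b) = (c, d)"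
    by (simp add: c_def d_def)
  have d: "d \<noteq> 0" using quotient_of_denom_pos[OF q] by simp
  have "rat_of_int a / rat_of_int b = rat_of_int c / rat_of_int d"
    using quotient_of_div[OF q] .
  then have "rat_of_int (a * d) = rat_of_int (c * b)"
    using ab d by (simp add: field_simps)
  then have eq: "a * d = c * b" by (simp only: of_int_eq_iff)
  then have c: "c \<noteq> 0" using ab d by auto
  have pr: "prime_elem (int p)" using p by simp
  have "multiplicity (int p) (a * d) = multiplicity (int p) (c * b)" using eq by simp
  then have "multiplicity (int p) a + multiplicity (int p) d
      = multiplicity (int p) c + multiplicity (int p) b"
    using pr ab c d by (simp add: prime_elem_multiplicity_mult_distrib)
  then show ?thesis unfolding padic_val_def q by simp
qed

lemma rat_as_quotient:
  obtains a b where "b \<noteq> 0" "(x::rat) = rat_of_int a / rat_of_int b"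
  by (metis quotient_of_div quotient_of_denom_pos less_irrefl surj_pair)

lemma padic_abs_0 [simp]: "padic_abs p 0 = 0"
  by (simp add: padic_abs_def)

lemma padic_abs_1 [simp]: "prime p \<Longrightarrow> padic_abs p 1 = 1"
  using padic_val_divide[of p 1 1] by (simp add: padic_abs_def)

lemma padic_abs_nonneg [simp]: "0 \<le> padic_abs p x"
  by (simp add: padic_abs_def)

lemma padic_abs_minus: "prime p \<Longrightarrow> padic_abs p (- x) = padic_abs p x"
proof -
  assume p: "prime p"
  obtain a b where ab: "b \<noteq> 0" "x = rat_of_int a / rat_of_int b" by (rule rat_as_quotient)
  have "padic_val p (- x) = padic_val p x" if "x \<noteq> 0"
  proof -
    have a: "a \<noteq> 0" using that ab by auto
    have "- x = rat_of_int (- a) / rat_of_int b" using ab by simp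
    then show ?thesis
      using padic_val_divide[OF p, of "- a" b] padic_val_divide[OF p, of a b] a ab
        multiplicity_normalize_right[of "int p" a] multiplicity_normalize_right[of "int p" "- a"]
      by simp
  qed
  then show ?thesis by (simp add: padic_abs_def)
qed

lemma padic_abs_mult:
  assumes p: "prime p"
  shows "padic_abs p (x * y) = padic_abs p x * padic_abs p y"
proof (cases "x = 0 \<or> y = 0")
  case True
  then show ?thesis by (auto simp: padic_abs_def)
next
  case False
  obtain a b where ab: "b \<noteq> 0" "x = rat_of_int a / rat_of_int b" by (rule rat_as_quotient)
  obtain c d where cd: "d \<noteq> 0" "y = rat_of_int c / rat_of_int d" by (rule rat_as_quotient)
  have nz: "a \<noteq> 0" "c \<noteq> 0" using False ab cd by auto
  have pr: "prime_elem (int p)" using p by simp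
  have xy: "x * y = rat_of_int (a * c) / rat_of_int (b * d)" using ab cd by simp
  have "padic_val p (x * y) = padic_val p x + padic_val p y"
    using padic_val_divide[OF p, of "a * c" "b * d"] padic_val_divide[OF p nz(1) ab(1)]
      padic_val_divide[OF p nz(2) cd(1)] ab(1) cd(1) nz
    unfolding ab(2)[symmetric] cd(2)[symmetric] xy[symmetric]
    by (simp add: prime_elem_multiplicity_mult_distrib[OF pr])
  moreover have "real p \<noteq> 0" using p by (auto dest: prime_gt_0_nat)
  ultimately show ?thesis using False
    by (simp add: padic_abs_def power_int_add[symmetric])
qed

lemma padic_abs_ultrametric:
  assumes p: "prime p"
  shows "padic_abs p (x + y) \<le> max (padic_abs p x) (padic_abs p y)"
proof (cases "x = 0 \<or> y = 0 \<or> x + y = 0")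
  case True
  then show ?thesis by (auto simp: le_max_iff_disj)
next
  case False
  obtain a b where ab: "b \<noteq> 0" "x = rat_of_int a / rat_of_int b" by (rule rat_as_quotient)
  obtain c d where cd: "d \<noteq> 0" "y = rat_of_int c / rat_of_int d" by (rule rat_as_quotient)
  have x: "x = rat_of_int (a * d) / rat_of_int (b * d)"
    and y: "y = rat_of_int (c * b) / rat_of_int (b * d)" using ab cd by simp_all
  have xy: "x + y = rat_of_int (a * d + c * b) / rat_of_int (b * d)"
    unfolding x y by (simp add: add_divide_distrib)
  have nz: "a * d \<noteq> 0" "c * b \<noteq> 0" "b * d \<noteq> 0" "a * d + c * b \<noteq> 0"
    using False ab cd by simp_all (use False xy in force)
  let ?m = "\<lambda>u. multiplicity (int p) u"
  have nu: "\<not> is_unit (int p)" by (rule prime_elem_not_unit) (use p in simp)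
  have "?m (a * d + c * b) \<ge> min (?m (a * d)) (?m (c * b))"
  proof (rule multiplicity_geI[OF nz(4) nu])
    show "int p ^ min (?m (a * d)) (?m (c * b)) dvd a * d + c * b"
      by (rule dvd_add; rule multiplicity_dvd') simp_all
  qed
  then have "padic_val p (x + y) \<ge> min (padic_val p x) (padic_val p y)"
    using padic_val_divide[OF p nz(1,3)] padic_val_divide[OF p nz(2,3)]
      padic_val_divide[OF p nz(4,3)]
    unfolding x[symmetric] y[symmetric] xy[symmetric] by linarith
  moreover have "1 \<le> real p" using p by (auto dest: prime_ge_1_nat)
  ultimately show ?thesis using False
    by (auto simp: padic_abs_def le_max_iff_disj min_le_iff_disj intro: power_int_increasing)
qed

lemma padic_abs_triangle:
  "prime p \<Longrightarrow> padic_abs p (x + y) \<le> padic_abs p x + padic_abs p y"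
  using padic_abs_ultrametric[of p x y] padic_abs_nonneg[of p x] padic_abs_nonneg[of p y]
  by linarith

lemma padic_abs_diff_le:
  assumes p: "prime p"
  shows "\<bar>padic_abs p x - padic_abs p y\<bar> \<le> padic_abs p (x - y)"
  using padic_abs_triangle[OF p, of "x - y" y] padic_abs_triangle[OF p, of "y - x" x]
    padic_abs_minus[OF p, of "x - y"] by simp

lemma padic_abs_diff_max:
  "prime p \<Longrightarrow> padic_abs p (x - y) \<le> max (padic_abs p x) (padic_abs p y)"
  using padic_abs_ultrametric[of p x "- y"] by (simp add: padic_abs_minus)

lemma padic_null_0 [simp]: "padic_null p (\<lambda>n. 0)"
  by (simp add: padic_null_def)

lemma padic_null_minus: "prime p \<Longrightarrow> padic_null p X \<Longrightarrow> padic_null p (\<lambda>n. - X n)"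
  by (simp add: padic_null_def padic_abs_minus)

lemma padic_null_add:
  assumes p: "prime p" and "padic_null p X" "padic_null p Y"
  shows "padic_null p (\<lambda>n. X n + Y n)"
proof -
  have lim: "(\<lambda>n. padic_abs p (X n) + padic_abs p (Y n)) \<longlonglongrightarrow> 0"
    using assms unfolding padic_null_def by (intro tendsto_add_zero)
  show ?thesis unfolding padic_null_def
    by (intro Lim_null_comparison[OF _ lim] always_eventually) (simp add: padic_abs_triangle[OF p])
qed

lemma padic_Cauchy_const: "padic_Cauchy p (\<lambda>n. c)"
  by (simp add: padic_Cauchy_def)

lemma padic_Cauchy_minus: "prime p \<Longrightarrow> padic_Cauchy p X \<Longrightarrow> padic_Cauchy p (\<lambda>n. - X n)"
  using padic_abs_minus[of p]
  by (simp add: padic_Cauchy_def minus_diff_commute)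
     (metis minus_diff_eq)

lemma padic_Cauchy_add:
  assumes p: "prime p" and X: "padic_Cauchy p X" and Y: "padic_Cauchy p Y"
  shows "padic_Cauchy p (\<lambda>n. X n + Y n)"
  unfolding padic_Cauchy_def
proof (intro allI impI)
  fix e :: real assume e: "e > 0"
  obtain M where M: "\<forall>m\<ge>M. \<forall>n\<ge>M. padic_abs p (X m - X n) < e"
    using X e unfolding padic_Cauchy_def by blast
  obtain N where N: "\<forall>m\<ge>N. \<forall>n\<ge>N. padic_abs p (Y m - Y n) < e"
    using Y e unfolding padic_Cauchy_def by blast
  show "\<exists>N. \<forall>m\<ge>N. \<forall>n\<ge>N. padic_abs p (X m + Y m - (X n + Y n)) < e"
  proof (rule exI[of _ "max M N"], intro allI impI)
    fix m n assume "max M N \<le> m" "max M N \<le> n"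
    then have "padic_abs p (X m - X n) < e" "padic_abs p (Y m - Y n) < e"
      using M N by auto
    then show "padic_abs p (X m + Y m - (X n + Y n)) < e"
      using padic_abs_ultrametric[OF p, of "X m - X n" "Y m - Y n"]
      by (simp add: algebra_simps)
  qed
qed

lemma padic_Cauchy_bounded:
  assumes p: "prime p" and X: "padic_Cauchy p X"
  obtains B where "B > 0" "\<And>n. padic_abs p (X n) \<le> B"
proof -
  obtain N where N: "\<forall>m\<ge>N. \<forall>n\<ge>N. padic_abs p (X m - X n) < 1"
    using X unfolding padic_Cauchy_def by (meson zero_less_one)
  define B where "B = (\<Sum>i\<le>N. padic_abs p (X i)) + 1"
  have S: "padic_abs p (X i) \<le> B - 1" if "i \<le> N" for i
    unfolding B_def
    using that member_le_sum[of i "{..N}" "\<lambda>i. padic_abs p (X i)"] by simp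
  have "padic_abs p (X n) \<le> B" for n
  proof (cases "n \<le> N")
    case True then show ?thesis using S[of n] by simp
  next
    case False
    then have "padic_abs p (X n - X N) < 1" using N by simp
    then show ?thesis
      using padic_abs_triangle[OF p, of "X n - X N" "X N"] S[of N] by simp
  qed
  moreover have "B > 0" unfolding B_def
    by (intro add_nonneg_pos sum_nonneg) auto
  ultimately show ?thesis using that by blast
qed

lemma padic_null_mult_bounded:
  assumes p: "prime p" and X: "padic_null p X" and Y: "padic_Cauchy p Y"
  shows "padic_null p (\<lambda>n. X n * Y n)"
proof -
  obtain B where B: "B > 0" "\<And>n. padic_abs p (Y n) \<le> B"
    using padic_Cauchy_bounded[OF p Y] by blast
  have lim: "(\<lambda>n. padic_abs p (X n) * B) \<longlonglongrightarrow> 0"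
    using X unfolding padic_null_def by (rule tendsto_mult_left_zero)
  have "padic_abs p (X n * Y n) \<le> padic_abs p (X n) * B" for n
    unfolding padic_abs_mult[OF p] by (rule mult_left_mono[OF B(2) padic_abs_nonneg])
  then show ?thesis unfolding padic_null_def
    by (intro Lim_null_comparison[OF _ lim] always_eventually) simp
qed

lemma padic_Cauchy_mult:
  assumes p: "prime p" and X: "padic_Cauchy p X" and Y: "padic_Cauchy p Y"
  shows "padic_Cauchy p (\<lambda>n. X n * Y n)"
  unfolding padic_Cauchy_def
proof (intro allI impI)
  fix e :: real assume e: "e > 0"
  obtain B where B: "B > 0" "\<And>n. padic_abs p (X n) \<le> B"
    using padic_Cauchy_bounded[OF p X] by blast
  obtain C where C: "C > 0" "\<And>n. padic_abs p (Y n) \<le> C"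
    using padic_Cauchy_bounded[OF p Y] by blast
  obtain M where M: "\<forall>m\<ge>M. \<forall>n\<ge>M. padic_abs p (X m - X n) < e / C"
    using X e C unfolding padic_Cauchy_def by (meson divide_pos_pos)
  obtain N where N: "\<forall>m\<ge>N. \<forall>n\<ge>N. padic_abs p (Y m - Y n) < e / B"
    using Y e B unfolding padic_Cauchy_def by (meson divide_pos_pos)
  show "\<exists>N. \<forall>m\<ge>N. \<forall>n\<ge>N. padic_abs p (X m * Y m - X n * Y n) < e"
  proof (rule exI[of _ "max M N"], intro allI impI)
    fix m n assume mn: "max M N \<le> m" "max M N \<le> n"
    have "padic_abs p (X m - X n) * padic_abs p (Y m) \<le> padic_abs p (X m - X n) * C"
      using C by (intro mult_left_mono) auto
    also have "\<dots> < e" using M mn C by (simp add: field_simps)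
    finally have 1: "padic_abs p ((X m - X n) * Y m) < e" by (simp add: padic_abs_mult[OF p])
    have "padic_abs p (X n) * padic_abs p (Y m - Y n) \<le> B * padic_abs p (Y m - Y n)"
      using B by (intro mult_right_mono) auto
    also have "\<dots> < e" using N mn B by (simp add: field_simps)
    finally have 2: "padic_abs p (X n * (Y m - Y n)) < e" by (simp add: padic_abs_mult[OF p])
    have "X m * Y m - X n * Y n = (X m - X n) * Y m + X n * (Y m - Y n)"
      by (simp add: algebra_simps)
    then show "padic_abs p (X m * Y m - X n * Y n) < e"
      using padic_abs_ultrametric[OF p, of "(X m - X n) * Y m" "X n * (Y m - Y n)"] 1 2 by simp
  qed
qed

text \<open>
  The field \<open>\<rat>\<^sub>p\<close> is the completion of \<open>\<rat>\<close> for \<open>padic_abs p\<close>, i.e. Cauchy sequences modulo null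
  sequences, and the finite adeles are the restricted product of the \<open>\<rat>\<^sub>p\<close> with respect to the
  rings \<open>\<int>\<^sub>p\<close>.  As the type \<open>\<rat>\<^sub>p\<close> would depend on the value \<open>p\<close>, the product over all primes is
  taken before the quotient: a finite adele is represented by a family \<open>X\<close> such that, for every
  prime \<open>p\<close>, the sequence \<open>X p\<close> represents an element of \<open>\<rat>\<^sub>p\<close>, and this element lies in \<open>\<int>\<^sub>p\<close> for
  all but finitely many \<open>p\<close>; two families are identified iff they agree in every \<open>\<rat>\<^sub>p\<close>.
  Values at non-prime indices are irrelevant.
\<close>

definition padic_integral :: "nat \<Rightarrow> (nat \<Rightarrow> rat) \<Rightarrow> bool" where
  "padic_integral p X \<longleftrightarrow> (\<forall>\<^sub>F n in sequentially. padic_abs p (X n) \<le> 1)"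

definition adele_rep :: "(nat \<Rightarrow> nat \<Rightarrow> rat) \<Rightarrow> bool" where
  "adele_rep X \<longleftrightarrow>
     (\<forall>p. prime p \<longrightarrow> padic_Cauchy p (X p)) \<and> finite {p. prime p \<and> \<not> padic_integral p (X p)}"

definition adele_rel :: "(nat \<Rightarrow> nat \<Rightarrow> rat) \<Rightarrow> (nat \<Rightarrow> nat \<Rightarrow> rat) \<Rightarrow> bool" where
  "adele_rel X Y \<longleftrightarrow>
     adele_rep X \<and> adele_rep Y \<and> (\<forall>p. prime p \<longrightarrow> padic_null p (\<lambda>n. X p n - Y p n))"

lemma padic_abs_rat_le_1:
  assumes p: "prime p" and n: "\<not> int p dvd snd (quotient_of x)"
  shows "padic_abs p x \<le> 1"
proof -
  have "multiplicity (int p) (snd (quotient_of x)) = 0"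
    using n by (intro not_dvd_imp_multiplicity_0)
  then have "padic_val p x \<ge> 0" by (simp add: padic_val_def)
  then have "real p powi (- padic_val p x) \<le> real p powi 0"
    using prime_ge_1_nat[OF p] by (intro power_int_increasing) auto
  then show ?thesis by (simp add: padic_abs_def)
qed

lemma adele_rep_const: "adele_rep (\<lambda>p n. x)"
proof -
  have d: "snd (quotient_of x) \<noteq> 0" using quotient_of_denom_pos' [of x] by simp
  have "{p. prime p \<and> \<not> padic_integral p (\<lambda>n. x)} \<subseteq> nat ` {k. k dvd snd (quotient_of x)}"
  proof
    fix p assume "p \<in> {p. prime p \<and> \<not> padic_integral p (\<lambda>n. x)}"
    then have "int p dvd snd (quotient_of x)"
      using padic_abs_rat_le_1[of p x] by (auto simp: padic_integral_def)
    then show "p \<in> nat ` {k. k dvd snd (quotient_of x)}"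
      by (intro image_eqI[of _ _ "int p"]) auto
  qed
  moreover have "finite (nat ` {k. k dvd snd (quotient_of x)})"
    using d by (intro finite_imageI finite_divisors_int)
  ultimately show ?thesis
    by (auto simp: adele_rep_def padic_Cauchy_const intro: finite_subset)
qed

lemma padic_integral_minus: "prime p \<Longrightarrow> padic_integral p X \<Longrightarrow> padic_integral p (\<lambda>n. - X n)"
  by (simp add: padic_integral_def padic_abs_minus)

lemma padic_integral_add:
  assumes p: "prime p" and "padic_integral p X" "padic_integral p Y"
  shows "padic_integral p (\<lambda>n. X n + Y n)"
  using assms(2,3) unfolding padic_integral_def
  by eventually_elim (rule order_trans[OF padic_abs_ultrametric[OF p]], simp)

lemma padic_integral_mult:
  assumes p: "prime p" and "padic_integral p X" "padic_integral p Y"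
  shows "padic_integral p (\<lambda>n. X n * Y n)"
  using assms(2,3) unfolding padic_integral_def
  by eventually_elim (simp add: padic_abs_mult[OF p] mult_le_one)

lemma adele_rep_minus: "adele_rep X \<Longrightarrow> adele_rep (\<lambda>p n. - X p n)"
  unfolding adele_rep_def
  by (auto intro: padic_Cauchy_minus padic_integral_minus elim!: finite_subset[rotated])

lemma adele_rep_add:
  assumes "adele_rep X" "adele_rep Y" shows "adele_rep (\<lambda>p n. X p n + Y p n)"
proof -
  have "finite ({p. prime p \<and> \<not> padic_integral p (X p)} \<union> {p. prime p \<and> \<not> padic_integral p (Y p)})"
    using assms unfolding adele_rep_def by blast
  then have "finite {p. prime p \<and> \<not> padic_integral p (\<lambda>n. X p n + Y p n)}"
    by (rule finite_subset[rotated]) (auto intro: padic_integral_add)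
  then show ?thesis using assms unfolding adele_rep_def by (auto intro: padic_Cauchy_add)
qed

lemma adele_rep_mult:
  assumes "adele_rep X" "adele_rep Y" shows "adele_rep (\<lambda>p n. X p n * Y p n)"
proof -
  have "finite ({p. prime p \<and> \<not> padic_integral p (X p)} \<union> {p. prime p \<and> \<not> padic_integral p (Y p)})"
    using assms unfolding adele_rep_def by blast
  then have "finite {p. prime p \<and> \<not> padic_integral p (\<lambda>n. X p n * Y p n)}"
    by (rule finite_subset[rotated]) (auto intro: padic_integral_mult)
  then show ?thesis using assms unfolding adele_rep_def by (auto intro: padic_Cauchy_mult)
qed

lemma adele_rel_refl: "adele_rep X \<Longrightarrow> adele_rel X X"
  by (simp add: adele_rel_def)

lemma part_equivp_adele_rel: "part_equivp adele_rel"
proof (rule part_equivpI)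
  show "\<exists>X. adele_rel X X" using adele_rel_refl adele_rep_const by blast
  show "symp adele_rel"
  proof (rule sympI)
    fix X Y assume "adele_rel X Y"
    moreover have "padic_null p (\<lambda>n. Y p n - X p n)"
      if "prime p" "padic_null p (\<lambda>n. X p n - Y p n)" for p
      using padic_null_minus[OF that] by simp
    ultimately show "adele_rel Y X" by (simp add: adele_rel_def)
  qed
  show "transp adele_rel"
  proof (rule transpI)
    fix X Y Z assume "adele_rel X Y" "adele_rel Y Z"
    moreover have "padic_null p (\<lambda>n. X p n - Z p n)"
      if "prime p" "padic_null p (\<lambda>n. X p n - Y p n)" "padic_null p (\<lambda>n. Y p n - Z p n)" for p
      using padic_null_add[OF that] by simp
    ultimately show "adele_rel X Z" by (simp add: adele_rel_def)
  qed
qed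

quotient_type adele = "nat \<Rightarrow> nat \<Rightarrow> rat" / partial: adele_rel
  by (rule part_equivp_adele_rel)

instantiation adele :: comm_ring_1
begin

lift_definition zero_adele :: adele is "\<lambda>p n. 0"
  by (simp add: adele_rel_refl adele_rep_const)

lift_definition one_adele :: adele is "\<lambda>p n. 1"
  by (simp add: adele_rel_refl adele_rep_const)

lift_definition plus_adele :: "adele \<Rightarrow> adele \<Rightarrow> adele" is "\<lambda>X Y p n. X p n + Y p n"
  unfolding adele_rel_def add_diff_add
  by (simp add: adele_rep_add padic_null_add)

lift_definition uminus_adele :: "adele \<Rightarrow> adele" is "\<lambda>X p n. - X p n"
  unfolding adele_rel_def minus_diff_minus
  using padic_null_minus adele_rep_minus by (simp del: minus_diff_eq)

lift_definition times_adele :: "adele \<Rightarrow> adele \<Rightarrow> adele" is "\<lambda>X Y p n. X p n * Y p n"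
proof -
  fix f1 f2 f3 f4 :: "nat \<Rightarrow> nat \<Rightarrow> rat"
  assume r: "adele_rel f1 f2" "adele_rel f3 f4"
  have "padic_null p (\<lambda>n. f1 p n * f3 p n - f2 p n * f4 p n)" if p: "prime p" for p
  proof -
    have "padic_null p (\<lambda>n. (f1 p n - f2 p n) * f3 p n + (f3 p n - f4 p n) * f2 p n)"
      using r p unfolding adele_rel_def adele_rep_def
      by (intro padic_null_add padic_null_mult_bounded) auto
    then show ?thesis by (simp add: algebra_simps)
  qed
  then show "adele_rel (\<lambda>p n. f1 p n * f3 p n) (\<lambda>p n. f2 p n * f4 p n)"
    using r by (simp add: adele_rel_def adele_rep_mult)
qed

definition minus_adele :: "adele \<Rightarrow> adele \<Rightarrow> adele" where "minus_adele x y = x + - y"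

instance
proof
  fix a b c :: adele
  show "a + b = b + a"
    by transfer (simp add: adele_rel_def adele_rep_add algebra_simps)
  show "(a + b) + c = a + (b + c)"
    by transfer (simp add: adele_rel_def adele_rep_add algebra_simps)
  show "0 + a = a"
    by transfer (simp add: adele_rel_def)
  show "- a + a = 0"
    by transfer (simp add: adele_rel_def adele_rep_const)
  show "a - b = a + - b"
    by (rule minus_adele_def)
  show "(a * b) * c = a * (b * c)"
    by transfer (simp add: adele_rel_def adele_rep_mult algebra_simps)
  show "a * b = b * a"
    by transfer (simp add: adele_rel_def adele_rep_mult algebra_simps)
  show "1 * a = a"
    by transfer (simp add: adele_rel_def)
  show "(a + b) * c = a * c + b * c"
    by transfer (simp add: adele_rel_def adele_rep_add adele_rep_mult algebra_simps)
  show "(0::adele) \<noteq> 1"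
  proof transfer
    have "\<not> padic_null 2 (\<lambda>n. 0 - 1)"
      using padic_abs_minus[of 2 1]
      by (auto simp: padic_null_def LIMSEQ_const_iff)
    then show "\<not> adele_rel (\<lambda>p n. 0) (\<lambda>p n. 1)"
      by (auto simp: adele_rel_def intro!: exI[of _ 2])
  qed
qed

end

lift_definition adele_of_rat :: "rat \<Rightarrow> adele" is "\<lambda>x p n. x"
  by (simp add: adele_rel_refl adele_rep_const)

lemma padic_abs_convergent:
  assumes p: "prime p" and X: "padic_Cauchy p X"
  shows "convergent (\<lambda>n. padic_abs p (X n))"
proof (rule Cauchy_convergent, rule metric_CauchyI)
  fix e :: real assume "e > 0"
  then obtain N where N: "\<forall>m\<ge>N. \<forall>n\<ge>N. padic_abs p (X m - X n) < e"
    using X unfolding padic_Cauchy_def by blast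
  show "\<exists>M. \<forall>m\<ge>M. \<forall>n\<ge>M. dist (padic_abs p (X m)) (padic_abs p (X n)) < e"
    using N padic_abs_diff_le[OF p] unfolding dist_real_def by (meson le_less_trans)
qed

text \<open>\<open>adele_abs x p\<close> is \<open>|x\<^sub>p|\<^sub>p\<close>, where \<open>x\<^sub>p\<close> is the component of \<open>x\<close> in \<open>\<rat>\<^sub>p\<close>.\<close>

lift_definition adele_abs :: "adele \<Rightarrow> nat \<Rightarrow> real" is
  "\<lambda>X p. if prime p then lim (\<lambda>n. padic_abs p (X p n)) else 0"
proof
  fix X Y :: "nat \<Rightarrow> nat \<Rightarrow> rat" and p :: nat
  assume r: "adele_rel X Y"
  show "(if prime p then lim (\<lambda>n. padic_abs p (X p n)) else 0) =
        (if prime p then lim (\<lambda>n. padic_abs p (Y p n)) else 0)"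
  proof (cases "prime p")
    case p: True
    then have X: "convergent (\<lambda>n. padic_abs p (X p n))"
      and d: "(\<lambda>n. padic_abs p (X p n - Y p n)) \<longlonglongrightarrow> 0"
      using r padic_abs_convergent unfolding adele_rel_def adele_rep_def padic_null_def by auto
    have "(\<lambda>n. padic_abs p (X p n) - padic_abs p (Y p n)) \<longlonglongrightarrow> 0"
      by (rule Lim_null_comparison[OF _ d]) (simp add: padic_abs_diff_le[OF p])
    from tendsto_diff[OF X[THEN convergent_LIMSEQ_iff[THEN iffD1]] this]
    have "(\<lambda>n. padic_abs p (Y p n)) \<longlonglongrightarrow> lim (\<lambda>n. padic_abs p (X p n))" by simp
    then show ?thesis using p by (simp add: limI)
  qed simp
qed

definition zhat :: "adele set" where
  "zhat = {x. \<forall>p. prime p \<longrightarrow> adele_abs x p \<le> 1}"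

definition zhat_units :: "adele set" where
  "zhat_units = {x. \<forall>p. prime p \<longrightarrow> adele_abs x p = 1}"

text \<open>The restricted product topology: basic neighbourhoods of \<open>x\<close> are products of balls around
  \<open>x\<^sub>p\<close> for finitely many \<open>p\<close> and of the cosets \<open>x\<^sub>p + \<int>\<^sub>p\<close> for all other \<open>p\<close>.\<close>

definition adele_nhd :: "adele \<Rightarrow> nat set \<Rightarrow> real \<Rightarrow> adele set" where
  "adele_nhd x S e =
     {y. \<forall>p. prime p \<longrightarrow> (if p \<in> S then adele_abs (y - x) p < e else adele_abs (y - x) p \<le> 1)}"

lemma adele_nhd_mono:
  assumes "S \<subseteq> T" "e \<le> d" "e \<le> 1"
  shows "adele_nhd x T e \<subseteq> adele_nhd x S d"
  using assms unfolding adele_nhd_def by (auto split: if_splits; force)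

instantiation adele :: topological_space
begin

definition open_adele :: "adele set \<Rightarrow> bool" where
  "open_adele U \<longleftrightarrow> (\<forall>x\<in>U. \<exists>S e. finite S \<and> e > 0 \<and> adele_nhd x S e \<subseteq> U)"

instance
proof
  show "open (UNIV :: adele set)"
    unfolding open_adele_def by (auto intro: exI[of _ "{}"] exI[of _ "1::real"])
next
  fix U V :: "adele set" assume U: "open U" and V: "open V"
  show "open (U \<inter> V)" unfolding open_adele_def
  proof
    fix x assume "x \<in> U \<inter> V"
    then have x: "x \<in> U" "x \<in> V" by simp_all
    obtain S d where S: "finite S" "d > 0" "adele_nhd x S d \<subseteq> U"
      using U x(1) unfolding open_adele_def by blast
    obtain T e where T: "finite T" "e > 0" "adele_nhd x T e \<subseteq> V"
      using V x(2) unfolding open_adele_def by blast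
    let ?e = "min 1 (min d e)"
    have "adele_nhd x (S \<union> T) ?e \<subseteq> adele_nhd x S d"
      by (rule adele_nhd_mono) simp_all
    moreover have "adele_nhd x (S \<union> T) ?e \<subseteq> adele_nhd x T e"
      by (rule adele_nhd_mono) simp_all
    ultimately have "adele_nhd x (S \<union> T) ?e \<subseteq> U \<inter> V"
      using S(3) T(3) by (meson Int_greatest subset_trans)
    moreover have "finite (S \<union> T)" "?e > 0" using S T by simp_all
    ultimately show "\<exists>S e. finite S \<and> e > 0 \<and> adele_nhd x S e \<subseteq> U \<inter> V"
      by (intro exI conjI)
  qed
next
  fix K :: "adele set set" assume "\<forall>U\<in>K. open U"
  then show "open (\<Union>K)" unfolding open_adele_def by (meson Sup_upper UnionE dual_order.trans)
qed

end


section \<open>The space \<open>\<Omega>\<^sub>B\<close> and the action of the affine group\<close>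

definition quotient_topology :: "'a topology \<Rightarrow> ('a \<Rightarrow> 'b) \<Rightarrow> 'b topology" where
  "quotient_topology X q =
     topology (\<lambda>U. U \<subseteq> q ` topspace X \<and> openin X {x \<in> topspace X. q x \<in> U})"

lemma openin_quotient_topology:
  "openin (quotient_topology X q) U \<longleftrightarrow>
     U \<subseteq> q ` topspace X \<and> openin X {x \<in> topspace X. q x \<in> U}"
proof -
  let ?L = "\<lambda>U. U \<subseteq> q ` topspace X \<and> openin X {x \<in> topspace X. q x \<in> U}"
  have "istopology ?L"
    unfolding istopology_def
  proof (intro conjI allI impI)
    fix S T assume S: "?L S" and T: "?L T"
    then show "S \<inter> T \<subseteq> q ` topspace X" by blast
    have "{x \<in> topspace X. q x \<in> S \<inter> T} =
        {x \<in> topspace X. q x \<in> S} \<inter> {x \<in> topspace X. q x \<in> T}" by blast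
    then show "openin X {x \<in> topspace X. q x \<in> S \<inter> T}" using S T by (simp add: openin_Int)
  next
    fix K assume K: "\<forall>S\<in>K. ?L S"
    then show "\<Union>K \<subseteq> q ` topspace X" by blast
    have "{x \<in> topspace X. q x \<in> \<Union>K} = (\<Union>S\<in>K. {x \<in> topspace X. q x \<in> S})" by blast
    then show "openin X {x \<in> topspace X. q x \<in> \<Union>K}" using K by auto
  qed
  then show ?thesis by (simp add: quotient_topology_def topology_inverse')
qed

lemma topspace_quotient_topology [simp]: "topspace (quotient_topology X q) = q ` topspace X"
proof -
  have "openin (quotient_topology X q) (q ` topspace X)"
  proof -
    have "{x \<in> topspace X. q x \<in> q ` topspace X} = topspace X" by blast
    then show ?thesis by (simp add: openin_quotient_topology)
  qed
  moreover have "topspace (quotient_topology X q) \<subseteq> q ` topspace X"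
    using openin_topspace[of "quotient_topology X q"] unfolding openin_quotient_topology by blast
  ultimately show ?thesis using openin_subset by blast
qed

definition unit_orbit :: "adele \<Rightarrow> adele set" where
  "unit_orbit a = {a * u | u. u \<in> zhat_units}"

definition adele_orbit_space :: "adele set topology" where
  "adele_orbit_space = quotient_topology euclidean unit_orbit"

definition orbit_zhat :: "adele set \<Rightarrow> adele set" where
  "orbit_zhat \<alpha> = {a * z | a z. a \<in> \<alpha> \<and> z \<in> zhat}"

text \<open>A point \<open>(r, a)\<close> is encoded as a pair of sets of adeles: the coset of \<open>r\<close> modulo \<open>a * zhat\<close>
  and the orbit of \<open>a\<close> under \<open>zhat_units\<close>.\<close>

type_synonym point = "adele set \<times> adele set"

definition Omega_proj :: "adele \<times> adele set \<Rightarrow> point" where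
  "Omega_proj = (\<lambda>(r, \<alpha>). ({r + s | s. s \<in> orbit_zhat \<alpha>}, \<alpha>))"

definition Omega_tilde :: "point topology" where
  "Omega_tilde = quotient_topology (prod_topology euclidean adele_orbit_space) Omega_proj"

definition Omega_B :: "point topology" where
  "Omega_B = subtopology Omega_tilde
     {Omega_proj (r, unit_orbit a) | r a. r \<in> zhat \<and> a \<in> zhat}"

definition affine_group :: "(rat \<times> rat) monoid" where
  "affine_group =
     \<lparr>carrier = {(m, k). k > 0}, monoid.mult = (\<lambda>(m, k) (n, l). (m + k * n, k * l)), one = (0, 1)\<rparr>"

definition affine_semigroup :: "(rat \<times> rat) set" where
  "affine_semigroup = {(of_int m, of_nat n) | m n. n > 0}"

definition act :: "rat \<times> rat \<Rightarrow> point \<Rightarrow> point" where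
  "act = (\<lambda>(m, k) (R, \<alpha>).
     ((\<lambda>r. adele_of_rat m + adele_of_rat k * r) ` R, (\<lambda>a. adele_of_rat k * a) ` \<alpha>))"

definition Omega_borel :: "point measure" where
  "Omega_borel = sigma (topspace Omega_B) {U. openin Omega_B U}"

definition scaling_probability :: "real \<Rightarrow> point measure \<Rightarrow> bool" where
  "scaling_probability \<beta> \<mu> \<longleftrightarrow>
     prob_space \<mu> \<and> sets \<mu> = sets Omega_borel \<and>
     (\<forall>Y\<in>sets Omega_borel. \<forall>(m::int) (n::nat). n > 0 \<longrightarrow>
        measure \<mu> (act (of_int m, of_nat n) ` Y) = real n powr (- \<beta>) * measure \<mu> Y)"


section \<open>C*-algebras\<close>

record 'a cstar = "'a ring" +
  scl :: "complex \<Rightarrow> 'a \<Rightarrow> 'a"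
  adj :: "'a \<Rightarrow> 'a"
  nrm :: "'a \<Rightarrow> real"

text \<open>C*-algebras need not be unital; in the non-unital case the field \<open>one\<close> is meaningless.\<close>

locale cstar_algebra = abelian_group A for A :: "'a cstar" (structure) +
  assumes mult_closed: "x \<in> carrier A \<Longrightarrow> y \<in> carrier A \<Longrightarrow> x \<otimes> y \<in> carrier A"
    and mult_assoc: "x \<in> carrier A \<Longrightarrow> y \<in> carrier A \<Longrightarrow> z \<in> carrier A \<Longrightarrow>
          (x \<otimes> y) \<otimes> z = x \<otimes> (y \<otimes> z)"
    and distrib_left: "x \<in> carrier A \<Longrightarrow> y \<in> carrier A \<Longrightarrow> z \<in> carrier A \<Longrightarrow>
          x \<otimes> (y \<oplus> z) = x \<otimes> y \<oplus> x \<otimes> z"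
    and distrib_right: "x \<in> carrier A \<Longrightarrow> y \<in> carrier A \<Longrightarrow> z \<in> carrier A \<Longrightarrow>
          (x \<oplus> y) \<otimes> z = x \<otimes> z \<oplus> y \<otimes> z"
    and scl_closed: "x \<in> carrier A \<Longrightarrow> scl A c x \<in> carrier A"
    and scl_one: "x \<in> carrier A \<Longrightarrow> scl A 1 x = x"
    and scl_scl: "x \<in> carrier A \<Longrightarrow> scl A c (scl A d x) = scl A (c * d) x"
    and scl_add_left: "x \<in> carrier A \<Longrightarrow> scl A (c + d) x = scl A c x \<oplus> scl A d x"
    and scl_add_right: "x \<in> carrier A \<Longrightarrow> y \<in> carrier A \<Longrightarrow>
          scl A c (x \<oplus> y) = scl A c x \<oplus> scl A c y"
    and scl_mult_left: "x \<in> carrier A \<Longrightarrow> y \<in> carrier A \<Longrightarrow> scl A c x \<otimes> y = scl A c (x \<otimes> y)"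
    and scl_mult_right: "x \<in> carrier A \<Longrightarrow> y \<in> carrier A \<Longrightarrow> x \<otimes> scl A c y = scl A c (x \<otimes> y)"
    and adj_closed: "x \<in> carrier A \<Longrightarrow> adj A x \<in> carrier A"
    and adj_adj: "x \<in> carrier A \<Longrightarrow> adj A (adj A x) = x"
    and adj_add: "x \<in> carrier A \<Longrightarrow> y \<in> carrier A \<Longrightarrow> adj A (x \<oplus> y) = adj A x \<oplus> adj A y"
    and adj_scl: "x \<in> carrier A \<Longrightarrow> adj A (scl A c x) = scl A (cnj c) (adj A x)"
    and adj_mult: "x \<in> carrier A \<Longrightarrow> y \<in> carrier A \<Longrightarrow> adj A (x \<otimes> y) = adj A y \<otimes> adj A x"
    and nrm_nonneg: "x \<in> carrier A \<Longrightarrow> 0 \<le> nrm A x"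
    and nrm_eq_0: "x \<in> carrier A \<Longrightarrow> nrm A x = 0 \<longleftrightarrow> x = \<zero>"
    and nrm_scl: "x \<in> carrier A \<Longrightarrow> nrm A (scl A c x) = cmod c * nrm A x"
    and nrm_add: "x \<in> carrier A \<Longrightarrow> y \<in> carrier A \<Longrightarrow> nrm A (x \<oplus> y) \<le> nrm A x + nrm A y"
    and nrm_mult: "x \<in> carrier A \<Longrightarrow> y \<in> carrier A \<Longrightarrow> nrm A (x \<otimes> y) \<le> nrm A x * nrm A y"
    and nrm_cstar: "x \<in> carrier A \<Longrightarrow> nrm A (adj A x \<otimes> x) = (nrm A x)\<^sup>2"
    and complete: "(\<And>n. X n \<in> carrier A) \<Longrightarrow>
          (\<And>e. e > 0 \<Longrightarrow> \<exists>N. \<forall>m\<ge>N. \<forall>n\<ge>N. nrm A (X m \<ominus> X n) < e) \<Longrightarrow>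
          \<exists>x\<in>carrier A. (\<lambda>n. nrm A (X n \<ominus> x)) \<longlonglongrightarrow> 0"

locale unital_cstar_algebra = cstar_algebra +
  assumes one_closed: "\<one> \<in> carrier A"
    and one_left: "x \<in> carrier A \<Longrightarrow> \<one> \<otimes> x = x"
    and one_right: "x \<in> carrier A \<Longrightarrow> x \<otimes> \<one> = x"

definition star_hom :: "'a cstar \<Rightarrow> 'b cstar \<Rightarrow> ('a \<Rightarrow> 'b) \<Rightarrow> bool" where
  "star_hom A B h \<longleftrightarrow>
     (\<forall>x\<in>carrier A. h x \<in> carrier B) \<and>
     (\<forall>x\<in>carrier A. \<forall>y\<in>carrier A. h (x \<oplus>\<^bsub>A\<^esub> y) = h x \<oplus>\<^bsub>B\<^esub> h y) \<and>
     (\<forall>x\<in>carrier A. \<forall>y\<in>carrier A. h (x \<otimes>\<^bsub>A\<^esub> y) = h x \<otimes>\<^bsub>B\<^esub> h y) \<and>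
     (\<forall>x\<in>carrier A. \<forall>c. h (scl A c x) = scl B c (h x)) \<and>
     (\<forall>x\<in>carrier A. h (adj A x) = adj B (h x))"

definition unital_star_hom :: "'a cstar \<Rightarrow> 'b cstar \<Rightarrow> ('a \<Rightarrow> 'b) \<Rightarrow> bool" where
  "unital_star_hom A B h \<longleftrightarrow> star_hom A B h \<and> h \<one>\<^bsub>A\<^esub> = \<one>\<^bsub>B\<^esub>"

definition closed_star_subalgebra :: "'a cstar \<Rightarrow> 'a set \<Rightarrow> bool" where
  "closed_star_subalgebra A T \<longleftrightarrow>
     T \<subseteq> carrier A \<and> \<zero>\<^bsub>A\<^esub> \<in> T \<and>
     (\<forall>x\<in>T. \<forall>y\<in>T. x \<oplus>\<^bsub>A\<^esub> y \<in> T \<and> x \<otimes>\<^bsub>A\<^esub> y \<in> T) \<and>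
     (\<forall>x\<in>T. adj A x \<in> T \<and> (\<forall>c. scl A c x \<in> T)) \<and>
     (\<forall>X. \<forall>x\<in>carrier A. (\<forall>n. X n \<in> T) \<and> (\<lambda>n. nrm A (X n \<ominus>\<^bsub>A\<^esub> x)) \<longlonglongrightarrow> 0 \<longrightarrow> x \<in> T)"

definition generated_by :: "'a cstar \<Rightarrow> 'a set \<Rightarrow> bool" where
  "generated_by A S \<longleftrightarrow> (\<forall>T. closed_star_subalgebra A T \<and> S \<subseteq> T \<longrightarrow> T = carrier A)"

definition state :: "'a cstar \<Rightarrow> ('a \<Rightarrow> complex) \<Rightarrow> bool" where
  "state A \<phi> \<longleftrightarrow>
     \<phi> \<in> extensional (carrier A) \<and>
     (\<forall>x\<in>carrier A. \<forall>y\<in>carrier A. \<phi> (x \<oplus>\<^bsub>A\<^esub> y) = \<phi> x + \<phi> y) \<and>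
     (\<forall>x\<in>carrier A. \<forall>c. \<phi> (scl A c x) = c * \<phi> x) \<and>
     (\<forall>x\<in>carrier A. \<phi> (adj A x \<otimes>\<^bsub>A\<^esub> x) \<in> \<real>\<^sub>\<ge>\<^sub>0) \<and>
     \<phi> \<one>\<^bsub>A\<^esub> = 1"

text \<open>Functions on a space \<open>X\<close> are represented by functions on the whole type that are zero outside
  \<open>topspace X\<close>.  In particular, a function on \<open>\<Omega>\<^sub>B\<close> is the same thing as its extension by zero.
  \<open>C_alg X\<close> is only meaningful for compact \<open>X\<close>, and the field \<open>one\<close> of \<open>C0_alg X\<close> is junk
  for non-compact \<open>X\<close>.\<close>

definition function_cstar :: "'p topology \<Rightarrow> ('p \<Rightarrow> complex) set \<Rightarrow> ('p \<Rightarrow> complex) cstar" where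
  "function_cstar X F =
     \<lparr>carrier = F, monoid.mult = (\<lambda>f g x. f x * g x), one = indicator (topspace X),
      zero = (\<lambda>x. 0), add = (\<lambda>f g x. f x + g x),
      scl = (\<lambda>c f x. c * f x), adj = (\<lambda>f x. cnj (f x)),
      nrm = (\<lambda>f. SUP x\<in>topspace X. cmod (f x))\<rparr>"

definition C_alg :: "'p topology \<Rightarrow> ('p \<Rightarrow> complex) cstar" where
  "C_alg X = function_cstar X
     {f. continuous_map X euclidean f \<and> (\<forall>x. x \<notin> topspace X \<longrightarrow> f x = 0)}"

definition C0_alg :: "'p topology \<Rightarrow> ('p \<Rightarrow> complex) cstar" where
  "C0_alg X = function_cstar X
     {f. continuous_map X euclidean f \<and> (\<forall>x. x \<notin> topspace X \<longrightarrow> f x = 0) \<and>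
         (\<forall>e>0. \<exists>K. compactin X K \<and> (\<forall>x\<in>topspace X - K. cmod (f x) < e))}"


section \<open>The crossed products\<close>

text \<open>\<open>translate g f\<close> is \<open>f(g\<^sup>-\<^sup>1 \<cdot>)\<close>.  If \<open>f\<close> is zero outside \<open>\<Omega>\<^sub>B\<close>, then \<open>translate x f\<close> is zero
  outside \<open>x\<Omega>\<^sub>B\<close>.\<close>

definition translate :: "rat \<times> rat \<Rightarrow> (point \<Rightarrow> complex) \<Rightarrow> point \<Rightarrow> complex" where
  "translate g f = (\<lambda>\<omega>. f (act (inv\<^bsub>affine_group\<^esub> g) \<omega>))"

definition semigroup_covariant ::
  "'a cstar \<Rightarrow> ((point \<Rightarrow> complex) \<Rightarrow> 'a) \<Rightarrow> (rat \<times> rat \<Rightarrow> 'a) \<Rightarrow> bool" where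
  "semigroup_covariant A \<iota> v \<longleftrightarrow>
     unital_star_hom (C_alg Omega_B) A \<iota> \<and>
     (\<forall>x\<in>affine_semigroup. v x \<in> carrier A \<and> adj A (v x) \<otimes>\<^bsub>A\<^esub> v x = \<one>\<^bsub>A\<^esub>) \<and>
     (\<forall>x\<in>affine_semigroup. \<forall>y\<in>affine_semigroup. v x \<otimes>\<^bsub>A\<^esub> v y = v (x \<otimes>\<^bsub>affine_group\<^esub> y)) \<and>
     (\<forall>x\<in>affine_semigroup. \<forall>f\<in>carrier (C_alg Omega_B).
        v x \<otimes>\<^bsub>A\<^esub> \<iota> f \<otimes>\<^bsub>A\<^esub> adj A (v x) = \<iota> (translate x f))"

text \<open>
  The crossed products are characterised by their universal properties, which determine them up to
  isomorphism.  The algebra \<open>B\<close> in the universal property ranges over all C*-algebras whose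
  underlying set is a set of reals.  This is no restriction: \<open>B\<close> may be replaced by the
  C*-subalgebra generated by the given data, which is separable (both spaces are second countable
  and the group is countable), so has at most the cardinality of the continuum.
\<close>

definition semigroup_crossed_product ::
  "'a cstar \<Rightarrow> ((point \<Rightarrow> complex) \<Rightarrow> 'a) \<Rightarrow> (rat \<times> rat \<Rightarrow> 'a) \<Rightarrow> bool" where
  "semigroup_crossed_product A \<iota> v \<longleftrightarrow>
     unital_cstar_algebra A \<and> semigroup_covariant A \<iota> v \<and>
     generated_by A (\<iota> ` carrier (C_alg Omega_B) \<union> v ` affine_semigroup) \<and>
     (\<forall>(B :: real cstar) \<iota>' v'. unital_cstar_algebra B \<and> semigroup_covariant B \<iota>' v' \<longrightarrow>
        (\<exists>h. unital_star_hom A B h \<and>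
             (\<forall>f\<in>carrier (C_alg Omega_B). h (\<iota> f) = \<iota>' f) \<and>
             (\<forall>x\<in>affine_semigroup. h (v x) = v' x)))"

text \<open>
  As \<open>C\<^sub>0\<close> of the non-compact space is not unital, the implementing unitaries \<open>u\<^sub>g\<close> are only
  multipliers of the group crossed product.  It is therefore presented by its elements
  \<open>w g f = f u\<^sub>g\<close>: the relations below say that \<open>w\<close> defines a *-homomorphism of the convolution
  algebra of finitely supported functions \<open>G \<rightarrow> C\<^sub>0\<close>, whose enveloping C*-algebra is the crossed
  product.
\<close>

definition group_covariant ::
  "'a cstar \<Rightarrow> (rat \<times> rat \<Rightarrow> (point \<Rightarrow> complex) \<Rightarrow> 'a) \<Rightarrow> bool" where
  "group_covariant A w \<longleftrightarrow>
     (\<forall>g\<in>carrier affine_group. \<forall>f\<in>carrier (C0_alg Omega_tilde).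
        w g f \<in> carrier A \<and>
        (\<forall>c. w g (\<lambda>\<omega>. c * f \<omega>) = scl A c (w g f)) \<and>
        (\<forall>h\<in>carrier (C0_alg Omega_tilde). w g (\<lambda>\<omega>. f \<omega> + h \<omega>) = w g f \<oplus>\<^bsub>A\<^esub> w g h) \<and>
        (\<forall>k\<in>carrier affine_group. \<forall>h\<in>carrier (C0_alg Omega_tilde).
           w g f \<otimes>\<^bsub>A\<^esub> w k h = w (g \<otimes>\<^bsub>affine_group\<^esub> k) (\<lambda>\<omega>. f \<omega> * translate g h \<omega>)) \<and>
        adj A (w g f) =
          w (inv\<^bsub>affine_group\<^esub> g) (translate (inv\<^bsub>affine_group\<^esub> g) (\<lambda>\<omega>. cnj (f \<omega>))))"

definition group_crossed_product ::
  "'a cstar \<Rightarrow> (rat \<times> rat \<Rightarrow> (point \<Rightarrow> complex) \<Rightarrow> 'a) \<Rightarrow> bool" where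
  "group_crossed_product A w \<longleftrightarrow>
     cstar_algebra A \<and> group_covariant A w \<and>
     generated_by A {w g f | g f. g \<in> carrier affine_group \<and> f \<in> carrier (C0_alg Omega_tilde)} \<and>
     (\<forall>(B :: real cstar) w'. cstar_algebra B \<and> group_covariant B w' \<longrightarrow>
        (\<exists>h. star_hom A B h \<and>
             (\<forall>g\<in>carrier affine_group. \<forall>f\<in>carrier (C0_alg Omega_tilde). h (w g f) = w' g f)))"

text \<open>The canonical identification of the semigroup crossed product with a corner of the group
  crossed product; note \<open>u\<^sub>x 1\<^sub>\<Omega> = (translate x 1\<^sub>\<Omega>) u\<^sub>x\<close>.\<close>

definition corner_identification ::
  "'a cstar \<Rightarrow> ((point \<Rightarrow> complex) \<Rightarrow> 'a) \<Rightarrow> (rat \<times> rat \<Rightarrow> 'a) \<Rightarrow>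
   'b cstar \<Rightarrow> (rat \<times> rat \<Rightarrow> (point \<Rightarrow> complex) \<Rightarrow> 'b) \<Rightarrow> ('a \<Rightarrow> 'b) \<Rightarrow> bool" where
  "corner_identification A \<iota> v C w \<pi> \<longleftrightarrow>
     star_hom A C \<pi> \<and>
     (let p = w \<one>\<^bsub>affine_group\<^esub> (indicator (topspace Omega_B))
      in bij_betw \<pi> (carrier A) {p \<otimes>\<^bsub>C\<^esub> c \<otimes>\<^bsub>C\<^esub> p | c. c \<in> carrier C}) \<and>
     (\<forall>f\<in>carrier (C_alg Omega_B). \<pi> (\<iota> f) = w \<one>\<^bsub>affine_group\<^esub> f) \<and>
     (\<forall>x\<in>affine_semigroup. \<pi> (v x) = w x (translate x (indicator (topspace Omega_B))))"

definition canonical_expectation ::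
  "'a cstar \<Rightarrow> (rat \<times> rat \<Rightarrow> (point \<Rightarrow> complex) \<Rightarrow> 'a) \<Rightarrow> ('a \<Rightarrow> point \<Rightarrow> complex) \<Rightarrow> bool" where
  "canonical_expectation A w E \<longleftrightarrow>
     (\<forall>x\<in>carrier A. E x \<in> carrier (C0_alg Omega_tilde) \<and> nrm (C0_alg Omega_tilde) (E x) \<le> nrm A x) \<and>
     (\<forall>x\<in>carrier A. \<forall>y\<in>carrier A. E (x \<oplus>\<^bsub>A\<^esub> y) = (\<lambda>\<omega>. E x \<omega> + E y \<omega>)) \<and>
     (\<forall>x\<in>carrier A. \<forall>c. E (scl A c x) = (\<lambda>\<omega>. c * E x \<omega>)) \<and>
     (\<forall>g\<in>carrier affine_group. \<forall>f\<in>carrier (C0_alg Omega_tilde).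
        E (w g f) = (if g = \<one>\<^bsub>affine_group\<^esub> then f else (\<lambda>\<omega>. 0)))"

text \<open>Restricted to the corner, i.e. composed with \<open>\<pi>\<close>, the expectation \<open>E\<close> takes values in
  \<open>C(\<Omega>\<^sub>B)\<close>.\<close>

definition factors_through_expectation ::
  "'a cstar \<Rightarrow> ('a \<Rightarrow> 'b) \<Rightarrow> ('b \<Rightarrow> point \<Rightarrow> complex) \<Rightarrow> ('a \<Rightarrow> complex) \<Rightarrow> bool" where
  "factors_through_expectation A \<pi> E \<phi> \<longleftrightarrow>
     (\<exists>\<psi>. state (C_alg Omega_B) \<psi> \<and> (\<forall>a\<in>carrier A. \<phi> a = \<psi> (E (\<pi> a))))"


section \<open>Dynamics and KMS states\<close>

text \<open>The values on the generators determine \<open>\<sigma>\<close>, and imply that it is a strongly continuous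
  one-parameter group of automorphisms.\<close>

definition crossed_dynamics ::
  "'a cstar \<Rightarrow> ((point \<Rightarrow> complex) \<Rightarrow> 'a) \<Rightarrow> (rat \<times> rat \<Rightarrow> 'a) \<Rightarrow> (real \<Rightarrow> 'a \<Rightarrow> 'a) \<Rightarrow> bool" where
  "crossed_dynamics A \<iota> v \<sigma> \<longleftrightarrow>
     (\<forall>t. unital_star_hom A A (\<sigma> t) \<and>
          (\<forall>f\<in>carrier (C_alg Omega_B). \<sigma> t (\<iota> f) = \<iota> f) \<and>
          (\<forall>(m::int) (k::nat). k > 0 \<longrightarrow>
             \<sigma> t (v (of_int m, of_nat k)) =
               scl A (of_nat k powr (\<i> * of_real t)) (v (of_int m, of_nat k))))"

definition entire_extension ::
  "'a cstar \<Rightarrow> (real \<Rightarrow> 'a \<Rightarrow> 'a) \<Rightarrow> 'a \<Rightarrow> (complex \<Rightarrow> 'a) \<Rightarrow> bool" where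
  "entire_extension A \<sigma> x F \<longleftrightarrow>
     (\<forall>z. F z \<in> carrier A) \<and> (\<forall>t. F (of_real t) = \<sigma> t x) \<and>
     (\<forall>z. \<exists>D\<in>carrier A.
        ((\<lambda>h. nrm A (scl A (1 / h) (F (z + h) \<ominus>\<^bsub>A\<^esub> F z) \<ominus>\<^bsub>A\<^esub> D)) \<longlongrightarrow> 0) (at 0))"

definition KMS_state ::
  "'a cstar \<Rightarrow> (real \<Rightarrow> 'a \<Rightarrow> 'a) \<Rightarrow> real \<Rightarrow> ('a \<Rightarrow> complex) \<Rightarrow> bool" where
  "KMS_state A \<sigma> \<beta> \<phi> \<longleftrightarrow>
     state A \<phi> \<and> (\<forall>t. \<forall>a\<in>carrier A. \<phi> (\<sigma> t a) = \<phi> a) \<and>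
     (\<forall>x\<in>carrier A. \<forall>y\<in>carrier A. \<forall>F F'.
        entire_extension A \<sigma> x F \<and> entire_extension A \<sigma> y F' \<longrightarrow>
        \<phi> (x \<otimes>\<^bsub>A\<^esub> y) = \<phi> (y \<otimes>\<^bsub>A\<^esub> F (\<i> * of_real \<beta>)))"

end

theory Submission
  imports
    Defs
    "HOL-Complex_Analysis.Complex_Analysis"
    "HOL-Number_Theory.Number_Theory"
begin

text \<open>
  For \<open>m\<close> in \<open>\<int>\<close> and \<open>n \<ge> 1\<close>, the set \<open>(m, n)\<Omega>\<^sub>B\<close> consists of the points \<open>(r, a)\<close> with \<open>n\<close> dividing \<open>a\<close>
  and \<open>r \<equiv> m\<close> modulo \<open>n\<close>.  By the Chinese remainder theorem these sets, together with the empty set,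
  are closed under intersections; they are clopen and generate the topology of the compact space
  \<open>\<Omega>\<^sub>B\<close> in the sense that finitely many of them cut out a neighbourhood base.  The scaling condition
  is therefore equivalent to \<open>\<mu>((m, n)\<Omega>\<^sub>B) = n powr - \<beta>\<close>, which gives uniqueness, and \<open>\<beta> \<ge> 1\<close> because \<open>(0, 2)\<Omega>\<^sub>B\<close>
  and \<open>(1, 2)\<Omega>\<^sub>B\<close> are disjoint.  For \<open>\<beta> \<ge> 1\<close> the measure is the law of the class of a random pair
  \<open>(r, a)\<close> with \<open>r\<close> distributed according to the Haar measure, given by independent uniform digits in
  the factorial number system, and \<open>a\<close> an independent product of prime powers whose exponents are
  independent and geometrically distributed (and infinite for \<open>\<beta> = 1\<close>).

  The same argument applied to the projections \<open>v\<^sub>x v\<^sub>x\<^sup>*\<close> shows that a KMS state has \<open>\<beta> \<ge> 1\<close> and restricts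
  on \<open>C(\<Omega>\<^sub>B)\<close> to the unique scaling state \<open>\<psi>\<close>.  Conversely \<open>\<phi> = \<psi> \<circ> E \<circ> \<pi>\<close> is a state, as \<open>E(c\<^sup>* c) \<ge> 0\<close> holds
  for finite sums of the elements \<open>f u\<^sub>g\<close>.  States are automatically bounded, so identities for \<open>\<phi>\<close> need
  to be checked only for the elements that \<open>\<pi>\<close> maps to some \<open>f u\<^sub>g\<close>, whose linear span is dense.  If \<open>y\<close> is
  such an element, with \<open>\<sigma>\<^sub>t(y) = k powr (it) \<cdot> y\<close>, then \<open>\<sigma>\<close>-invariance shows that the entire function
  \<open>\<phi>(y \<sigma>\<^sub>z(x))\<close> equals \<open>k powr (-iz) \<cdot> \<phi>(y x)\<close> for real \<open>z\<close>, hence for all \<open>z\<close>.  For \<open>z = i\<beta>\<close> this reduces the KMS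
  condition to \<open>\<phi>(x y) = k powr \<beta> \<cdot> \<phi>(y x)\<close>, which is the scaling property of \<open>\<psi>\<close>.
\<close>

section \<open>Arithmetic of the finite adeles\<close>

text \<open>The delicate point is the neighbourhood base. A point remembers a only up to units of
  zhat and r only modulo a zhat, and the sets (m, n)Omega_B with n dividing N see no more than d =
  gcd(a, N) and r modulo d. They suffice because two elements a, a' with the same d agree modulo N
  up to a unit of zhat: units modulo N/d lift, with component 1 at the primes not dividing N/d. The
  law of the exponents is dictated by n powr (-beta) = (1/n) n powr (1 - beta). Haar measure gives a
  residue class modulo n the mass 1/n, so the event that n divides a has to get the mass n powr (1 -
  beta), which independence over the primes reduces to prime powers. On the algebra side sigma is
  prescribed on generators only, and E only on the elements f u_g. Identities are therefore tested
  on elements that are eigenvectors of sigma and are mapped to a single f u_g, both for the same g.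
  Unlike the generators, these elements are closed under products and adjoints.\<close>

lemma multiplicity_int_int: "multiplicity (int p) (int n) = multiplicity p n"
  unfolding multiplicity_def by (simp flip: of_nat_power)

lemma padic_abs_of_int:
  assumes p: "prime p" and j: "j \<noteq> 0"
  shows "padic_abs p (of_int j) = 1 / real p ^ multiplicity (int p) j"
proof -
  have "padic_val p (of_int j) = int (multiplicity (int p) j)"
    using padic_val_divide[OF p j, of 1] by simp
  then show ?thesis using j by (simp add: padic_abs_def power_int_minus field_simps)
qed

lemma padic_abs_of_nat:
  assumes p: "prime p" and n: "n > 0"
  shows "padic_abs p (of_nat n) = 1 / real p ^ multiplicity p n"
proof -
  have "multiplicity (int p) (int n) = multiplicity p n"
    by (simp add: multiplicity_int_int)
  then show ?thesis using padic_abs_of_int[OF p, of "int n"] n by simp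
qed

lemma padic_abs_of_int_le_1: "prime p \<Longrightarrow> padic_abs p (of_int j) \<le> 1"
  using padic_abs_rat_le_1[of p "of_int j"] by (auto dest: prime_gt_1_nat simp: zdvd1_eq)

lemma padic_abs_pos: "prime p \<Longrightarrow> x \<noteq> 0 \<Longrightarrow> padic_abs p x > 0"
  by (auto simp: padic_abs_def dest: prime_gt_0_nat)

lemma padic_abs_prime: "prime p \<Longrightarrow> padic_abs p (of_nat p) = 1 / real p"
  using padic_abs_of_nat[of p p] by (simp add: prime_gt_0_nat)

text \<open>The bound is uniform in p, so one exponent j makes p^j small at finitely many primes at
  once (\<open>open_adele_iff\<close>).\<close>

lemma padic_abs_le_power_dvd:
  assumes p: "prime p" and n: "n > 0" "p ^ j dvd n"
  shows "padic_abs p (of_nat n) \<le> (1 / 2) ^ j"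
proof -
  have "j \<le> multiplicity p n" using n p by (intro multiplicity_geI) auto
  then have "(1 / real p) ^ multiplicity p n \<le> (1 / real p) ^ j"
    using prime_gt_1_nat[OF p] by (intro power_decreasing) auto
  also have "\<dots> \<le> (1 / 2) ^ j"
    using prime_ge_2_nat[OF p] by (intro power_mono) (auto simp: field_simps)
  finally show ?thesis by (simp add: padic_abs_of_nat[OF p n(1)] power_divide)
qed

lemma padic_abs_of_int_le_iff:
  assumes p: "prime p" and n: "n > 0"
  shows "padic_abs p (of_int j) \<le> padic_abs p (of_nat n) \<longleftrightarrow>
    j = 0 \<or> multiplicity p n \<le> multiplicity (int p) j"
proof (cases "j = 0")
  case False
  then show ?thesis using prime_gt_1_nat[OF p]
    by (simp add: padic_abs_of_int[OF p] padic_abs_of_nat[OF p n] field_simps)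
qed simp

text \<open>Identities and inequalities for \<open>adele_abs\<close> follow from those for
  \<open>padic_abs\<close> by passing to the limit along such a representative.\<close>

lemma adele_obtain_rep:
  obtains X where "adele_rep X" "x = abs_adele X"
    "\<And>p. prime p \<Longrightarrow> (\<lambda>n. padic_abs p (X p n)) \<longlonglongrightarrow> adele_abs x p"
proof -
  define X where "X = rep_adele x"
  have 1: "adele_rel X X" unfolding X_def by (rule Quotient_rep_reflp[OF Quotient_adele])
  then have r: "adele_rep X" by (simp add: adele_rel_def)
  have x: "x = abs_adele X" unfolding X_def
    using Quotient_abs_rep[OF Quotient_adele, of x] by simp
  have "(\<lambda>n. padic_abs p (X p n)) \<longlonglongrightarrow> adele_abs x p" if p: "prime p" for p
  proof -
    have "adele_abs x p = lim (\<lambda>n. padic_abs p (X p n))"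
      using adele_abs.abs_eq[OF 1] p x by simp
    then show ?thesis
      using padic_abs_convergent[OF p, of "X p"] r p
      by (simp add: adele_rep_def convergent_LIMSEQ_iff)
  qed
  with r x show ?thesis using that by blast
qed

lemma adele_abs_eqI:
  assumes "adele_rep X" "prime p" "(\<lambda>n. padic_abs p (X p n)) \<longlonglongrightarrow> L"
  shows "adele_abs (abs_adele X) p = L"
  using adele_abs.abs_eq[of X] adele_rel_refl[OF assms(1)] assms(2,3) limI by auto

lemma adele_abs_mult: "adele_abs (x * y) p = adele_abs x p * adele_abs y p"
proof (cases "prime p")
  case False then show ?thesis by transfer simp
next
  case p: True
  obtain X where X: "adele_rep X" "x = abs_adele X" "(\<lambda>n. padic_abs p (X p n)) \<longlonglongrightarrow> adele_abs x p"
    using adele_obtain_rep[of x] p by metis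
  obtain Y where Y: "adele_rep Y" "y = abs_adele Y" "(\<lambda>n. padic_abs p (Y p n)) \<longlonglongrightarrow> adele_abs y p"
    using adele_obtain_rep[of y] p by metis
  have "x * y = abs_adele (\<lambda>p n. X p n * Y p n)"
    using X Y by (simp add: times_adele.abs_eq adele_rel_refl)
  then show ?thesis
    using adele_abs_eqI[OF adele_rep_mult[OF X(1) Y(1)] p] tendsto_mult[OF X(3) Y(3)]
    by (simp add: padic_abs_mult[OF p])
qed

lemma adele_abs_add: "adele_abs (x + y) p \<le> max (adele_abs x p) (adele_abs y p)"
proof (cases "prime p")
  case False then show ?thesis by transfer simp
next
  case p: True
  obtain X where X: "adele_rep X" "x = abs_adele X" "(\<lambda>n. padic_abs p (X p n)) \<longlonglongrightarrow> adele_abs x p"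
    using adele_obtain_rep[of x] p by metis
  obtain Y where Y: "adele_rep Y" "y = abs_adele Y" "(\<lambda>n. padic_abs p (Y p n)) \<longlonglongrightarrow> adele_abs y p"
    using adele_obtain_rep[of y] p by metis
  obtain Z where Z: "(\<lambda>n. padic_abs p (X p n + Y p n)) \<longlonglongrightarrow> adele_abs (x + y) p"
  proof -
    have r: "adele_rep (\<lambda>p n. X p n + Y p n)" by (rule adele_rep_add[OF X(1) Y(1)])
    have "x + y = abs_adele (\<lambda>p n. X p n + Y p n)"
      using X Y by (simp add: plus_adele.abs_eq adele_rel_refl)
    then have "adele_abs (x + y) p = lim (\<lambda>n. padic_abs p (X p n + Y p n))"
      using adele_abs.abs_eq[of "\<lambda>p n. X p n + Y p n"] adele_rel_refl[OF r] p by simp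
    then show ?thesis using that padic_abs_convergent[OF p, of "\<lambda>n. X p n + Y p n"] r p
      by (simp add: adele_rep_def convergent_LIMSEQ_iff)
  qed
  show ?thesis
    by (rule LIMSEQ_le[OF Z tendsto_max[OF X(3) Y(3)]]) (auto intro: padic_abs_ultrametric[OF p])
qed

lemma adele_abs_nonneg [simp]: "0 \<le> adele_abs x p"
proof (cases "prime p")
  case False then show ?thesis by transfer simp
next
  case p: True
  obtain X where X: "(\<lambda>n. padic_abs p (X p n)) \<longlonglongrightarrow> adele_abs x p"
    using adele_obtain_rep[of x] p by metis
  show ?thesis by (rule LIMSEQ_le_const[OF X]) simp
qed

section \<open>The diagonal embedding of the rationals\<close>

lemma adele_of_rat_add: "adele_of_rat (a + b) = adele_of_rat a + adele_of_rat b"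
  by transfer (simp add: adele_rel_refl adele_rep_const)

lemma adele_of_rat_mult: "adele_of_rat (a * b) = adele_of_rat a * adele_of_rat b"
  by transfer (simp add: adele_rel_refl adele_rep_const)

lemma adele_of_rat_minus: "adele_of_rat (- a) = - adele_of_rat a"
  by transfer (simp add: adele_rel_refl adele_rep_const)

lemma adele_of_rat_0 [simp]: "adele_of_rat 0 = 0"
  by transfer (simp add: adele_rel_refl adele_rep_const)

lemma adele_of_rat_1 [simp]: "adele_of_rat 1 = 1"
  by transfer (simp add: adele_rel_refl adele_rep_const)

lemma adele_of_rat_diff: "adele_of_rat (a - b) = adele_of_rat a - adele_of_rat b"
  using adele_of_rat_add[of a "- b"] by (simp add: adele_of_rat_minus)

lemma adele_of_rat_of_nat [simp]: "adele_of_rat (of_nat n) = of_nat n"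
  by (induction n) (simp_all add: adele_of_rat_add)

lemma adele_of_rat_of_int [simp]: "adele_of_rat (of_int n) = of_int n"
  by (cases n rule: int_cases2) (simp_all add: adele_of_rat_minus)

lemma adele_abs_of_rat [simp]: "prime p \<Longrightarrow> adele_abs (adele_of_rat x) p = padic_abs p x"
  by transfer simp

lemma adele_abs_of_int: "prime p \<Longrightarrow> adele_abs (of_int j) p = padic_abs p (of_int j)"
  using adele_abs_of_rat[of p "of_int j"] by (simp del: adele_abs_of_rat)

lemma adele_abs_of_nat: "prime p \<Longrightarrow> adele_abs (of_nat j) p = padic_abs p (of_nat j)"
  using adele_abs_of_rat[of p "of_nat j"] by (simp del: adele_abs_of_rat)

lemma adele_abs_0 [simp]: "adele_abs 0 p = 0"
  by transfer simp

lemma adele_abs_1 [simp]: "prime p \<Longrightarrow> adele_abs 1 p = 1"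
  using adele_abs_of_rat[of p 1] by simp

lemma adele_abs_minus [simp]: "adele_abs (- x) p = adele_abs x p"
proof (cases "prime p")
  case False then show ?thesis by transfer simp
next
  case p: True
  have "adele_abs (- 1) p = 1"
    using adele_abs_of_rat[OF p, of "- 1"] padic_abs_minus[OF p, of 1] p
    by (simp add: adele_of_rat_minus del: adele_abs_of_rat)
  then show ?thesis using adele_abs_mult[of "- 1" x p] by simp
qed

lemma adele_abs_diff: "adele_abs (x - y) p \<le> max (adele_abs x p) (adele_abs y p)"
  using adele_abs_add[of x "- y" p] by simp

lemma adele_abs_diff_commute: "adele_abs (x - y) p = adele_abs (y - x) p"
  using adele_abs_minus[of "x - y" p] by simp

text \<open>In an ultrametric, terms whose values exceed L/2 and whose mutual distances stay below
  L/2 all have the same value. This permits termwise inversion in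
  \<open>zhat_units_inverse\<close>.\<close>

lemma padic_abs_eventually_const:
  assumes p: "prime p" and X: "padic_Cauchy p X" and L: "(\<lambda>n. padic_abs p (X n)) \<longlonglongrightarrow> L" "L > 0"
  shows "\<forall>\<^sub>F n in sequentially. padic_abs p (X n) = L"
proof -
  have "\<forall>\<^sub>F n in sequentially. padic_abs p (X n) > L / 2"
    using L by (intro order_tendstoD) auto
  then obtain N1 where N1: "\<And>n. n \<ge> N1 \<Longrightarrow> padic_abs p (X n) > L / 2"
    unfolding eventually_sequentially by blast
  obtain N2 where N2: "\<And>m n. m \<ge> N2 \<Longrightarrow> n \<ge> N2 \<Longrightarrow> padic_abs p (X m - X n) < L / 2"
    using X L(2) unfolding padic_Cauchy_def by (meson half_gt_zero)
  define N where "N = max N1 N2"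
  have le: "padic_abs p (X m) \<le> padic_abs p (X n)" if "m \<ge> N" "n \<ge> N" for m n
    using padic_abs_ultrametric[OF p, of "X m - X n" "X n"] N1[of n] N1[of m] N2[of m n] that
    by (auto simp: N_def)
  have "padic_abs p (X n) = padic_abs p (X N)" if "n \<ge> N" for n
    using le[of n N] le[of N n] that by force
  then have ev: "\<forall>\<^sub>F n in sequentially. padic_abs p (X n) = padic_abs p (X N)"
    unfolding eventually_sequentially by blast
  then have "(\<lambda>n. padic_abs p (X n)) \<longlonglongrightarrow> padic_abs p (X N)"
    by (rule tendsto_eventually)
  then have "L = padic_abs p (X N)" using L(1) LIMSEQ_unique by blast
  then show ?thesis using ev by simp
qed

text \<open>Nonzero values are integer powers of p, so none lies strictly between 1/p and 1.\<close>

lemma padic_abs_lt_iff: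
  assumes p: "prime p" and n: "padic_abs p x < 1"
  shows "padic_abs p x \<le> 1 / real p"
proof (cases "x = 0")
  case False
  have p1: "real p > 1" using prime_gt_1_nat[OF p] by simp
  have "real p powi (- padic_val p x) < real p powi 0"
    using n False by (simp add: padic_abs_def)
  then have "- padic_val p x < 0"
    using p1 by (smt (verit) power_int_increasing)
  then have "- padic_val p x \<le> - 1" by simp
  then have "real p powi (- padic_val p x) \<le> real p powi (- 1)"
    using p1 by (intro power_int_increasing) auto
  then show ?thesis using False by (simp add: padic_abs_def power_int_minus field_simps)
qed simp

lemma adele_abs_lt_1:
  assumes p: "prime p" and n: "adele_abs x p < 1"
  shows "adele_abs x p \<le> 1 / real p"
proof -
  obtain X where X: "(\<lambda>n. padic_abs p (X p n)) \<longlonglongrightarrow> adele_abs x p"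
    using adele_obtain_rep[of x] p by metis
  have "\<forall>\<^sub>F n in sequentially. padic_abs p (X p n) < 1"
    by (rule order_tendstoD(2)[OF X n])
  then have "\<forall>\<^sub>F n in sequentially. padic_abs p (X p n) \<le> 1 / real p"
    by eventually_elim (rule padic_abs_lt_iff[OF p])
  then show ?thesis by (intro tendsto_upperbound[OF X]) auto
qed

section \<open>The fractional ideals k zhat and congruences modulo n\<close>

definition zideal :: "rat \<Rightarrow> adele set" where
  "zideal k = {x. \<forall>p. prime p \<longrightarrow> adele_abs x p \<le> padic_abs p k}"

lemma zidealD: "x \<in> zideal k \<Longrightarrow> prime p \<Longrightarrow> adele_abs x p \<le> padic_abs p k"
  by (simp add: zideal_def)

lemma zideal_1: "zideal 1 = zhat" by (auto simp: zideal_def zhat_def)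

lemma zideal_0 [simp]: "0 \<in> zideal k" by (simp add: zideal_def)

lemma zideal_add: "x \<in> zideal k \<Longrightarrow> y \<in> zideal k \<Longrightarrow> x + y \<in> zideal k"
  unfolding zideal_def by (fastforce intro: order_trans[OF adele_abs_add])

lemma zideal_minus [simp]: "- x \<in> zideal k \<longleftrightarrow> x \<in> zideal k"
  by (simp add: zideal_def)

lemma zideal_diff: "x \<in> zideal k \<Longrightarrow> y \<in> zideal k \<Longrightarrow> x - y \<in> zideal k"
  using zideal_add[of x k "- y"] by simp

lemma zideal_mult: "x \<in> zideal k \<Longrightarrow> y \<in> zideal l \<Longrightarrow> x * y \<in> zideal (k * l)"
  by (auto simp: zideal_def adele_abs_mult padic_abs_mult intro: mult_mono)

lemma zhat_0 [simp]: "0 \<in> zhat" and zhat_1 [simp]: "1 \<in> zhat"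
  by (simp_all add: zhat_def)

lemma zhat_add: "x \<in> zhat \<Longrightarrow> y \<in> zhat \<Longrightarrow> x + y \<in> zhat"
  using zideal_add[of x 1 y] unfolding zideal_1 by blast

lemma zhat_diff: "x \<in> zhat \<Longrightarrow> y \<in> zhat \<Longrightarrow> x - y \<in> zhat"
  using zideal_diff[of x 1 y] unfolding zideal_1 by blast

lemma zhat_mult: "x \<in> zhat \<Longrightarrow> y \<in> zhat \<Longrightarrow> x * y \<in> zhat"
  using zideal_mult[of x 1 y 1] by (simp add: zideal_1)

lemma zhat_minus [simp]: "- x \<in> zhat \<longleftrightarrow> x \<in> zhat"
  using zideal_minus[of x 1] unfolding zideal_1 by blast

lemma zhat_of_int [simp]: "of_int j \<in> zhat"
  by (simp add: zhat_def adele_abs_of_int padic_abs_of_int_le_1)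

lemma zhat_of_nat [simp]: "of_nat j \<in> zhat"
  using zhat_of_int[of "int j"] by simp

lemma zideal_mult_zhat: "x \<in> zideal k \<Longrightarrow> y \<in> zhat \<Longrightarrow> x * y \<in> zideal k"
  using zideal_mult[of x k y 1] by (simp add: zideal_1)

lemma adele_of_rat_cancel: "k \<noteq> 0 \<Longrightarrow> adele_of_rat (inverse k) * (adele_of_rat k * x) = x"
  by (metis adele_of_rat_1 adele_of_rat_mult left_inverse mult.assoc mult_1)

lemma adele_of_rat_cancel': "k \<noteq> 0 \<Longrightarrow> adele_of_rat k * (adele_of_rat (inverse k) * x) = x"
  using adele_of_rat_cancel[of "inverse k" x] by simp

lemma adele_of_rat_mult_eq_iff [simp]:
  "k \<noteq> 0 \<Longrightarrow> adele_of_rat k * x = adele_of_rat k * y \<longleftrightarrow> x = y"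
  by (metis adele_of_rat_cancel)

lemma zideal_mult_iff: "k \<noteq> 0 \<Longrightarrow> adele_of_rat k * x \<in> zideal (k * l) \<longleftrightarrow> x \<in> zideal l"
  by (simp add: zideal_def adele_abs_mult padic_abs_mult padic_abs_pos)

text \<open>Dividing by k turns the local bounds of \<open>zideal\<close> into those of zhat. Both
  forms are used below: bounds can be checked one prime at a time, multiples can be substituted into
  formulas.\<close>

lemma zideal_iff:
  assumes "k \<noteq> 0" shows "x \<in> zideal k \<longleftrightarrow> (\<exists>z\<in>zhat. x = adele_of_rat k * z)"
proof
  assume "x \<in> zideal k"
  then have "adele_of_rat (inverse k) * x \<in> zhat"
    using zideal_mult_iff[of k "adele_of_rat (inverse k) * x" 1] assms
    by (simp add: adele_of_rat_cancel' zideal_1)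
  then show "\<exists>z\<in>zhat. x = adele_of_rat k * z"
    using adele_of_rat_cancel'[OF assms] by metis
next
  assume "\<exists>z\<in>zhat. x = adele_of_rat k * z"
  then show "x \<in> zideal k" using zideal_mult_iff[of k _ 1] assms by (auto simp: zideal_1)
qed

lemma zideal_nat_iff:
  "n > 0 \<Longrightarrow> x \<in> zideal (of_nat n) \<longleftrightarrow> (\<exists>z\<in>zhat. x = of_nat n * z)"
  using zideal_iff[of "of_nat n" x] by simp

lemma zideal_coset_subset:
  assumes "n > 0" "\<And>z. z \<in> zhat \<Longrightarrow> x + of_nat n * z \<in> U" "y - x \<in> zideal (of_nat n)"
  shows "y \<in> U"
proof -
  obtain z where "z \<in> zhat" "y - x = of_nat n * z"
    using assms(3) unfolding zideal_nat_iff[OF assms(1)] by (elim bexE)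
  moreover have "y = x + (y - x)" by simp
  ultimately show ?thesis using assms(2) by metis
qed

lemma zideal_of_nat_mult:
  "n > 0 \<Longrightarrow> x \<in> zideal (of_nat m) \<Longrightarrow> of_nat n * x \<in> zideal (of_nat (n * m))"
  using zideal_mult_iff[of "of_nat n" x "of_nat m"] by simp

lemma zideal_antimono_dvd:
  assumes "m dvd n" shows "zideal (of_nat n) \<subseteq> zideal (of_nat m)"
proof -
  obtain l where n: "n = m * l" using assms by blast
  have "padic_abs p (of_nat n) \<le> padic_abs p (of_nat m)" if p: "prime p" for p
    using padic_abs_of_int_le_1[OF p, of "int l"]
    by (simp add: n padic_abs_mult[OF p] mult_left_le)
  then show ?thesis unfolding zideal_def by (auto intro: order_trans)
qed

lemma zideal_subset_zhat: "zideal (of_nat n) \<subseteq> zhat"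
  using zideal_antimono_dvd[of 1 n] by (simp add: zideal_1)

text \<open>Divisibility of integers can be checked prime by prime, and the value of an integer at p
  records the multiplicity of p. This converts congruences between integers inside zhat into
  ordinary ones.\<close>

lemma of_int_zideal_iff:
  assumes n: "n > 0" shows "of_int j \<in> zideal (of_nat n) \<longleftrightarrow> int n dvd j"
proof
  assume "int n dvd j"
  then obtain l where "j = int n * l" by blast
  then show "of_int j \<in> zideal (of_nat n)"
    by (auto simp: zideal_nat_iff[OF n] intro!: bexI[of _ "of_int l"])
next
  assume j: "of_int j \<in> zideal (of_nat n)"
  show "int n dvd j"
  proof (cases "j = 0")
    case False
    show ?thesis
    proof (rule multiplicity_le_imp_dvd)
      show "int n \<noteq> 0" using n by simp
      fix q :: int assume q: "prime q"
      define p where "p = nat q"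
      have qp: "q = int p" using q by (simp add: p_def prime_ge_0_int)
      have p: "prime p" using q by (simp add: qp)
      have "multiplicity p n \<le> multiplicity (int p) j"
        using j p False unfolding zideal_def
        by (auto simp: adele_abs_of_int padic_abs_of_int_le_iff[OF p n])
      moreover have "multiplicity (int p) (int n) = multiplicity p n"
        by (simp add: multiplicity_int_int)
      ultimately show "multiplicity q (int n) \<le> multiplicity q j" by (simp add: qp)
    qed
  qed simp
qed

text \<open>The cosets x + N zhat form a base. The two parameters S and e of
  \<open>adele_nhd\<close> merge into a single integer N, so that common refinements are obtained by
  multiplying levels.\<close>

lemma open_adele_iff:
  "open (U :: adele set) \<longleftrightarrow> (\<forall>x\<in>U. \<exists>N>0. \<forall>z\<in>zhat. x + of_nat N * z \<in> U)"
proof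
  assume U: "open U"
  show "\<forall>x\<in>U. \<exists>N>0. \<forall>z\<in>zhat. x + of_nat N * z \<in> U"
  proof
    fix x assume "x \<in> U"
    then obtain S e where S: "finite S" "e > 0" "adele_nhd x S e \<subseteq> U"
      using U unfolding open_adele_def by blast
    obtain j where j: "(1/2::real) ^ j < e" using S(2) real_arch_pow_inv[of e "1/2"] by auto
    define S' where "S' = {p\<in>S. prime p}"
    \<comment> \<open>Each prime of S divides N to the power j, so N has value at most (1/2)^j < e
      there.\<close>
    define N where "N = \<Prod>S' ^ j"
    have fin: "finite S'" using S by (simp add: S'_def)
    have N: "N > 0" unfolding N_def S'_def by (auto intro!: prod_pos dest: prime_gt_0_nat)
    have "x + of_nat N * z \<in> U" if z: "z \<in> zhat" for z
    proof -
      have "x + of_nat N * z \<in> adele_nhd x S e"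
        unfolding adele_nhd_def
      proof (safe, goal_cases)
        case (1 p)
        have zp: "adele_abs z p \<le> 1" using z 1 by (simp add: zhat_def)
        have Np: "adele_abs (of_nat N) p \<le> 1"
          using padic_abs_of_int_le_1[OF 1, of "int N"] by (simp add: adele_abs_of_nat[OF 1])
        have "adele_abs (of_nat N) p < e" if p: "p \<in> S"
        proof -
          have "p dvd \<Prod>S'" using fin p 1 by (intro dvd_prodI) (auto simp: S'_def)
          then have "p ^ j dvd N" unfolding N_def by (rule dvd_power_same)
          then show ?thesis
            using padic_abs_le_power_dvd[OF 1 N, of j] j by (simp add: adele_abs_of_nat[OF 1])
        qed
        moreover have "adele_abs (of_nat N * z) p \<le> adele_abs (of_nat N) p"
          using zp by (simp add: adele_abs_mult mult_left_le)
        ultimately show ?case using Np by auto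
      qed
      then show ?thesis using S by blast
    qed
    then show "\<exists>N>0. \<forall>z\<in>zhat. x + of_nat N * z \<in> U" using N by blast
  qed
next
  assume *: "\<forall>x\<in>U. \<exists>N>0. \<forall>z\<in>zhat. x + of_nat N * z \<in> U"
  show "open U" unfolding open_adele_def
  proof
    fix x assume "x \<in> U"
    then obtain N where N: "N > 0" "\<And>z. z \<in> zhat \<Longrightarrow> x + of_nat N * z \<in> U" using * by blast
    \<comment> \<open>At a prime p dividing N the value of N is 1/p^m with p^m dividing N, hence at
      least 1/N; at every other prime it is 1.\<close>
    have "adele_nhd x (prime_factors N) (1 / real N) \<subseteq> U"
    proof
      fix y assume y: "y \<in> adele_nhd x (prime_factors N) (1 / real N)"
      have "y - x \<in> zideal (of_nat N)" unfolding zideal_def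
      proof safe
        fix p :: nat assume p: "prime p"
        show "adele_abs (y - x) p \<le> padic_abs p (of_nat N)"
        proof (cases "p dvd N")
          case True
          have "p ^ multiplicity p N \<le> N" using N(1) by (intro dvd_imp_le multiplicity_dvd)
          then have "real p ^ multiplicity p N \<le> real N" by (metis of_nat_le_iff of_nat_power)
          moreover have "real p ^ multiplicity p N > 0" using prime_gt_0_nat[OF p] by simp
          ultimately have "1 / real N \<le> padic_abs p (of_nat N)"
            by (simp add: padic_abs_of_nat[OF p N(1)] frac_le)
          moreover have "p \<in> prime_factors N" using True p N(1) by (simp add: prime_factors_dvd)
          then have "adele_abs (y - x) p < 1 / real N" using y p by (simp add: adele_nhd_def)
          ultimately show ?thesis by linarith
        next
          case False
          then have "p \<notin> prime_factors N" by auto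
          then have "adele_abs (y - x) p \<le> 1" using y p by (simp add: adele_nhd_def)
          then show ?thesis using False
            by (simp add: padic_abs_of_nat[OF p N(1)] not_dvd_imp_multiplicity_0)
        qed
      qed
      then show "y \<in> U" using zideal_coset_subset[of N x U y] N by simp
    qed
    then show "\<exists>S e. finite S \<and> e > 0 \<and> adele_nhd x S e \<subseteq> U"
      using N(1) by (intro exI[of _ "prime_factors N"] exI[of _ "1 / real N"]) auto
  qed
qed

text \<open>The hypothesis expresses that x and y have the same component at p.\<close>

lemma adele_abs_cong: "adele_abs (x - y) p = 0 \<Longrightarrow> adele_abs x p = adele_abs y p"
  using adele_abs_add[of "x - y" y p] adele_abs_add[of "y - x" x p] adele_abs_nonneg[of x p]
    adele_abs_nonneg[of y p] adele_abs_diff_commute[of x y p]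
  by simp

section \<open>Density of the integers in zhat\<close>

lemma adele_approx_rat:
  assumes p: "prime p" and e: "e > 0"
  shows "\<exists>q. adele_abs (x - adele_of_rat q) p \<le> e"
proof -
  obtain X where X: "adele_rep X" "x = abs_adele X"
    using adele_obtain_rep[of x] by metis
  obtain N where N: "\<And>m n. m \<ge> N \<Longrightarrow> n \<ge> N \<Longrightarrow> padic_abs p (X p m - X p n) < e"
    using X p e unfolding adele_rep_def padic_Cauchy_def by meson
  define q where "q = X p N"
  have r: "adele_rep (\<lambda>p n. X p n + - q)"
    by (rule adele_rep_add[OF X(1) adele_rep_const])
  have "adele_of_rat (- q) = abs_adele (\<lambda>p n. - q)" by (simp add: adele_of_rat_def)
  then have xq: "x - adele_of_rat q = abs_adele (\<lambda>p n. X p n + - q)"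
    unfolding minus_adele_def adele_of_rat_minus[symmetric] X(2)
    using plus_adele.abs_eq[OF adele_rel_refl[OF X(1)] adele_rel_refl[OF adele_rep_const[of "- q"]]]
    by simp
  have "convergent (\<lambda>n. padic_abs p (X p n + - q))"
    using padic_abs_convergent[OF p, of "\<lambda>n. X p n + - q"] r p by (simp add: adele_rep_def)
  then obtain L where L: "(\<lambda>n. padic_abs p (X p n + - q)) \<longlonglongrightarrow> L"
    unfolding convergent_def by blast
  have "L \<le> e"
  proof (rule LIMSEQ_le_const2[OF L], intro exI allI impI)
    fix n assume "N \<le> n"
    then show "padic_abs p (X p n + - q) \<le> e" using N[of n N] by (simp add: q_def)
  qed
  then have "adele_abs (x - adele_of_rat q) p \<le> e"
    using adele_abs_eqI[OF r p L] xq by simp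
  then show ?thesis ..
qed

text \<open>A rational u/v close to x at p is p-integral, so p does not divide v, and u times an
  inverse of v modulo p is the integer wanted. At every other prime p is a unit, and the condition
  only says that x - j is integral.\<close>

lemma zhat_approx_int_prime:
  assumes p: "prime p" and x: "x \<in> zhat"
  shows "\<exists>j. x - of_int j \<in> zideal (of_nat p)"
proof -
  have p1: "real p > 1" using prime_gt_1_nat[OF p] by simp
  \<comment> \<open>Any error below 1 is good enough, since it is then at most 1/p by
    \<open>adele_abs_lt_1\<close>.\<close>
  obtain q where q: "adele_abs (x - adele_of_rat q) p \<le> 1 / 2"
    using adele_approx_rat[OF p, of "1/2"] by auto
  have "adele_abs x p \<le> 1" using x p by (simp add: zhat_def)
  then have "adele_abs (adele_of_rat q) p \<le> 1"
    using adele_abs_diff[of x "x - adele_of_rat q" p] q by simp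
  then have q1: "padic_abs p q \<le> 1" using p by simp
  obtain u v where uv: "quotient_of q = (u, v)" by fastforce
  have v: "v > 0" "coprime u v" "q = of_int u / of_int v"
    using quotient_of_denom_pos[OF uv] quotient_of_coprime[OF uv] quotient_of_div[OF uv] by auto
  have qv: "of_int v * q = of_int u" using v by simp
  have pv: "\<not> int p dvd v"
  proof
    assume *: "int p dvd v"
    have "padic_abs p (of_int u) = padic_abs p (of_int v) * padic_abs p q"
      by (simp add: qv flip: padic_abs_mult[OF p])
    also have "\<dots> \<le> padic_abs p (of_int v)" using q1 by (simp add: mult_left_le)
    finally have "padic_abs p (of_int u) \<le> padic_abs p (of_int v)" .
    moreover have "multiplicity (int p) v \<ge> 1" using * v p
      by (intro multiplicity_geI) auto
    ultimately have "u = 0 \<or> multiplicity (int p) u \<ge> 1"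
      using v p1 by (cases "u = 0") (auto simp: padic_abs_of_int[OF p] field_simps not_less_eq_eq)
    then have "int p dvd u" by (metis dvd_0_right multiplicity_dvd' power_one_right)
    then have "is_unit (int p)" using * v(2) by (rule coprime_common_divisor[rotated])
    then show False using p not_prime_unit[of "int p"] by simp
  qed
  then have "coprime v (int p)" using p
    by (simp add: coprime_commute[of v] prime_imp_coprime)
  then obtain w where w: "[v * w = 1] (mod int p)" using cong_solve_coprime_int by blast
  define j where "j = u * w"
  have "[v * j = u * 1] (mod int p)" unfolding j_def
    using cong_scalar_left[OF w, of u] by (simp add: mult_ac)
  then have "int p dvd u - v * j" by (simp add: cong_iff_dvd_diff dvd_diff_commute)
  then have "of_int (u - v * j) \<in> zideal (of_nat p)"
    using of_int_zideal_iff[of p "u - v * j"] prime_gt_0_nat[OF p] by simp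
  then have "padic_abs p (of_int (u - v * j)) \<le> padic_abs p (of_nat p)"
    unfolding adele_abs_of_int[OF p, symmetric] using p by (rule zidealD)
  moreover note padic_abs_prime[OF p]
  moreover have "padic_abs p (of_int (u - v * j)) = padic_abs p (q - of_int j)"
  proof -
    have "padic_abs p (of_int (u - v * j)) = padic_abs p (of_int v * (q - of_int j))"
      using qv by (simp add: algebra_simps)
    also have "\<dots> = padic_abs p (q - of_int j)"
      using pv v by (simp add: padic_abs_mult[OF p] padic_abs_of_int[OF p] not_dvd_imp_multiplicity_0)
    finally show ?thesis .
  qed
  moreover have "1 / real p < 1" using p1 by simp
  ultimately have "padic_abs p (q - of_int j) < 1" by linarith
  moreover have "adele_abs (adele_of_rat q - of_int j) p = padic_abs p (q - of_int j)"
    using adele_abs_of_rat[OF p, of "q - of_int j"] by (simp add: adele_of_rat_diff)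
  ultimately have "adele_abs (x - of_int j) p < 1"
    using adele_abs_add[of "x - adele_of_rat q" "adele_of_rat q - of_int j" p] q by simp
  then have *: "adele_abs (x - of_int j) p \<le> 1 / real p" by (rule adele_abs_lt_1[OF p])
  have "adele_abs (x - of_int j) p' \<le> padic_abs p' (of_nat p)" if p': "prime p'" for p'
  proof (cases "p' = p")
    case True
    then show ?thesis using * padic_abs_prime[OF p] by simp
  next
    case False
    have "\<not> p' dvd p" using p p' False primes_dvd_imp_eq by blast
    then have "padic_abs p' (of_nat p) = 1"
      using padic_abs_of_nat[OF p', of p] prime_gt_0_nat[OF p] by (simp add: not_dvd_imp_multiplicity_0)
    moreover have "x - of_int j \<in> zhat" using x by (simp add: zhat_diff)
    ultimately show ?thesis using p' by (simp add: zhat_def)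
  qed
  then show ?thesis unfolding zideal_def by blast
qed

text \<open>Strong induction that splits off a prime p of N = p M: write x = j + p z with z in zhat
  and approximate z modulo M.\<close>

lemma zhat_approx_int:
  assumes "x \<in> zhat" "N > 0"
  shows "\<exists>j. x - of_int j \<in> zideal (of_nat N)"
  using assms
proof (induction N arbitrary: x rule: less_induct)
  case (less N)
  show ?case
  proof (cases "N = 1")
    case True
    then show ?thesis using less.prems by (intro exI[of _ 0]) (simp add: zideal_1)
  next
    case False
    then obtain p where p: "prime p" "p dvd N" using prime_factor_nat by blast
    then obtain M where M: "N = p * M" by blast
    have M0: "M > 0" "M < N" using M less.prems prime_gt_1_nat[OF p(1)] by auto
    obtain j where "x - of_int j \<in> zideal (of_nat p)"
      using zhat_approx_int_prime[OF p(1) less.prems(1)] by blast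
    then obtain z where z: "z \<in> zhat" "x - of_int j = of_nat p * z"
      using zideal_nat_iff[of p] prime_gt_0_nat[OF p(1)] by blast
    obtain i where i: "z - of_int i \<in> zideal (of_nat M)"
      using less.IH[OF M0(2) z(1) M0(1)] by blast
    have eq: "x - of_int (j + int p * i) = of_nat p * (z - of_int i)"
      using z(2) by (simp add: algebra_simps)
    have "x - of_int (j + int p * i) \<in> zideal (of_nat N)"
      unfolding M eq by (rule zideal_of_nat_mult[OF prime_gt_0_nat[OF p(1)] i])
    then show ?thesis ..
  qed
qed

lemma zhat_approx_int':
  assumes "x \<in> zhat" "N > 0"
  shows "\<exists>j\<in>{0..<int N}. x - of_int j \<in> zideal (of_nat N)"
proof -
  obtain j where j: "x - of_int j \<in> zideal (of_nat N)" using zhat_approx_int[OF assms] by blast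
  have "int N dvd j - j mod int N" by (simp add: mod_eq_dvd_iff[symmetric])
  then have "of_int (j - j mod int N) \<in> zideal (of_nat N)"
    using of_int_zideal_iff[OF assms(2)] by blast
  then have "x - of_int j + of_int (j - j mod int N) \<in> zideal (of_nat N)"
    by (rule zideal_add[OF j])
  then have "x - of_int (j mod int N) \<in> zideal (of_nat N)" by simp
  then show ?thesis using assms(2) by (intro bexI[of _ "j mod int N"]) auto
qed

text \<open>Representing families can be spliced prime by prime: the primes where the result is not
  integral lie in the union of two finite sets. This prescribes the components of a unit in
  \<open>zhat_unit_lift\<close>.\<close>

lemma adele_glue:
  obtains z where "\<And>p. prime p \<Longrightarrow> p \<in> S \<Longrightarrow> adele_abs (z - x) p = 0"
    "\<And>p. prime p \<Longrightarrow> p \<notin> S \<Longrightarrow> adele_abs (z - y) p = 0"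
proof -
  obtain X where X: "adele_rep X" "x = abs_adele X"
    using adele_obtain_rep[of x] by metis
  obtain Y where Y: "adele_rep Y" "y = abs_adele Y"
    using adele_obtain_rep[of y] by metis
  define Z where "Z = (\<lambda>p. if p \<in> S then X p else Y p)"
  have "finite ({p. prime p \<and> \<not> padic_integral p (X p)} \<union> {p. prime p \<and> \<not> padic_integral p (Y p)})"
    using X Y unfolding adele_rep_def by blast
  then have "finite {p. prime p \<and> \<not> padic_integral p (Z p)}"
    by (rule rev_finite_subset) (auto simp: Z_def)
  then have Z: "adele_rep Z" using X Y unfolding adele_rep_def by (auto simp: Z_def)
  have diff: "adele_abs (abs_adele Z - abs_adele W) p = lim (\<lambda>n. padic_abs p (Z p n + - W p n))"
    if p: "prime p" and W: "adele_rep W" for W p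
  proof -
    have "- abs_adele W = abs_adele (\<lambda>p n. - W p n)"
      using W by (simp add: uminus_adele.abs_eq adele_rel_refl)
    then have "abs_adele Z - abs_adele W = abs_adele (\<lambda>p n. Z p n + - W p n)"
      unfolding minus_adele_def
      using plus_adele.abs_eq[OF adele_rel_refl[OF Z] adele_rel_refl[OF adele_rep_minus[OF W]]] by simp
    then show ?thesis
      using adele_abs.abs_eq[OF adele_rel_refl[OF adele_rep_add[OF Z adele_rep_minus[OF W]]]] p
      by simp
  qed
  show ?thesis
  proof (rule that[of "abs_adele Z"])
    fix p :: nat assume p: "prime p"
    show "adele_abs (abs_adele Z - x) p = 0" if "p \<in> S"
      unfolding X(2) diff[OF p X(1)] using that by (simp add: Z_def)
    show "adele_abs (abs_adele Z - y) p = 0" if "p \<notin> S"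
      unfolding Y(2) diff[OF p Y(1)] using that by (simp add: Z_def)
  qed
qed

text \<open>The inverse is taken term by term. For each p the terms eventually have value 1; then so
  do their inverses, and 1/a - 1/b has the same value as b - a, which preserves Cauchy
  sequences.\<close>

lemma zhat_units_inverse:
  assumes u: "u \<in> zhat_units"
  obtains v where "v \<in> zhat_units" "u * v = 1"
proof -
  obtain X where X: "adele_rep X" "u = abs_adele X"
    "\<And>p. prime p \<Longrightarrow> (\<lambda>n. padic_abs p (X p n)) \<longlonglongrightarrow> adele_abs u p"
    using adele_obtain_rep[of u] by metis
  have ev: "\<forall>\<^sub>F n in sequentially. padic_abs p (X p n) = 1" if p: "prime p" for p
    using padic_abs_eventually_const[OF p _ X(3)[OF p]] X(1) u p
    by (simp add: adele_rep_def zhat_units_def)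
  \<comment> \<open>Where \<open>X p n\<close> is 0 this is the default 0; for each prime p that
    happens for only finitely many n.\<close>
  define Y where "Y = (\<lambda>p n. inverse (X p n))"
  have inv: "padic_abs p (inverse c) = 1" if "prime p" "padic_abs p c = 1" for p c
  proof -
    have "c \<noteq> 0" using that by auto
    then have "padic_abs p c * padic_abs p (inverse c) = 1"
      using that(1) by (simp flip: padic_abs_mult)
    then show ?thesis using that by simp
  qed
  have evY: "\<forall>\<^sub>F n in sequentially. padic_abs p (Y p n) = 1" if p: "prime p" for p
    using ev[OF p] by eventually_elim (simp add: Y_def inv[OF p])
  have "padic_Cauchy p (Y p)" if p: "prime p" for p
    unfolding padic_Cauchy_def
  proof (intro allI impI)
    fix e :: real assume "e > 0"
    then obtain N where N: "\<And>m n. m \<ge> N \<Longrightarrow> n \<ge> N \<Longrightarrow> padic_abs p (X p m - X p n) < e"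
      using X p unfolding adele_rep_def padic_Cauchy_def by meson
    obtain M where M: "\<And>n. n \<ge> M \<Longrightarrow> padic_abs p (X p n) = 1"
      using ev[OF p] unfolding eventually_sequentially by blast
    show "\<exists>N. \<forall>m\<ge>N. \<forall>n\<ge>N. padic_abs p (Y p m - Y p n) < e"
    proof (intro exI[of _ "max M N"] allI impI)
      fix m n assume mn: "max M N \<le> m" "max M N \<le> n"
      then have 1: "padic_abs p (X p m) = 1" "padic_abs p (X p n) = 1" using M by auto
      then have nz: "X p m \<noteq> 0" "X p n \<noteq> 0" by auto
      have "Y p m - Y p n = (X p n - X p m) * (Y p m * Y p n)"
        using nz by (simp add: Y_def field_simps)
      then have "padic_abs p (Y p m - Y p n) = padic_abs p (X p n - X p m)"
        using inv[OF p 1(1)] inv[OF p 1(2)] by (simp add: padic_abs_mult[OF p] Y_def)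
      then show "padic_abs p (Y p m - Y p n) < e" using N[of n m] mn by simp
    qed
  qed
  moreover have "padic_integral p (Y p)" if p: "prime p" for p
    unfolding padic_integral_def using evY[OF p] by eventually_elim simp
  ultimately have Y: "adele_rep Y" unfolding adele_rep_def by (auto intro: finite_subset[of _ "{}"])
  define v where "v = abs_adele Y"
  have "adele_abs v p = 1" if p: "prime p" for p unfolding v_def
    by (rule adele_abs_eqI[OF Y p]) (use evY[OF p] in \<open>rule tendsto_eventually\<close>)
  then have v: "v \<in> zhat_units" by (simp add: zhat_units_def)
  have "u * v = abs_adele (\<lambda>p n. X p n * Y p n)"
    unfolding X(2) v_def
    using times_adele.abs_eq[OF adele_rel_refl[OF X(1)] adele_rel_refl[OF Y]] by simp
  also have "\<dots> = abs_adele (\<lambda>p n. 1)"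
  proof (rule Quotient_rel_abs[OF Quotient_adele])
    have "padic_null p (\<lambda>n. X p n * Y p n - 1)" if p: "prime p" for p
      unfolding padic_null_def
    proof (rule tendsto_eventually, use ev[OF p] in eventually_elim)
      case (elim n)
      then have "X p n \<noteq> 0" by auto
      then show ?case by (simp add: Y_def)
    qed
    then show "adele_rel (\<lambda>p n. X p n * Y p n) (\<lambda>p n. 1)"
      using adele_rep_mult[OF X(1) Y] adele_rep_const by (simp add: adele_rel_def)
  qed
  also have "\<dots> = 1" by (simp add: one_adele_def)
  finally show ?thesis using that v by blast
qed

lemma zhat_units_mult: "u \<in> zhat_units \<Longrightarrow> v \<in> zhat_units \<Longrightarrow> u * v \<in> zhat_units"
  by (simp add: zhat_units_def adele_abs_mult)

lemma zhat_units_1 [simp]: "1 \<in> zhat_units"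
  by (simp add: zhat_units_def)

lemma zhat_units_subset: "zhat_units \<subseteq> zhat"
  by (auto simp: zhat_units_def zhat_def)

text \<open>The limit in zhat of a sequence of integers: the same sequence represents the component
  at every prime. It is meaningful for sequences that are Cauchy at all primes, as under the
  hypothesis of the lemma \<open>adele_lim\<close>.\<close>

definition adele_lim :: "(nat \<Rightarrow> int) \<Rightarrow> adele" where
  "adele_lim m = abs_adele (\<lambda>p n. of_int (m n))"

text \<open>Makes factorials tend to 0 at every prime: each of the i multiples of p up to p i
  contributes a factor p.\<close>

lemma power_dvd_fact:
  assumes p: "p > 0" shows "p ^ i dvd (fact (p * i) :: nat)"
proof (induction i)
  case (Suc i)
  define M where "M = p * Suc i - 1"
  have "(fact (p * i) :: nat) dvd fact M" unfolding M_def using p by (intro fact_dvd) auto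
  then have "p ^ i dvd fact M" by (rule dvd_trans[OF Suc.IH])
  then have "p * p ^ i dvd (p * Suc i) * fact M" by (intro mult_dvd_mono dvd_triv_left)
  moreover have "(fact (p * Suc i) :: nat) = (p * Suc i) * fact M"
    unfolding M_def using p by (subst fact_reduce) auto
  ultimately show ?case by (simp only: power_Suc)
qed simp

text \<open>All terms after the k-th agree with it modulo k!, and this bound survives the limit. As
  factorials tend to 0 at every prime, the sequence is Cauchy at all primes simultaneously.\<close>

lemma adele_lim:
  assumes m: "\<And>k. fact k dvd m (Suc k) - m k"
  shows "adele_lim m - of_int (m k) \<in> zideal (fact k)"
proof -
  have dvd: "fact k dvd m n - m k" if "k \<le> n" for k n
    using that
  proof (induction n rule: dec_induct)
    case (step n)
    have "(fact k :: int) dvd fact n" using step by (simp add: fact_dvd)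
    then have "fact k dvd (m (Suc n) - m n) + (m n - m k)"
      using m[of n] step.IH by (intro dvd_add) (auto intro: dvd_trans)
    then show ?case by simp
  qed simp
  have le: "padic_abs p (of_int (m n - m k)) \<le> padic_abs p (fact k)"
    if p: "prime p" and "k \<le> n" for p n k
  proof -
    have "of_int (m n - m k) \<in> zideal (of_nat (fact k))"
      using dvd[OF that(2)] by (subst of_int_zideal_iff) (auto simp: fact_gt_zero)
    then show ?thesis using p unfolding zideal_def
      using adele_abs_of_int[OF p, of "m n - m k"] by auto
  qed
  have C: "padic_Cauchy p (\<lambda>n. of_int (m n))" if p: "prime p" for p
    unfolding padic_Cauchy_def
  proof (intro allI impI)
    fix e :: real assume "e > 0"
    obtain j where j: "(1/2::real) ^ j < e" using \<open>e > 0\<close> real_arch_pow_inv[of e "1/2"] by auto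
    define N where "N = p * j"
    have "p ^ j dvd fact N" unfolding N_def by (rule power_dvd_fact[OF prime_gt_0_nat[OF p]])
    then have N: "padic_abs p (fact N) < e"
      using padic_abs_le_power_dvd[OF p fact_gt_zero, of j N] j unfolding of_nat_fact by linarith
    show "\<exists>N. \<forall>i\<ge>N. \<forall>n\<ge>N. padic_abs p (of_int (m i) - of_int (m n)) < e"
    proof (intro exI[of _ N] allI impI)
      fix i n assume "N \<le> i" "N \<le> n"
      then have "padic_abs p (of_int (m i - m N)) < e" "padic_abs p (of_int (m n - m N)) < e"
        using le[OF p] N by (meson le_less_trans)+
      then show "padic_abs p (of_int (m i) - of_int (m n)) < e"
        using padic_abs_diff_max[OF p, of "of_int (m i - m N)" "of_int (m n - m N)"] by simp
    qed
  qed
  have r: "adele_rep (\<lambda>p n. of_int (m n))"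
    unfolding adele_rep_def
    by (auto simp: C padic_integral_def padic_abs_of_int_le_1 intro: finite_subset[of _ "{}"])
  have r': "adele_rep (\<lambda>p n. - of_int (m k))" by (rule adele_rep_const)
  have "adele_lim m - of_int (m k) = abs_adele (\<lambda>p n. of_int (m n) + - of_int (m k))"
    (is "_ = abs_adele ?W")
  proof -
    have "- of_int (m k) = adele_of_rat (- of_int (m k))" by (simp add: adele_of_rat_minus)
    also have "\<dots> = abs_adele (\<lambda>p n. - of_int (m k))" by (simp add: adele_of_rat_def)
    finally show ?thesis unfolding minus_adele_def adele_lim_def
      using plus_adele.abs_eq[OF adele_rel_refl[OF r] adele_rel_refl[OF r']] by simp
  qed
  moreover have "adele_abs (abs_adele ?W) p \<le> padic_abs p (fact k)" if p: "prime p" for p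
  proof -
    have r: "adele_rep ?W" by (rule adele_rep_add[OF r r'])
    then obtain L where L: "(\<lambda>n. padic_abs p (?W p n)) \<longlonglongrightarrow> L"
      using padic_abs_convergent[OF p, of "?W p"] p by (auto simp: adele_rep_def convergent_def)
    have "L \<le> padic_abs p (fact k)"
      using le[OF p, of k] by (intro LIMSEQ_le_const2[OF L]) auto
    then show ?thesis using adele_abs_eqI[OF r p L] by simp
  qed
  ultimately show ?thesis unfolding zideal_def by auto
qed

text \<open>The supernatural number that is the product of the p^(e p), with p^infinity read as 0.
  It serves as the representative of an orbit of zhat under its units.\<close>

definition adele_pow :: "(nat \<Rightarrow> enat) \<Rightarrow> adele" where
  "adele_pow e = abs_adele (\<lambda>p n. if e p = \<infinity> then 0 else of_nat (p ^ the_enat (e p)))"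

lemma adele_abs_pow:
  assumes p: "prime p"
  shows "adele_abs (adele_pow e) p = (if e p = \<infinity> then 0 else 1 / real p ^ the_enat (e p))"
  unfolding adele_pow_def
proof (rule adele_abs_eqI[OF _ p])
  show "adele_rep (\<lambda>p n. if e p = \<infinity> then 0 else of_nat (p ^ the_enat (e p)))"
    unfolding adele_rep_def
    using padic_abs_of_int_le_1[of _ "int (_ ^ _)"]
    by (auto simp: padic_Cauchy_const padic_integral_def intro!: finite_subset[of _ "{}"])
  show "(\<lambda>n. padic_abs p (if e p = \<infinity> then 0 else of_nat (p ^ the_enat (e p)))) \<longlonglongrightarrow>
    (if e p = \<infinity> then 0 else 1 / real p ^ the_enat (e p))"
    using padic_abs_of_nat[OF p, of "p ^ the_enat (e p)"] prime_gt_0_nat[OF p] p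
    by simp
qed

lemma adele_pow_zideal_iff:
  assumes n: "n > 0"
  shows "adele_pow e \<in> zideal (of_nat n) \<longleftrightarrow> (\<forall>p\<in>prime_factors n. enat (multiplicity p n) \<le> e p)"
proof -
  have "adele_abs (adele_pow e) p \<le> padic_abs p (of_nat n) \<longleftrightarrow> enat (multiplicity p n) \<le> e p"
    if p: "prime p" for p
    using prime_gt_1_nat[OF p]
    by (cases "e p") (auto simp: adele_abs_pow[OF p] padic_abs_of_nat[OF p n] field_simps)
  moreover have "multiplicity p n = 0" if "prime p" "p \<notin> prime_factors n" for p
    using that n by (metis in_prime_factors_iff not_dvd_imp_multiplicity_0 not_gr_zero)
  ultimately show ?thesis unfolding zideal_def
    by (auto simp: in_prime_factors_iff) (metis enat_0_iff(1) zero_le in_prime_factors_iff)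
qed

lemma adele_pow_zhat: "adele_pow e \<in> zhat"
  using adele_pow_zideal_iff[of 1 e] by (simp add: zideal_1)

text \<open>A nested subdivision. \<open>D j k\<close> is the coset j + k! zhat, which splits into k
  + 1 cosets modulo (k + 1)!. Without a finite subcover there would be a nested chain of cosets none
  of which is finitely covered; the limit of their centres lies in some U of the cover, and U
  contains the whole coset at a late enough level.\<close>

lemma compact_zhat: "compact zhat"
  unfolding compact_eq_Heine_Borel
proof (intro allI impI, elim conjE)
  fix \<U> assume op: "\<forall>U\<in>\<U>. open U" and cov: "zhat \<subseteq> \<Union>\<U>"
  define good where "good A \<longleftrightarrow> (\<exists>\<V>\<subseteq>\<U>. finite \<V> \<and> A \<subseteq> \<Union>\<V>)" for A
  define D where "D j k = {x. x - of_int j \<in> zideal (of_nat (fact k))}" for j k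
  have mono: "good A" if "good B" "A \<subseteq> B" for A B
    using that unfolding good_def by (meson subset_trans)
  have Un: "good (\<Union>i\<in>I. A i)" if "finite I" "\<And>i. i \<in> I \<Longrightarrow> good (A i)" for I :: "int set" and A
  proof -
    have "\<forall>i\<in>I. \<exists>W. W \<subseteq> \<U> \<and> finite W \<and> A i \<subseteq> \<Union>W"
      using that unfolding good_def by blast
    then obtain V where V: "\<And>i. i \<in> I \<Longrightarrow> V i \<subseteq> \<U> \<and> finite (V i) \<and> A i \<subseteq> \<Union>(V i)"
      by metis
    show ?thesis unfolding good_def
    proof (intro exI conjI)
      show "(\<Union>i\<in>I. V i) \<subseteq> \<U>" by (rule UN_least) (simp add: V)
      show "finite (\<Union>i\<in>I. V i)" by (rule finite_UN_I[OF \<open>finite I\<close>]) (simp add: V)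
      have "A i \<subseteq> \<Union>(\<Union>i\<in>I. V i)" if "i \<in> I" for i
        using conjunct2[OF conjunct2[OF V[OF that]]] that by blast
      then show "(\<Union>i\<in>I. A i) \<subseteq> \<Union>(\<Union>i\<in>I. V i)" by (rule UN_least)
    qed
  qed
  have step: "\<exists>j'. fact k dvd j' - j \<and> \<not> good (D j' (Suc k))" if bad: "\<not> good (D j k)" for j k
  proof (rule ccontr)
    assume "\<nexists>j'. fact k dvd j' - j \<and> \<not> good (D j' (Suc k))"
    then have "good (\<Union>i\<in>{0..<int (Suc k)}. D (j + fact k * i) (Suc k))" by (intro Un) auto
    moreover have "D j k \<subseteq> (\<Union>i\<in>{0..<int (Suc k)}. D (j + fact k * i) (Suc k))"
    proof
      fix x assume "x \<in> D j k"
      then obtain z where z: "z \<in> zhat" "x - of_int j = of_nat (fact k) * z"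
        unfolding D_def using zideal_nat_iff[of "fact k"] by auto
      obtain i where i: "i \<in> {0..<int (Suc k)}" "z - of_int i \<in> zideal (of_nat (Suc k))"
        using zhat_approx_int'[OF z(1), of "Suc k"] by blast
      have "of_int (fact k) = (of_nat (fact k) :: adele)"
        by (metis of_int_of_nat_eq of_nat_fact)
      then have eq: "x - of_int (j + fact k * i) = of_nat (fact k) * (z - of_int i)"
        using z(2) by (simp add: algebra_simps)
      have f: "fact k * Suc k = (fact (Suc k) :: nat)"
        unfolding fact_Suc by simp
      have "of_nat (fact k) * (z - of_int i) \<in> zideal (of_nat (fact (Suc k)))"
        unfolding f[symmetric] by (rule zideal_of_nat_mult[OF fact_gt_zero i(2)])
      then have "x \<in> D (j + fact k * i) (Suc k)" by (simp only: D_def mem_Collect_eq eq)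
      then show "x \<in> (\<Union>i\<in>{0..<int (Suc k)}. D (j + fact k * i) (Suc k))"
        by (rule UN_I[OF i(1)])
    qed
    ultimately have "good (D j k)" by (rule mono)
    then show False using bad by contradiction
  qed
  show "\<exists>\<V>\<subseteq>\<U>. finite \<V> \<and> zhat \<subseteq> \<Union>\<V>"
  proof (rule ccontr)
    assume "\<not> ?thesis"
    then have bad0: "\<not> good (D 0 0)" by (simp add: good_def D_def zideal_1)
    have "\<exists>m. \<forall>k. \<not> good (D (m k) k) \<and> fact k dvd m (Suc k) - m k"
      using dependent_nat_choice[of "\<lambda>k j. \<not> good (D j k)" "\<lambda>k j j'. fact k dvd j' - j"]
        step bad0 by metis
    then obtain m where m: "\<And>k. \<not> good (D (m k) k)" "\<And>k. fact k dvd m (Suc k) - m k" by blast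
    define x where "x = adele_lim m"
    have x: "x - of_int (m k) \<in> zideal (of_nat (fact k))" for k
      using adele_lim[of m k] m(2) by (simp add: x_def)
    then have "x \<in> zhat" using zhat_add[of "x - of_int (m 0)" "of_int (m 0)"]
      using zideal_subset_zhat by fastforce
    then obtain U where U: "U \<in> \<U>" "x \<in> U" using cov by blast
    then obtain N where N: "N > 0" "\<And>z. z \<in> zhat \<Longrightarrow> x + of_nat N * z \<in> U"
      using op unfolding open_adele_iff by meson
    have "D (m N) N \<subseteq> U"
    proof
      fix y assume "y \<in> D (m N) N"
      then have "y - x \<in> zideal (of_nat (fact N))"
        using zideal_diff[OF _ x[of N], of "y - of_int (m N)"] by (simp add: D_def)
      moreover have "N dvd fact N" using N(1) by (intro dvd_fact) auto
      ultimately have "y - x \<in> zideal (of_nat N)" using zideal_antimono_dvd by blast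
      then show "y \<in> U" using zideal_coset_subset[of N x U y] N by simp
    qed
    then have "good (D (m N) N)" unfolding good_def using U by (intro exI[of _ "{U}"]) auto
    then show False using m(1) by blast
  qed
qed

lemma zideal_lcm:
  assumes "m > 0" "n > 0" "x \<in> zideal (of_nat m)" "x \<in> zideal (of_nat n)"
  shows "x \<in> zideal (of_nat (lcm m n))"
  unfolding zideal_def mem_Collect_eq
proof (intro allI impI)
  fix p :: nat assume p: "prime p"
  have "multiplicity p (lcm m n) = max (multiplicity p m) (multiplicity p n)"
    using p assms(1,2) by (intro multiplicity_lcm) auto
  then have "padic_abs p (of_nat (lcm m n)) = padic_abs p (of_nat m) \<or>
      padic_abs p (of_nat (lcm m n)) = padic_abs p (of_nat n)"
    using assms(1,2) lcm_pos_nat[of m n] by (simp add: padic_abs_of_nat[OF p] max_def)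
  then show "adele_abs x p \<le> padic_abs p (of_nat (lcm m n))"
    using zidealD[OF assms(3) p] zidealD[OF assms(4) p] by presburger
qed

section \<open>The topology of \<open>\<Omega>\<^sub>B\<close>\<close>

definition pt :: "adele \<Rightarrow> adele \<Rightarrow> point" where
  "pt r a = Omega_proj (r, unit_orbit a)"

lemma unit_orbit_self: "a \<in> unit_orbit a"
  unfolding unit_orbit_def by (auto intro!: exI[of _ 1])

lemma unit_orbit_eq_iff: "unit_orbit a = unit_orbit b \<longleftrightarrow> (\<exists>u\<in>zhat_units. b = a * u)"
proof
  assume eq: "unit_orbit a = unit_orbit b"
  then have "b \<in> unit_orbit a" using unit_orbit_self by simp
  then show "\<exists>u\<in>zhat_units. b = a * u" unfolding unit_orbit_def by blast
next
  assume "\<exists>u\<in>zhat_units. b = a * u"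
  then obtain u v where u: "u \<in> zhat_units" "b = a * u" "v \<in> zhat_units" "u * v = 1"
    using zhat_units_inverse by metis
  have a: "a = b * v" using u by (simp add: mult.assoc)
  show "unit_orbit a = unit_orbit b"
  proof (intro subset_antisym subsetI)
    fix x assume "x \<in> unit_orbit a"
    then obtain w where "w \<in> zhat_units" "x = a * w" unfolding unit_orbit_def by blast
    then have "v * w \<in> zhat_units" "x = b * (v * w)"
      using a u(3) zhat_units_mult by (simp_all add: mult.assoc)
    then show "x \<in> unit_orbit b" unfolding unit_orbit_def by blast
  next
    fix x assume "x \<in> unit_orbit b"
    then obtain w where "w \<in> zhat_units" "x = b * w" unfolding unit_orbit_def by blast
    then have "u * w \<in> zhat_units" "x = a * (u * w)"
      using u zhat_units_mult by (simp_all add: mult.assoc)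
    then show "x \<in> unit_orbit a" unfolding unit_orbit_def by blast
  qed
qed

lemma orbit_zhat_unit_orbit: "orbit_zhat (unit_orbit a) = {a * z | z. z \<in> zhat}"
proof (intro subset_antisym subsetI)
  fix x assume "x \<in> orbit_zhat (unit_orbit a)"
  then obtain u z where "u \<in> zhat_units" "z \<in> zhat" "x = a * u * z"
    unfolding orbit_zhat_def unit_orbit_def by blast
  then have "x = a * (u * z)" "u * z \<in> zhat"
    using zhat_units_subset by (auto simp: mult.assoc intro: zhat_mult)
  then show "x \<in> {a * z | z. z \<in> zhat}" by blast
next
  fix x assume "x \<in> {a * z | z. z \<in> zhat}"
  then obtain z where "z \<in> zhat" "x = (a * 1) * z" by auto
  then show "x \<in> orbit_zhat (unit_orbit a)"
    unfolding orbit_zhat_def unit_orbit_def using zhat_units_1 by blast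
qed

lemma pt_def': "pt r a = ({r + a * z | z. z \<in> zhat}, unit_orbit a)"
  unfolding pt_def Omega_proj_def split orbit_zhat_unit_orbit by auto

lemma pt_eq_iff:
  "pt r a = pt r' a' \<longleftrightarrow> (\<exists>u\<in>zhat_units. a' = a * u) \<and> (\<exists>z\<in>zhat. r' = r + a * z)"
proof
  assume eq: "pt r a = pt r' a'"
  moreover have "r' \<in> {r' + a' * z | z. z \<in> zhat}" by (auto intro!: exI[of _ 0])
  ultimately have "r' \<in> {r + a * z | z. z \<in> zhat}" unfolding pt_def' by simp
  moreover have "\<exists>u\<in>zhat_units. a' = a * u"
    using eq unfolding pt_def' by (simp add: unit_orbit_eq_iff)
  ultimately show "(\<exists>u\<in>zhat_units. a' = a * u) \<and> (\<exists>z\<in>zhat. r' = r + a * z)" by blast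
next
  assume *: "(\<exists>u\<in>zhat_units. a' = a * u) \<and> (\<exists>z\<in>zhat. r' = r + a * z)"
  then obtain z where z: "z \<in> zhat" "r' = r + a * z" by blast
  have o: "unit_orbit a = unit_orbit a'" using * unit_orbit_eq_iff by blast
  then have "{a * z | z. z \<in> zhat} = {a' * z | z. z \<in> zhat}"
    using orbit_zhat_unit_orbit by metis
  moreover have "{r' + b * z | z. z \<in> zhat} = (+) r' ` {b * z | z. z \<in> zhat}" for b by auto
  ultimately have "{r' + a' * z | z. z \<in> zhat} = {r' + a * z | z. z \<in> zhat}" by simp
  also have "\<dots> = {r + a * z | z. z \<in> zhat}"
  proof (intro subset_antisym subsetI)
    fix x assume "x \<in> {r' + a * z | z. z \<in> zhat}"
    then obtain w where w: "w \<in> zhat" "x = r' + a * w" by blast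
    then have "x = r + a * (z + w)" "z + w \<in> zhat" using z by (auto simp: algebra_simps zhat_add)
    then show "x \<in> {r + a * z | z. z \<in> zhat}" by blast
  next
    fix x assume "x \<in> {r + a * z | z. z \<in> zhat}"
    then obtain w where w: "w \<in> zhat" "x = r + a * w" by blast
    then have "x = r' + a * (w - z)" "w - z \<in> zhat" using z by (auto simp: algebra_simps zhat_diff)
    then show "x \<in> {r' + a * z | z. z \<in> zhat}" by blast
  qed
  finally show "pt r a = pt r' a'" unfolding pt_def' using o by simp
qed

section \<open>Open sets in terms of representatives\<close>

lemma topspace_orbit: "topspace adele_orbit_space = range unit_orbit"
  by (simp add: adele_orbit_space_def)

lemma topspace_tilde: "topspace Omega_tilde = {pt r a | r a. True}"
  by (auto simp: Omega_tilde_def topspace_orbit pt_def)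

lemma pt_in_tilde [simp]: "pt r a \<in> topspace Omega_tilde"
  by (auto simp: topspace_tilde)

lemma open_coset: "open {x + of_nat N * z | z. z \<in> zhat}" if "N > 0"
  unfolding open_adele_iff
proof (intro ballI exI[of _ N] conjI that)
  fix y w assume "y \<in> {x + of_nat N * z | z. z \<in> zhat}" and w: "w \<in> zhat"
  then obtain z where "z \<in> zhat" "y = x + of_nat N * z" by blast
  then have "y + of_nat N * w = x + of_nat N * (z + w)" "z + w \<in> zhat"
    using w by (auto simp: algebra_simps zhat_add)
  then show "y + of_nat N * w \<in> {x + of_nat N * z | z. z \<in> zhat}" by blast
qed

text \<open>If y u lies in the coset of x, then so does (y + N w) u, because u maps N zhat into
  itself. Hence the saturation of the coset is open.\<close>

lemma openin_orbit_coset: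
  assumes N: "N > 0"
  shows "openin adele_orbit_space (unit_orbit ` {x + of_nat N * z | z. z \<in> zhat})"
proof -
  have "open {y. unit_orbit y \<in> unit_orbit ` {x + of_nat N * z | z. z \<in> zhat}}"
    unfolding open_adele_iff
  proof (intro ballI exI[of _ N] conjI N)
    fix y w assume y: "y \<in> {y. unit_orbit y \<in> unit_orbit ` {x + of_nat N * z | z. z \<in> zhat}}"
      and w: "w \<in> zhat"
    then obtain z where z: "z \<in> zhat" "unit_orbit y = unit_orbit (x + of_nat N * z)" by auto
    then obtain u where u: "u \<in> zhat_units" "x + of_nat N * z = y * u"
      by (auto simp: unit_orbit_eq_iff)
    have "(y + of_nat N * w) * u = x + of_nat N * (z + w * u)"
      using u(2) by (simp add: algebra_simps)
    moreover have "z + w * u \<in> zhat" using z w u zhat_units_subset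
      by (auto intro!: zhat_add zhat_mult)
    moreover have "unit_orbit (y + of_nat N * w) = unit_orbit ((y + of_nat N * w) * u)"
      using u unit_orbit_eq_iff by blast
    ultimately show "y + of_nat N * w \<in> {y. unit_orbit y \<in> unit_orbit ` {x + of_nat N * z | z. z \<in> zhat}}"
      by auto
  qed
  then show ?thesis unfolding adele_orbit_space_def openin_quotient_topology by auto
qed

text \<open>Two nested quotient topologies and a product are replaced by a condition on
  representatives with a single level N for both coordinates. Later openness proofs use this
  form.\<close>

lemma openin_tilde_iff:
  "openin Omega_tilde U \<longleftrightarrow> U \<subseteq> topspace Omega_tilde \<and>
    (\<forall>r a. pt r a \<in> U \<longrightarrow> (\<exists>N>0. \<forall>s\<in>zhat. \<forall>t\<in>zhat. pt (r + of_nat N * s) (a + of_nat N * t) \<in> U))"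
  (is "_ \<longleftrightarrow> _ \<and> ?R")
proof (intro iffI conjI)
  assume U: "openin Omega_tilde U"
  show "U \<subseteq> topspace Omega_tilde" using U by (rule openin_subset)
  show ?R
  proof (intro allI impI)
    fix r a assume ra: "pt r a \<in> U"
    have "openin (prod_topology euclidean adele_orbit_space)
        {x \<in> topspace (prod_topology euclidean adele_orbit_space). Omega_proj x \<in> U}" (is "openin _ ?V")
      using U unfolding Omega_tilde_def openin_quotient_topology by blast
    moreover have "(r, unit_orbit a) \<in> ?V" using ra by (auto simp: topspace_orbit pt_def)
    ultimately have "\<exists>A B. openin euclidean A \<and> openin adele_orbit_space B \<and> r \<in> A \<and>
        unit_orbit a \<in> B \<and> A \<times> B \<subseteq> ?V"
      unfolding openin_prod_topology_alt by (elim allE impE)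
    then obtain A B where AB: "open A" "openin adele_orbit_space B" "r \<in> A" "unit_orbit a \<in> B" "A \<times> B \<subseteq> ?V"
      by (elim exE conjE) (simp flip: open_openin)
    obtain N1 where N1: "N1 > 0" "\<And>z. z \<in> zhat \<Longrightarrow> r + of_nat N1 * z \<in> A"
      using AB(1)[unfolded open_adele_iff, rule_format, OF AB(3)] by auto
    have "open {x. unit_orbit x \<in> B}"
      using AB(2) unfolding adele_orbit_space_def openin_quotient_topology by simp
    then obtain N2 where N2: "N2 > 0" "\<And>z. z \<in> zhat \<Longrightarrow> unit_orbit (a + of_nat N2 * z) \<in> B"
      using AB(4) unfolding open_adele_iff by auto
    show "\<exists>N>0. \<forall>s\<in>zhat. \<forall>t\<in>zhat. pt (r + of_nat N * s) (a + of_nat N * t) \<in> U"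
    proof (intro exI[of _ "N1 * N2"] conjI ballI)
      show "N1 * N2 > 0" using N1 N2 by simp
      fix s t assume s: "s \<in> zhat" and t: "t \<in> zhat"
      have "r + of_nat N1 * (of_nat N2 * s) \<in> A" "unit_orbit (a + of_nat N2 * (of_nat N1 * t)) \<in> B"
        using s t by (auto intro!: N1(2) N2(2) zhat_mult)
      then have "(r + of_nat (N1 * N2) * s, unit_orbit (a + of_nat (N1 * N2) * t)) \<in> A \<times> B"
        by (simp add: mult_ac)
      then show "pt (r + of_nat (N1 * N2) * s) (a + of_nat (N1 * N2) * t) \<in> U"
        using AB(5) unfolding pt_def by blast
    qed
  qed
next
  assume *: "U \<subseteq> topspace Omega_tilde \<and> ?R"
  let ?X = "prod_topology (euclidean :: adele topology) adele_orbit_space"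
  have "openin ?X {x \<in> topspace ?X. Omega_proj x \<in> U}"
    unfolding openin_prod_topology_alt
  proof (intro allI impI)
    fix r \<alpha> assume "(r, \<alpha>) \<in> {x \<in> topspace ?X. Omega_proj x \<in> U}"
    then obtain a where a: "\<alpha> = unit_orbit a" "pt r a \<in> U" by (auto simp: topspace_orbit pt_def)
    then obtain N where N: "N > 0" "\<And>s t. s \<in> zhat \<Longrightarrow> t \<in> zhat \<Longrightarrow> pt (r + of_nat N * s) (a + of_nat N * t) \<in> U"
      using conjunct2[OF *, rule_format, OF a(2)] by auto
    let ?A = "{r + of_nat N * z | z. z \<in> zhat}"
    let ?B = "unit_orbit ` {a + of_nat N * z | z. z \<in> zhat}"
    have "r \<in> ?A" "\<alpha> \<in> ?B" unfolding a by (auto intro!: exI[of _ 0] imageI)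
    moreover have "?A \<times> ?B \<subseteq> {x \<in> topspace ?X. Omega_proj x \<in> U}"
      using N(2) by (auto simp: topspace_orbit pt_def)
    ultimately show "\<exists>A B. openin euclidean A \<and> openin adele_orbit_space B \<and> r \<in> A \<and> \<alpha> \<in> B \<and>
        A \<times> B \<subseteq> {x \<in> topspace ?X. Omega_proj x \<in> U}"
      using open_coset[OF N(1), of r] openin_orbit_coset[OF N(1), of a]
      by (intro exI[of _ ?A] exI[of _ ?B] conjI) (simp_all flip: open_openin)
  qed
  then show "openin Omega_tilde U"
    using * unfolding Omega_tilde_def openin_quotient_topology
    by (auto simp: topspace_orbit topspace_tilde Omega_tilde_def)
qed

lemma continuous_map_pt: "continuous_map euclidean Omega_tilde (\<lambda>(r, a). pt r a)"
  unfolding continuous_map_def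
proof (intro conjI allI impI)
  show "(\<lambda>(r, a). pt r a) \<in> topspace euclidean \<rightarrow> topspace Omega_tilde" by auto
  fix U assume U: "openin Omega_tilde U"
  have "open {x. (\<lambda>(r, a). pt r a) x \<in> U}"
    unfolding open_prod_def
  proof
    fix x assume "x \<in> {x. (\<lambda>(r, a). pt r a) x \<in> U}"
    then obtain r a where x: "x = (r, a)" "pt r a \<in> U" by (cases x) auto
    then obtain N where N: "N > 0" "\<And>s t. s \<in> zhat \<Longrightarrow> t \<in> zhat \<Longrightarrow> pt (r + of_nat N * s) (a + of_nat N * t) \<in> U"
      using conjunct2[OF U[unfolded openin_tilde_iff], rule_format, OF x(2)] by auto
    have "x \<in> {r + of_nat N * z | z. z \<in> zhat} \<times> {a + of_nat N * z | z. z \<in> zhat}"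
      unfolding x by (auto intro!: exI[of _ 0])
    moreover have "{r + of_nat N * z | z. z \<in> zhat} \<times> {a + of_nat N * z | z. z \<in> zhat} \<subseteq> {x. (\<lambda>(r, a). pt r a) x \<in> U}"
      using N(2) by auto
    ultimately show "\<exists>A B. open A \<and> open B \<and> x \<in> A \<times> B \<and> A \<times> B \<subseteq> {x. (\<lambda>(r, a). pt r a) x \<in> U}"
      using open_coset[OF N(1)] by blast
  qed
  then show "openin euclidean {x \<in> topspace euclidean. (\<lambda>(r, a). pt r a) x \<in> U}" by simp
qed

section \<open>The action of the affine group\<close>

lemma act_pt:
  assumes "k \<noteq> 0"
  shows "act (m, k) (pt r a) = pt (adele_of_rat m + adele_of_rat k * r) (adele_of_rat k * a)"
proof -
  have "(\<lambda>r. adele_of_rat m + adele_of_rat k * r) ` {r + a * z | z. z \<in> zhat} =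
      {adele_of_rat m + adele_of_rat k * (r + a * z) | z. z \<in> zhat}"
    by blast
  then have "(\<lambda>r. adele_of_rat m + adele_of_rat k * r) ` {r + a * z | z. z \<in> zhat} =
      {adele_of_rat m + adele_of_rat k * r + adele_of_rat k * a * z | z. z \<in> zhat}"
    by (simp only: distrib_left mult.assoc add.assoc)
  moreover have "(\<lambda>b. adele_of_rat k * b) ` unit_orbit a = unit_orbit (adele_of_rat k * a)"
    unfolding unit_orbit_def by (auto simp: mult.assoc)
  ultimately show ?thesis unfolding act_def pt_def' by simp
qed

lemma act_one [simp]: "act (0, 1) x = x"
  by (cases x) (simp add: act_def)

lemma act_act: "act (m, k) (act (n, l) x) = act (m + k * n, k * l) x"
  by (cases x) (simp add: act_def image_image adele_of_rat_add adele_of_rat_mult algebra_simps)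

lemma continuous_map_act:
  assumes k: "k > 0"
  shows "continuous_map Omega_tilde Omega_tilde (act (m, k))"
  unfolding continuous_map_def
proof (intro conjI allI impI)
  show "act (m, k) \<in> topspace Omega_tilde \<rightarrow> topspace Omega_tilde"
  proof
    fix x assume "x \<in> topspace Omega_tilde"
    then obtain r a where "x = pt r a" unfolding topspace_tilde by blast
    then show "act (m, k) x \<in> topspace Omega_tilde" using k by (simp add: act_pt)
  qed
  fix U assume U: "openin Omega_tilde U"
  show "openin Omega_tilde {x \<in> topspace Omega_tilde. act (m, k) x \<in> U}"
    unfolding openin_tilde_iff
  proof (intro conjI allI impI)
    fix r a assume "pt r a \<in> {x \<in> topspace Omega_tilde. act (m, k) x \<in> U}"
    then have "pt (adele_of_rat m + adele_of_rat k * r) (adele_of_rat k * a) \<in> U"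
      using k by (simp add: act_pt)
    then obtain N where N: "N > 0" "\<And>s t. s \<in> zhat \<Longrightarrow> t \<in> zhat \<Longrightarrow>
        pt (adele_of_rat m + adele_of_rat k * r + of_nat N * s) (adele_of_rat k * a + of_nat N * t) \<in> U"
      using conjunct2[OF U[unfolded openin_tilde_iff], rule_format] by meson
    \<comment> \<open>With k = u/v, multiplication by k maps the shift N v s to N (u s). So the
      level N of the target is reached by the level N v of the source.\<close>
    obtain u v where uv: "quotient_of k = (u, v)" by fastforce
    have v: "v > 0" "k = of_int u / of_int v"
      using quotient_of_denom_pos[OF uv] quotient_of_div[OF uv] by auto
    have "k * of_int v = of_int u" using v by simp
    then have kv: "adele_of_rat k * of_int v = of_int u"
      by (metis adele_of_rat_mult adele_of_rat_of_int)
    have vn: "of_nat (nat v) = (of_int v :: adele)" using v(1) by simp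
    have *: "adele_of_rat k * (of_nat (N * nat v) * s) = of_nat N * (of_int u * s)" for s
    proof -
      have "adele_of_rat k * (of_nat (N * nat v) * s) = of_nat N * ((adele_of_rat k * of_int v) * s)"
        unfolding of_nat_mult vn by (simp only: mult_ac)
      then show ?thesis unfolding kv .
    qed
    show "\<exists>N>0. \<forall>s\<in>zhat. \<forall>t\<in>zhat. pt (r + of_nat N * s) (a + of_nat N * t)
        \<in> {x \<in> topspace Omega_tilde. act (m, k) x \<in> U}"
    proof (intro exI[of _ "N * nat v"] conjI ballI)
      show "N * nat v > 0" using N v by simp
      fix s t assume st: "s \<in> zhat" "t \<in> zhat"
      have "act (m, k) (pt (r + of_nat (N * nat v) * s) (a + of_nat (N * nat v) * t)) =
          pt (adele_of_rat m + adele_of_rat k * r + of_nat N * (of_int u * s)) (adele_of_rat k * a + of_nat N * (of_int u * t))"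
        using k unfolding *[symmetric] by (simp add: act_pt algebra_simps)
      also have "\<dots> \<in> U" using st by (intro N(2) zhat_mult) auto
      finally show "pt (r + of_nat (N * nat v) * s) (a + of_nat (N * nat v) * t)
        \<in> {x \<in> topspace Omega_tilde. act (m, k) x \<in> U}" by simp
    qed
  qed auto
qed

section \<open>The sets (m, n)Omega_B and their intersections\<close>

definition cyl :: "int \<Rightarrow> nat \<Rightarrow> point set" where
  "cyl m n = {pt r a | r a. a \<in> zideal (of_nat n) \<and> r - of_int m \<in> zideal (of_nat n)}"

text \<open>Membership may be tested on any representative: units preserve n zhat, and since a lies
  in n zhat, changing r by an element of a zhat keeps its residue modulo n.\<close>

lemma pt_in_cyl: "pt r a \<in> cyl m n \<longleftrightarrow> a \<in> zideal (of_nat n) \<and> r - of_int m \<in> zideal (of_nat n)"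
proof
  assume "pt r a \<in> cyl m n"
  then obtain r' a' where *: "pt r' a' = pt r a" "a' \<in> zideal (of_nat n)" "r' - of_int m \<in> zideal (of_nat n)"
    unfolding cyl_def by auto
  then obtain u z where uz: "u \<in> zhat_units" "z \<in> zhat" "a = a' * u" "r = r' + a' * z"
    unfolding pt_eq_iff by blast
  have "a \<in> zideal (of_nat n)"
    unfolding uz(3) using *(2) uz(1) zhat_units_subset by (intro zideal_mult_zhat) auto
  moreover have "r' - of_int m + a' * z \<in> zideal (of_nat n)"
    using * uz by (intro zideal_add zideal_mult_zhat)
  ultimately show "a \<in> zideal (of_nat n) \<and> r - of_int m \<in> zideal (of_nat n)"
    unfolding uz(4) by (simp add: algebra_simps)
qed (auto simp: cyl_def)

lemma cyl_subset_tilde: "cyl m n \<subseteq> topspace Omega_tilde"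
  by (auto simp: cyl_def)

lemma zideal_add_iff:
  assumes "z \<in> zhat" "n > 0"
  shows "x + of_nat n * z \<in> zideal (of_nat n) \<longleftrightarrow> x \<in> zideal (of_nat n)"
proof -
  have *: "of_nat n * z \<in> zideal (of_nat n)" using assms zideal_nat_iff by blast
  show ?thesis using zideal_add[OF _ *, of x] zideal_diff[OF _ *, of "x + of_nat n * z"] by auto
qed

text \<open>Invariance under shifts by n zhat makes both the set and its complement open.\<close>

lemma pt_shift_in_cyl:
  assumes "s \<in> zhat" "t \<in> zhat" "n > 0"
  shows "pt (r + of_nat n * s) (a + of_nat n * t) \<in> cyl m n \<longleftrightarrow> pt r a \<in> cyl m n"
proof -
  have "r + of_nat n * s - of_int m = (r - of_int m) + of_nat n * s" by simp
  then show ?thesis unfolding pt_in_cyl using assms zideal_add_iff by metis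
qed

lemma openin_cyl: "n > 0 \<Longrightarrow> openin Omega_tilde (cyl m n)"
  unfolding openin_tilde_iff using pt_shift_in_cyl by (auto simp: cyl_subset_tilde)

lemma closedin_cyl: "n > 0 \<Longrightarrow> closedin Omega_tilde (cyl m n)"
  unfolding closedin_def openin_tilde_iff using pt_shift_in_cyl
  by (auto simp: cyl_subset_tilde)

lemma cyl_0_1: "cyl 0 1 = {pt r a | r a. r \<in> zhat \<and> a \<in> zhat}"
  unfolding cyl_def by (auto simp: zideal_1)

lemma topspace_Omega_B: "topspace Omega_B = cyl 0 1"
proof -
  have "{Omega_proj (r, unit_orbit a) | r a. r \<in> zhat \<and> a \<in> zhat} = cyl 0 1"
    unfolding cyl_0_1 pt_def by blast
  then show ?thesis using cyl_subset_tilde[of 0 1] unfolding Omega_B_def by auto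
qed

lemma Omega_B_eq: "Omega_B = subtopology Omega_tilde (cyl 0 1)"
  unfolding Omega_B_def cyl_0_1 pt_def by simp

lemma openin_Omega_B: "openin Omega_B U \<longleftrightarrow> openin Omega_tilde U \<and> U \<subseteq> cyl 0 1"
  unfolding Omega_B_eq by (rule openin_open_subtopology) (simp add: openin_cyl)

lemma cyl_subset: "cyl m n \<subseteq> cyl 0 1"
proof -
  have "r \<in> zhat" if "r - of_int m \<in> zideal (of_nat n)" for r
    using zhat_add[of "r - of_int m" "of_int m"] that zideal_subset_zhat[of n] by auto
  then show ?thesis unfolding cyl_0_1 using zideal_subset_zhat[of n] unfolding cyl_def by blast
qed

lemma act_image_cyl:
  assumes n: "n > 0" and k: "k > 0"
  shows "act (of_int m, of_nat n) ` cyl l k = cyl (m + int n * l) (n * k)"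
proof (intro subset_antisym subsetI)
  fix x assume "x \<in> act (of_int m, of_nat n) ` cyl l k"
  then obtain r a where x: "x = act (of_int m, of_nat n) (pt r a)" "a \<in> zideal (of_nat k)"
      "r - of_int l \<in> zideal (of_nat k)"
    unfolding cyl_def by blast
  have "of_int m + of_nat n * r - of_int (m + int n * l) = of_nat n * (r - of_int l)"
    by (simp add: algebra_simps)
  then show "x \<in> cyl (m + int n * l) (n * k)"
    using zideal_of_nat_mult[OF n x(2)] zideal_of_nat_mult[OF n x(3)] n
    unfolding x(1) by (simp add: act_pt pt_in_cyl del: of_int_add of_nat_mult of_int_mult)
next
  fix x assume "x \<in> cyl (m + int n * l) (n * k)"
  then obtain r a where x: "x = pt r a" "a \<in> zideal (of_nat (n * k))"
      "r - of_int (m + int n * l) \<in> zideal (of_nat (n * k))"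
    unfolding cyl_def by blast
  define b s where "b = adele_of_rat (inverse (of_nat n)) * a"
    and "s = adele_of_rat (inverse (of_nat n)) * (r - of_int m)"
  have b: "a = of_nat n * b" and s: "r = of_int m + of_nat n * s"
    using adele_of_rat_cancel'[of "of_nat n" a] adele_of_rat_cancel'[of "of_nat n" "r - of_int m"] n
    by (simp_all add: b_def s_def)
  have "b \<in> zideal (of_nat k)"
    using x(2) zideal_mult_iff[of "of_nat n" b "of_nat k"] n by (simp add: b)
  moreover have "r - of_int (m + int n * l) = of_nat n * (s - of_int l)"
    by (simp add: s algebra_simps)
  then have "s - of_int l \<in> zideal (of_nat k)"
    using x(3) zideal_mult_iff[of "of_nat n" "s - of_int l" "of_nat k"] n by simp
  moreover have "x = act (of_int m, of_nat n) (pt s b)"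
    using n by (simp add: act_pt x(1) b s)
  ultimately show "x \<in> act (of_int m, of_nat n) ` cyl l k" unfolding cyl_def by blast
qed

lemma act_image_Omega_B:
  "n > 0 \<Longrightarrow> act (of_int m, of_nat n) ` topspace Omega_B = cyl m n"
  using act_image_cyl[of n 1 m 0] by (simp add: topspace_Omega_B)

lemma cyl_disjoint: "cyl 0 2 \<inter> cyl 1 2 = {}"
proof -
  have False if "r - of_int 0 \<in> zideal (of_nat 2)" "r - of_int 1 \<in> zideal (of_nat 2)" for r
  proof -
    have "of_int 1 \<in> zideal (of_nat 2)" using zideal_diff[OF that] by simp
    then show False using of_int_zideal_iff[of 2 1] by simp
  qed
  then have "pt r a \<notin> cyl 0 2 \<inter> cyl 1 2" for r a unfolding Int_iff pt_in_cyl by blast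
  then show ?thesis using cyl_subset_tilde[of 0 2] unfolding topspace_tilde by blast
qed

text \<open>A common point (r, a) replaces the solvability condition of the Chinese remainder
  theorem: an integer l close to r modulo the lcm can take the place of both m and m'.\<close>

lemma cyl_Int:
  assumes "n > 0" "n' > 0"
  shows "cyl m n \<inter> cyl m' n' = {} \<or> (\<exists>l. cyl m n \<inter> cyl m' n' = cyl l (lcm n n'))"
proof (cases "cyl m n \<inter> cyl m' n' = {}")
  case False
  then obtain r a where ra: "pt r a \<in> cyl m n" "pt r a \<in> cyl m' n'" unfolding cyl_def by blast
  have r: "r \<in> zhat" using ra(1) cyl_subset pt_in_cyl[of r a 0 1] by (auto simp: zideal_1)
  have N: "lcm n n' > 0" using assms by (simp add: lcm_pos_nat)
  obtain l where l: "r - of_int l \<in> zideal (of_nat (lcm n n'))"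
    using zhat_approx_int[OF r N] by blast
  have *: "s - of_int q \<in> zideal (of_nat k) \<longleftrightarrow> s - of_int l \<in> zideal (of_nat k)"
    if "k dvd lcm n n'" "r - of_int q \<in> zideal (of_nat k)" for s q k
  proof -
    have "r - of_int l \<in> zideal (of_nat k)" using l zideal_antimono_dvd that by blast
    then have "of_int l - of_int q \<in> zideal (of_nat k)"
      using zideal_diff[OF that(2)] by fastforce
    then show ?thesis
      using zideal_add[of "s - of_int l" _ "of_int l - of_int q"]
        zideal_diff[of "s - of_int q" _ "of_int l - of_int q"] by auto
  qed
  have lcm_iff: "x \<in> zideal (of_nat (lcm n n')) \<longleftrightarrow> x \<in> zideal (of_nat n) \<and> x \<in> zideal (of_nat n')" for x
    using zideal_lcm[OF assms] zideal_antimono_dvd[of n "lcm n n'"] zideal_antimono_dvd[of n' "lcm n n'"]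
    by auto
  have "pt s b \<in> cyl m n \<inter> cyl m' n' \<longleftrightarrow> pt s b \<in> cyl l (lcm n n')" for s b
    using ra *[of n m s] *[of n' m' s] unfolding Int_iff pt_in_cyl lcm_iff by auto
  then have "cyl m n \<inter> cyl m' n' = cyl l (lcm n n')"
    using cyl_subset_tilde unfolding topspace_tilde by blast
  then show ?thesis by blast
qed simp

section \<open>Compactness and a neighbourhood base of Omega_B\<close>

lemma compactin_Omega_B: "compactin Omega_tilde (cyl 0 1)"
proof -
  have "compactin Omega_tilde ((\<lambda>(r, a). pt r a) ` (zhat \<times> zhat))"
    by (rule image_compactin[OF _ continuous_map_pt])
      (simp add: compact_Times compact_zhat)
  moreover have "(\<lambda>(r, a). pt r a) ` (zhat \<times> zhat) = cyl 0 1" unfolding cyl_0_1 by auto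
  ultimately show ?thesis by simp
qed

lemma compact_space_Omega_B: "compact_space Omega_B"
  unfolding Omega_B_eq using compactin_Omega_B by (simp add: compact_space_subtopology)

text \<open>On Omega_B and for N > 0 the classes are the atoms of the finite Boolean algebra
  generated by the cylinders of level dividing N; the residue m matters only modulo n.\<close>

definition cyl_equiv :: "nat \<Rightarrow> point \<Rightarrow> point \<Rightarrow> bool" where
  "cyl_equiv N x y \<longleftrightarrow> (\<forall>n m. n dvd N \<longrightarrow> (x \<in> cyl m n \<longleftrightarrow> y \<in> cyl m n))"

lemma cyl_equiv_refl [simp]: "cyl_equiv N x x"
  by (simp add: cyl_equiv_def)

lemma cyl_equiv_sym: "cyl_equiv N x y \<Longrightarrow> cyl_equiv N y x"
  by (simp add: cyl_equiv_def)

lemma cyl_equiv_trans: "cyl_equiv N x y \<Longrightarrow> cyl_equiv N y z \<Longrightarrow> cyl_equiv N x z"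
  by (simp add: cyl_equiv_def)

lemma cyl_equiv_dvd: "cyl_equiv N x y \<Longrightarrow> M dvd N \<Longrightarrow> cyl_equiv M x y"
  unfolding cyl_equiv_def using dvd_trans by blast

text \<open>Membership at the levels dividing N depends only on r and a modulo N, so Omega_B has at
  most N^2 classes.\<close>

lemma cyl_equiv_integer_point:
  assumes "r \<in> zhat" "a \<in> zhat" "N > 0"
  shows "\<exists>i\<in>{0..<int N}. \<exists>j\<in>{0..<int N}. cyl_equiv N (pt r a) (pt (of_int i) (of_int j))"
proof -
  obtain i j where ij: "i \<in> {0..<int N}" "r - of_int i \<in> zideal (of_nat N)"
    "j \<in> {0..<int N}" "a - of_int j \<in> zideal (of_nat N)"
    using zhat_approx_int'[OF assms(1,3)] zhat_approx_int'[OF assms(2,3)] by blast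
  have *: "x \<in> zideal (of_nat n) \<longleftrightarrow> y \<in> zideal (of_nat n)"
    if "n dvd N" "x - y \<in> zideal (of_nat N)" for n x y
  proof -
    have d: "x - y \<in> zideal (of_nat n)" using that zideal_antimono_dvd by blast
    show ?thesis using zideal_add[OF d, of y] zideal_diff[OF _ d, of x] by auto
  qed
  have "r - of_int m - (of_int i - of_int m) \<in> zideal (of_nat N)" for m using ij by simp
  then have "cyl_equiv N (pt r a) (pt (of_int i) (of_int j))"
    unfolding cyl_equiv_def pt_in_cyl using * ij(4) by (metis (no_types))
  then show ?thesis using ij by blast
qed

text \<open>Here \<open>d\<close> plays the role of the greatest common divisor of \<open>a\<close> and \<open>N\<close>.\<close>

lemma zhat_bezout:
  assumes a: "a \<in> zhat" and N: "N > 0"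
  obtains d i y b where "d > 0" "d dvd N" "y \<in> zhat" "b \<in> zhat"
    "a = of_nat d * b" "a * of_int i + of_nat N * y = of_nat d"
proof -
  obtain j where "a - of_int j \<in> zideal (of_nat N)" using zhat_approx_int[OF a N] by blast
  then obtain w where w: "w \<in> zhat" "a - of_int j = of_nat N * w" using zideal_nat_iff[OF N] by blast
  define d where "d = nat (gcd j (int N))"
  have d: "int d = gcd j (int N)" "d > 0" using N by (simp_all add: d_def)
  have dN: "d dvd N" using d(1) by (metis gcd_dvd2 int_dvd_int_iff)
  obtain i k where ik: "i * j + k * int N = int d" using bezout_int[of j "int N"] d(1) by auto
  obtain c where c: "N = d * c" using dN by blast
  obtain l where l: "j = int d * l" using d(1) by (metis gcd_dvd1 dvdE)
  have aj: "a = of_int j + of_nat N * w" using w(2) by (simp add: algebra_simps)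
  have "a = of_nat d * (of_int l + of_nat c * w)" by (simp add: aj c l algebra_simps)
  moreover have "a * of_int i + of_nat N * (of_int k - w * of_int i) = of_int (i * j + k * int N)"
    by (simp add: aj algebra_simps)
  then have "a * of_int i + of_nat N * (of_int k - w * of_int i) = of_nat d" unfolding ik by simp
  moreover have "of_int k - w * of_int i \<in> zhat" "of_int l + of_nat c * w \<in> zhat"
    using w(1) by (auto intro!: zhat_add zhat_diff zhat_mult)
  ultimately show ?thesis using that d(2) dN by blast
qed

lemma of_nat_adele_cancel:
  assumes "n > 0" "of_nat n * x = of_nat n * (y :: adele)" shows "x = y"
  using adele_of_rat_mult_eq_iff[of "of_nat n" x y] assms by simp

text \<open>Units modulo c lift to units of zhat. By the last two hypotheses b and b' are invertible
  modulo c, and i' is an inverse of b', so u has to be i' b modulo c. This is a unit at the primes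
  dividing c; at the other primes it may fail to be one, and the component 1 is taken
  instead.\<close>

lemma zhat_unit_lift:
  assumes b: "b \<in> zhat" and b': "b' \<in> zhat" and c: "c > 0"
    and y: "y \<in> zhat" and y': "y' \<in> zhat"
    and bi: "b * of_int i + of_nat c * y = 1" and bi': "b' * of_int i' + of_nat c * y' = 1"
  obtains u where "u \<in> zhat_units" "b' * u - b \<in> zideal (of_nat c)"
proof -
  \<comment> \<open>At p dividing c the summand c z has value below 1, so x k has value at least 1;
    as both factors have value at most 1, both have value 1.\<close>
  have unit: "adele_abs x p = 1 \<and> adele_abs (of_int k) p = 1"
    if p: "prime p" "p dvd c" and x: "x \<in> zhat" "z \<in> zhat" "x * of_int k + of_nat c * z = 1" for x z k p
  proof -
    have "adele_abs (of_nat c) p \<le> 1 / real p"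
      using p zidealD[OF _ p(1), of "of_nat c" "of_nat p"] of_int_zideal_iff[of p "int c"] prime_gt_0_nat[OF p(1)]
      by (simp add: padic_abs_prime)
    moreover have "1 / real p < 1" using prime_gt_1_nat[OF p(1)] by simp
    ultimately have "adele_abs (of_nat c) p * adele_abs z p < 1"
      using x(2) p(1) by (smt (verit) adele_abs_nonneg mem_Collect_eq mult_left_le zhat_def)
    then have cz: "adele_abs (of_nat c * z) p < 1" by (simp add: adele_abs_mult)
    have le: "adele_abs x p \<le> 1" "adele_abs (of_int k) p \<le> 1"
      using x(1) zhat_of_int[of k] p(1) unfolding zhat_def by auto
    have "1 \<le> max (adele_abs (x * of_int k) p) (adele_abs (of_nat c * z) p)"
      using adele_abs_add[of "x * of_int k" "of_nat c * z" p] x(3) p(1) by simp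
    then have ge: "1 \<le> adele_abs x p * adele_abs (of_int k) p" using cz by (simp add: adele_abs_mult)
    have "adele_abs x p * adele_abs (of_int k) p \<le> adele_abs x p"
      "adele_abs x p * adele_abs (of_int k) p \<le> adele_abs (of_int k) p"
      using le by (simp_all add: mult_left_le mult_left_le_one_le)
    then show ?thesis using le ge by linarith
  qed
  obtain u where u: "\<And>p. prime p \<Longrightarrow> p \<in> {p. p dvd c} \<Longrightarrow> adele_abs (u - of_int i' * b) p = 0"
    "\<And>p. prime p \<Longrightarrow> p \<notin> {p. p dvd c} \<Longrightarrow> adele_abs (u - 1) p = 0"
    by (rule adele_glue[of "{p. p dvd c}" "of_int i' * b" 1]) blast
  have "adele_abs u p = 1" if p: "prime p" for p
  proof (cases "p dvd c")
    case True
    then have "adele_abs u p = adele_abs (of_int i' * b) p" using u(1)[OF p] by (intro adele_abs_cong) simp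
    also have "\<dots> = 1" using unit[OF p True b y bi] unit[OF p True b' y' bi'] by (simp add: adele_abs_mult)
    finally show ?thesis .
  next
    case False
    then have "adele_abs u p = adele_abs 1 p" using u(2)[OF p] by (intro adele_abs_cong) simp
    then show ?thesis using p by simp
  qed
  then have uu: "u \<in> zhat_units" by (simp add: zhat_units_def)
  have "b' * u - b \<in> zideal (of_nat c)" unfolding zideal_def mem_Collect_eq
  proof (intro allI impI)
    fix p :: nat assume p: "prime p"
    show "adele_abs (b' * u - b) p \<le> padic_abs p (of_nat c)"
    proof (cases "p dvd c")
      case True
      have eq: "b' * u - b = b' * (u - of_int i' * b) - b * (of_nat c * y')"
      proof -
        have "b' * u - b * (b' * of_int i' + of_nat c * y') = b' * (u - of_int i' * b) - b * (of_nat c * y')"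
          by (simp add: algebra_simps)
        then show ?thesis unfolding bi' by simp
      qed
      have "adele_abs (b' * (u - of_int i' * b)) p = 0" using u(1)[OF p] True by (simp add: adele_abs_mult)
      moreover have "adele_abs (b * (of_nat c * y')) p \<le> padic_abs p (of_nat c)"
      proof (rule zidealD[OF _ p])
        have "of_nat c * y' \<in> zideal (of_nat c)" using y' zideal_nat_iff[OF c] by blast
        then show "b * (of_nat c * y') \<in> zideal (of_nat c)"
          using zideal_mult_zhat b by (subst mult.commute)
      qed
      ultimately show ?thesis
        using adele_abs_diff[of "b' * (u - of_int i' * b)" "b * (of_nat c * y')" p] unfolding eq by simp
    next
      case False
      then have "padic_abs p (of_nat c) = 1"
        using c by (simp add: padic_abs_of_nat[OF p] not_dvd_imp_multiplicity_0)
      moreover have "b' * u - b \<in> zhat" using b b' uu zhat_units_subset by (auto intro!: zhat_diff zhat_mult)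
      ultimately show ?thesis using p by (simp add: zhat_def)
    qed
  qed
  then show ?thesis using that uu by blast
qed

text \<open>Let U contain all (r + N s, a + N t). Equivalence of (r, a) and (r', a') at level N
  forces a and a' to have the same gcd d with N, and r' = r modulo d. With a = d b and a' = d b',
  both b and b' are invertible modulo c = N/d, so \<open>zhat_unit_lift\<close> gives a unit u with
  a' u = a + N t. Hence (r', a') is the same point as a shifted representative of (r, a).\<close>

lemma cyl_equiv_base:
  assumes U: "openin Omega_tilde U" and ra: "r \<in> zhat" "a \<in> zhat" "pt r a \<in> U"
  shows "\<exists>N>0. \<forall>y\<in>topspace Omega_B. cyl_equiv N (pt r a) y \<longrightarrow> y \<in> U"
proof -
  obtain N where N: "N > 0" "\<And>s t. s \<in> zhat \<Longrightarrow> t \<in> zhat \<Longrightarrow> pt (r + of_nat N * s) (a + of_nat N * t) \<in> U"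
    using conjunct2[OF U[unfolded openin_tilde_iff], rule_format, OF ra(3)] by auto
  have "pt r' a' \<in> U" if r': "r' \<in> zhat" "a' \<in> zhat" and eq: "cyl_equiv N (pt r a) (pt r' a')" for r' a'
  proof -
    obtain d i y b where d: "d > 0" "d dvd N" "y \<in> zhat" "b \<in> zhat" "a = of_nat d * b"
      "a * of_int i + of_nat N * y = of_nat d" using zhat_bezout[OF ra(2) N(1)] .
    obtain d' i' y' b' where d': "d' > 0" "d' dvd N" "y' \<in> zhat" "b' \<in> zhat" "a' = of_nat d' * b'"
      "a' * of_int i' + of_nat N * y' = of_nat d'" using zhat_bezout[OF r'(2) N(1)] .
    \<comment> \<open>Choose an integer residue m of s1 modulo e; the cylinder given by m and e
      transfers both conditions to the second point.\<close>
    have mem: "x2 \<in> zideal (of_nat e) \<and> s2 - s1 \<in> zideal (of_nat e)"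
      if e: "e > 0" "e dvd N" "x1 \<in> zideal (of_nat e)" "s1 \<in> zhat" "cyl_equiv N (pt s1 x1) (pt s2 x2)"
      for e x1 x2 s1 s2
    proof -
      obtain m where m: "s1 - of_int m \<in> zideal (of_nat e)" using zhat_approx_int[OF e(4,1)] by blast
      then have "pt s1 x1 \<in> cyl m e" using e(3) by (simp add: pt_in_cyl)
      then have "pt s2 x2 \<in> cyl m e" using e(2,5) unfolding cyl_equiv_def by blast
      then have "x2 \<in> zideal (of_nat e)" "s2 - of_int m \<in> zideal (of_nat e)" by (simp_all add: pt_in_cyl)
      then show ?thesis using zideal_diff[OF _ m, of "s2 - of_int m"] by simp
    qed
    \<comment> \<open>The Bezout relation writes e as a combination of x and N, so a common divisor
      of these divides e.\<close>
    have dvd: "e' dvd e" if "e' dvd N" "e' > 0" "x \<in> zideal (of_nat e')" "w \<in> zhat" "x * of_int k + of_nat N * w = of_nat e" for e e' x k w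
    proof -
      have "of_nat N \<in> zideal (of_nat e')" using of_int_zideal_iff[OF that(2), of "int N"] that(1) by simp
      then have "of_nat e \<in> zideal (of_nat e')" unfolding that(5)[symmetric] using that(3,4)
        by (intro zideal_add zideal_mult_zhat) auto
      then show ?thesis using of_int_zideal_iff[OF that(2), of "int e"] by simp
    qed
    have a: "a \<in> zideal (of_nat d)" using d zideal_nat_iff by blast
    have a': "a' \<in> zideal (of_nat d')" using d' zideal_nat_iff by blast
    note m = mem[OF d(1,2) a ra(1) eq]
    note m' = mem[OF d'(1,2) a' r'(1) cyl_equiv_sym[OF eq]]
    have "d dvd d'" using dvd[OF d(2,1) _ d'(3,6)] m by blast
    moreover have "d' dvd d" using dvd[OF d'(2,1) _ d(3,6)] m' by blast
    ultimately have dd: "d' = d" by (rule dvd_antisym[symmetric])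
    obtain c where c: "N = d * c" using d(2) by blast
    have c0: "c > 0" using c N(1) by simp
    have "of_nat d * (b * of_int i + of_nat c * y) = of_nat d * 1"
      using d(6) unfolding d(5) c by (simp add: algebra_simps)
    then have bi: "b * of_int i + of_nat c * y = 1" using of_nat_adele_cancel d(1) by blast
    have "of_nat d * (b' * of_int i' + of_nat c * y') = of_nat d * 1"
      using d'(6) unfolding d'(5) c dd by (simp add: algebra_simps)
    then have bi': "b' * of_int i' + of_nat c * y' = 1" using of_nat_adele_cancel d(1) by blast
    obtain u where u: "u \<in> zhat_units" "b' * u - b \<in> zideal (of_nat c)"
      using zhat_unit_lift[OF d(4) d'(4) c0 d(3) d'(3) bi bi'] .
    obtain t where t: "t \<in> zhat" "b' * u - b = of_nat c * t" using u(2) zideal_nat_iff[OF c0] by blast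
    have "a' * u = of_nat d * b + of_nat d * (b' * u - b)"
      unfolding d'(5) dd by (simp add: algebra_simps)
    also have "\<dots> = a + of_nat N * t" unfolding t(2) d(5) c by (simp add: mult.assoc)
    finally have au: "a + of_nat N * t = a' * u" by simp
    obtain z where z: "z \<in> zhat" "r' - r = of_nat d * z" using m zideal_nat_iff[OF d(1)] by blast
    \<comment> \<open>The relation d = a' i' + N y' splits the difference d z of r' and r into an
      element of a' zhat, which does not change the point, and an element of N zhat.\<close>
    have "r = r' - (a' * of_int i' + of_nat N * y') * z"
      unfolding d'(6) dd z(2)[symmetric] by simp
    then have r: "r + of_nat N * (y' * z) = r' + a' * (- (of_int i' * z))" by (simp add: algebra_simps)
    have "pt r' a' = pt (r + of_nat N * (y' * z)) (a + of_nat N * t)"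
      unfolding pt_eq_iff
    proof (intro conjI)
      show "\<exists>u\<in>zhat_units. a + of_nat N * t = a' * u" using au u(1) by blast
      have "- (of_int i' * z) \<in> zhat" using z(1) by (simp add: zhat_mult)
      then show "\<exists>w\<in>zhat. r + of_nat N * (y' * z) = r' + a' * w" using r by blast
    qed
    then show ?thesis using N(2)[OF zhat_mult[OF d'(3) z(1)] t(1)] by simp
  qed
  then have "\<forall>y\<in>topspace Omega_B. cyl_equiv N (pt r a) y \<longrightarrow> y \<in> U"
    unfolding topspace_Omega_B cyl_0_1 by blast
  then show ?thesis using N(1) by blast
qed

lemma cyl_equiv_base':
  assumes "openin Omega_tilde U" "x \<in> topspace Omega_B" "x \<in> U"
  shows "\<exists>N>0. \<forall>y\<in>topspace Omega_B. cyl_equiv N x y \<longrightarrow> y \<in> U"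
proof -
  obtain r a where "x = pt r a" "r \<in> zhat" "a \<in> zhat"
    using assms(2) unfolding topspace_Omega_B cyl_0_1 by blast
  then show ?thesis using cyl_equiv_base assms by blast
qed

lemma cyl_equiv_integer_point':
  assumes "x \<in> topspace Omega_B" "N > 0"
  shows "\<exists>i\<in>{0..<int N}. \<exists>j\<in>{0..<int N}. cyl_equiv N x (pt (of_int i) (of_int j))"
proof -
  obtain r a where "x = pt r a" "r \<in> zhat" "a \<in> zhat"
    using assms(1) unfolding topspace_Omega_B cyl_0_1 by blast
  then show ?thesis using cyl_equiv_integer_point assms(2) by blast
qed

section \<open>The Borel \<open>\<sigma>\<close>-algebra and scaling measures\<close>

text \<open>The empty set is included so that the family is closed under intersections.\<close>

definition cyls :: "point set set" where
  "cyls = insert {} {cyl m n | m n. n > 0}"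

lemma cyls_subset: "cyls \<subseteq> Pow (topspace Omega_B)"
  unfolding cyls_def topspace_Omega_B using cyl_subset by blast

lemma Int_stable_cyls: "Int_stable cyls"
proof (rule Int_stableI)
  fix A B assume "A \<in> cyls" "B \<in> cyls"
  then consider "A \<inter> B = {}" | m n m' n' where "n > 0" "n' > 0" "A = cyl m n" "B = cyl m' n'"
    unfolding cyls_def by blast
  then show "A \<inter> B \<in> cyls"
  proof cases
    case 2
    then show ?thesis using cyl_Int[of n n' m m'] lcm_pos_nat[of n n'] unfolding cyls_def by auto
  qed (simp add: cyls_def)
qed

lemma space_Omega_borel [simp]: "space Omega_borel = topspace Omega_B"
  unfolding Omega_borel_def by (rule space_measure_of) (auto dest: openin_subset)

lemma sets_Omega_borel': "sets Omega_borel = sigma_sets (topspace Omega_B) {U. openin Omega_B U}"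
  unfolding Omega_borel_def by (rule sets_measure_of) (auto dest: openin_subset)

lemma openin_Omega_B_cyl: "n > 0 \<Longrightarrow> openin Omega_B (cyl m n)"
  unfolding openin_Omega_B using openin_cyl cyl_subset by blast

lemma cyl_borel: "n > 0 \<Longrightarrow> cyl m n \<in> sets Omega_borel"
  unfolding sets_Omega_borel' using openin_Omega_B_cyl by blast

text \<open>An open set is the union of the \<open>cyl_equiv\<close> classes that it contains, and
  these are indexed by a level and an integer point, hence countably many. Each class is a countable
  intersection of cylinders and complements of cylinders.\<close>

lemma sets_Omega_borel: "sets Omega_borel = sigma_sets (topspace Omega_B) cyls"
proof -
  let ?S = "sigma_sets (topspace Omega_B) cyls"
  interpret S: sigma_algebra "topspace Omega_B" ?S
    by (rule sigma_algebra_sigma_sets[OF cyls_subset])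
  have cyl: "cyl m n \<in> ?S" if "n > 0" for m n
    using that by (intro sigma_sets.Basic) (auto simp: cyls_def)
  define cls where "cls N x = {y \<in> topspace Omega_B. cyl_equiv N x y}" for N x
  have cls: "cls N x \<in> ?S" if "N > 0" for N x
  proof -
    define W where "W m n = (if n dvd N then (if x \<in> cyl m n then cyl m n else topspace Omega_B - cyl m n)
      else topspace Omega_B)" for m n
    have W: "W m n \<in> ?S" for m n
      using cyl[of n m] dvd_pos_nat[OF that, of n] by (auto simp: W_def intro: S.compl_sets S.top)
    have "cls N x = (\<Inter>m. \<Inter>n. W m n)"
    proof (intro subset_antisym subsetI)
      fix y assume "y \<in> cls N x"
      then show "y \<in> (\<Inter>m. \<Inter>n. W m n)" unfolding cls_def cyl_equiv_def W_def by auto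
    next
      fix y assume y: "y \<in> (\<Inter>m. \<Inter>n. W m n)"
      have top: "W m n \<subseteq> topspace Omega_B" for m n
        using cyl_subset unfolding W_def topspace_Omega_B by (auto split: if_splits)
      have "y \<in> topspace Omega_B" using y top by blast
      moreover have "x \<in> cyl m n \<longleftrightarrow> y \<in> cyl m n" if "n dvd N" for m n
      proof -
        have "y \<in> W m n" using y by blast
        then show ?thesis using that unfolding W_def by (auto split: if_splits)
      qed
      ultimately show "y \<in> cls N x" unfolding cls_def cyl_equiv_def by blast
    qed
    also have "\<dots> \<in> ?S" by (intro S.countable_INT) (auto intro: W S.countable_INT)
    finally show ?thesis .
  qed
  have opn: "U \<in> ?S" if U: "openin Omega_B U" for U
  proof -
    define I where "I = {(N, i, j). N > 0 \<and> cls N (pt (of_int i) (of_int j)) \<subseteq> U}"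
    have "U = (\<Union>(N, i, j)\<in>I. cls N (pt (of_int i) (of_int j)))"
    proof (intro subset_antisym subsetI)
      fix x assume x: "x \<in> U"
      have xo: "x \<in> topspace Omega_B" using U x openin_subset by blast
      have "openin Omega_tilde U" using U by (simp add: openin_Omega_B)
      then obtain N where N: "N > 0" "\<And>y. y \<in> topspace Omega_B \<Longrightarrow> cyl_equiv N x y \<Longrightarrow> y \<in> U"
        using cyl_equiv_base'[OF _ xo x] by blast
      obtain i j where ij: "cyl_equiv N x (pt (of_int i) (of_int j))"
        using cyl_equiv_integer_point'[OF xo N(1)] by blast
      have "cls N (pt (of_int i) (of_int j)) \<subseteq> U"
        unfolding cls_def using N(2) cyl_equiv_trans[OF ij] by blast
      moreover have "x \<in> cls N (pt (of_int i) (of_int j))"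
        unfolding cls_def using xo cyl_equiv_sym[OF ij] by blast
      ultimately show "x \<in> (\<Union>(N, i, j)\<in>I. cls N (pt (of_int i) (of_int j)))"
        unfolding I_def using N(1) by blast
    qed (auto simp: I_def)
    also have "\<dots> \<in> ?S"
      by (intro S.countable_UN') (auto simp: I_def intro: cls)
    finally show ?thesis .
  qed
  show ?thesis unfolding sets_Omega_borel'
  proof (intro subset_antisym sigma_sets_mono)
    show "{U. openin Omega_B U} \<subseteq> ?S" using opn by blast
    show "cyls \<subseteq> sigma_sets (topspace Omega_B) {U. openin Omega_B U}"
      using openin_Omega_B_cyl unfolding cyls_def by (auto intro: sigma_sets.Empty)
  qed
qed

lemma scaling_probability_cyl:
  assumes \<mu>: "scaling_probability \<beta> \<mu>" and n: "n > 0"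
  shows "measure \<mu> (cyl m n) = real n powr - \<beta>"
proof -
  interpret prob_space \<mu> using \<mu> by (simp add: scaling_probability_def)
  have s: "sets \<mu> = sets Omega_borel" using \<mu> by (simp add: scaling_probability_def)
  then have "space \<mu> = topspace Omega_B" using sets_eq_imp_space_eq[OF s] by simp
  then have "measure \<mu> (topspace Omega_B) = 1" using prob_space by simp
  moreover have "topspace Omega_B \<in> sets Omega_borel"
    using sets.top[of Omega_borel] by simp
  moreover have "\<forall>Y\<in>sets Omega_borel. measure \<mu> (act (of_int m, of_nat n) ` Y) = real n powr - \<beta> * measure \<mu> Y"
    using \<mu> n unfolding scaling_probability_def by blast
  ultimately show ?thesis unfolding act_image_Omega_B[OF n, of m, symmetric] by simp
qed

text \<open>A pi-lambda argument. On cylinders the claim is multiplicativity of n powr (-beta);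
  since the map is injective, images respect complements and disjoint unions. Measurability of the
  image is carried along in the induction.\<close>

lemma scaling_probabilityI:
  assumes "prob_space \<mu>" and s: "sets \<mu> = sets Omega_borel"
    and cyl: "\<And>m n. n > 0 \<Longrightarrow> measure \<mu> (cyl m n) = real n powr - \<beta>"
  shows "scaling_probability \<beta> \<mu>"
proof -
  interpret prob_space \<mu> by fact
  have sp: "space \<mu> = topspace Omega_B" using sets_eq_imp_space_eq[OF s] by simp
  have "measure \<mu> (act (of_int m, of_nat n) ` Y) = real n powr - \<beta> * measure \<mu> Y"
    if Y: "Y \<in> sets Omega_borel" and n: "n > 0" for Y m n
  proof -
    let ?g = "act (of_int m, of_nat n)"
    have inj: "inj ?g"
    proof (rule inj_on_inverseI)
      fix x show "act (- of_int m / of_nat n, 1 / of_nat n) (?g x) = x"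
        using n by (simp add: act_act)
    qed
    have Y': "Y \<in> sigma_sets (topspace Omega_B) cyls" using Y by (simp add: sets_Omega_borel)
    have "?g ` Y \<in> sets \<mu> \<and> measure \<mu> (?g ` Y) = real n powr - \<beta> * measure \<mu> Y"
    proof (induction rule: sigma_sets_induct_disjoint[OF Int_stable_cyls cyls_subset Y'])
      case (1 A)
      then show ?case
      proof (cases "A = {}")
        case False
        then obtain l k where A: "A = cyl l k" "k > 0" using 1 unfolding cyls_def by blast
        show ?thesis using n A(2) cyl_borel unfolding A(1) act_image_cyl[OF n A(2)]
          by (simp add: cyl s powr_mult)
      qed simp
    next
      case 2 then show ?case by simp
    next
      case (3 A)
      have A: "A \<in> sets \<mu>" using 3 s sets_Omega_borel by simp
      have sub: "A \<subseteq> topspace Omega_B" using sets.sets_into_space[OF A] sp by simp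
      have im: "?g ` (topspace Omega_B - A) = cyl m n - ?g ` A"
        using act_image_Omega_B[OF n, of m] inj by (simp add: image_set_diff)
      have "measure \<mu> (cyl m n - ?g ` A) = measure \<mu> (cyl m n) - measure \<mu> (?g ` A)"
        using 3 cyl_borel[OF n] s image_mono[OF sub, of ?g] unfolding act_image_Omega_B[OF n]
        by (intro finite_measure_Diff) auto
      also have "\<dots> = real n powr - \<beta> * (1 - measure \<mu> A)"
        using 3 by (simp add: cyl n algebra_simps)
      also have "1 - measure \<mu> A = measure \<mu> (topspace Omega_B - A)"
        using prob_compl[OF A] sp by simp
      finally show ?case unfolding im using 3 cyl_borel n s by auto
    next
      case (4 A)
      have A: "range A \<subseteq> sets \<mu>" using 4(2) s sets_Omega_borel by auto
      have im: "?g ` (\<Union>i. A i) = (\<Union>i. ?g ` A i)" by blast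
      have gA: "range (\<lambda>i. ?g ` A i) \<subseteq> sets \<mu>" using 4 by auto
      have dis: "disjoint_family (\<lambda>i. ?g ` A i)"
        using 4(1) inj unfolding disjoint_family_on_def by (metis (no_types, lifting) image_Int image_empty)
      have "(\<lambda>i. measure \<mu> (?g ` A i)) sums measure \<mu> (\<Union>i. ?g ` A i)"
        by (rule finite_measure_UNION[OF gA dis])
      moreover have "(\<lambda>i. real n powr - \<beta> * measure \<mu> (A i)) sums (real n powr - \<beta> * measure \<mu> (\<Union>i. A i))"
        using finite_measure_UNION[OF A 4(1)] by (rule sums_mult)
      ultimately have "measure \<mu> (\<Union>i. ?g ` A i) = real n powr - \<beta> * measure \<mu> (\<Union>i. A i)"
        using 4(3) sums_unique2 by simp
      then show ?case unfolding im using gA by auto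
    qed
    then show ?thesis by simp
  qed
  then show ?thesis using assms(1) s unfolding scaling_probability_def by blast
qed

lemma scaling_probability_unique:
  assumes "scaling_probability \<beta> \<mu>" "scaling_probability \<beta> \<nu>"
  shows "\<mu> = \<nu>"
proof -
  interpret M: prob_space \<mu> using assms(1) by (simp add: scaling_probability_def)
  interpret N: prob_space \<nu> using assms(2) by (simp add: scaling_probability_def)
  have s: "sets \<mu> = sigma_sets (topspace Omega_B) cyls" "sets \<nu> = sigma_sets (topspace Omega_B) cyls"
    using assms sets_Omega_borel by (auto simp: scaling_probability_def)
  have "topspace Omega_B \<in> cyls" unfolding cyls_def topspace_Omega_B by auto
  have "emeasure \<mu> X = emeasure \<nu> X" if "X \<in> cyls" for X
    using that scaling_probability_cyl[OF assms(1)] scaling_probability_cyl[OF assms(2)]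
    unfolding cyls_def by (auto simp: M.emeasure_eq_measure N.emeasure_eq_measure)
  then show ?thesis
    by (rule measure_eqI_generator_eq[OF Int_stable_cyls cyls_subset _ s, of "\<lambda>_. topspace Omega_B"])
      (use \<open>topspace Omega_B \<in> cyls\<close> in auto)
qed

lemma scaling_probability_ge_1:
  assumes \<mu>: "scaling_probability \<beta> \<mu>" shows "\<beta> \<ge> 1"
proof -
  interpret prob_space \<mu> using \<mu> by (simp add: scaling_probability_def)
  have s: "sets \<mu> = sets Omega_borel" using \<mu> by (simp add: scaling_probability_def)
  have "measure \<mu> (cyl 0 2 \<union> cyl 1 2) = measure \<mu> (cyl 0 2) + measure \<mu> (cyl 1 2)"
    using cyl_disjoint s cyl_borel by (intro finite_measure_Union) auto
  then have "2 * 2 powr - \<beta> \<le> (1::real)"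
    using prob_le_1[of "cyl 0 2 \<union> cyl 1 2"] scaling_probability_cyl[OF \<mu>, of 2] by simp
  then have "2 powr (1 - \<beta>) \<le> (2::real) powr 0" by (simp add: powr_diff powr_minus field_simps)
  then show ?thesis by (subst (asm) powr_le_cancel_iff) auto
qed

section \<open>Existence of the scaling measure\<close>

lemma product_pmf_cylinder:
  fixes Q :: "'i \<Rightarrow> 'a pmf"
  assumes J: "finite J"
  shows "{f. \<forall>i\<in>J. f i \<in> X i} \<in> sets (PiM UNIV (\<lambda>i. measure_pmf (Q i)))" (is "?A \<in> _")
    and "measure (PiM UNIV (\<lambda>i. measure_pmf (Q i))) {f. \<forall>i\<in>J. f i \<in> X i} =
      (\<Prod>i\<in>J. measure_pmf.prob (Q i) (X i))"
proof -
  interpret product_prob_space "\<lambda>i. measure_pmf (Q i)" UNIV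
    by (intro product_prob_spaceI measure_pmf.prob_space_axioms)
  have eq: "?A = prod_emb UNIV (\<lambda>i. measure_pmf (Q i)) J (\<Pi>\<^sub>E j\<in>J. X j)"
    unfolding prod_emb_def by (auto simp: PiE_iff restrict_def extensional_def)
  show "?A \<in> sets (PiM UNIV (\<lambda>i. measure_pmf (Q i)))"
    unfolding eq by (rule sets_PiM_I[OF J]) auto
  show "measure (PiM UNIV (\<lambda>i. measure_pmf (Q i))) ?A = (\<Prod>i\<in>J. measure_pmf.prob (Q i) (X i))"
    unfolding eq by (rule measure_PiM_emb[OF _ J]) auto
qed

lemma prob_space_product_pmf: "prob_space (PiM UNIV (\<lambda>i. measure_pmf (Q i)))"
  by (intro prob_space_PiM measure_pmf.prob_space_axioms)

section \<open>Haar measure on zhat by random digits\<close>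

definition digit_measure :: "(nat \<Rightarrow> nat) measure" where
  "digit_measure = PiM UNIV (\<lambda>k. measure_pmf (pmf_of_set {..k}))"

definition digit_sum :: "(nat \<Rightarrow> nat) \<Rightarrow> nat \<Rightarrow> nat" where
  "digit_sum d n = (\<Sum>k<n. d k * fact k)"

text \<open>The factorial number system: the digit belonging to k! is (j div k!) mod (k + 1), which
  lies in 0, ..., k, the support of the k-th coordinate of \<open>digit_measure\<close>.\<close>

lemma digit_sum_mod: "digit_sum (\<lambda>k. (j div fact k) mod Suc k) n = j mod fact n"
proof (induction n)
  case (Suc n)
  have "j mod (fact n * Suc n) = fact n * (j div fact n mod Suc n) + j mod fact n"
    by (rule mod_mult2_eq)
  moreover have "fact (Suc n) = fact n * Suc n" by (simp add: algebra_simps)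
  ultimately show ?case using Suc by (simp only: digit_sum_def sum.lessThan_Suc) (simp add: algebra_simps)
qed (simp add: digit_sum_def)

text \<open>Only the first n digits matter, so the set is a countable union of cylinder sets, one
  for each admissible list of n digits.\<close>

lemma digit_sum_measurable: "{d. P (digit_sum d n)} \<in> sets digit_measure"
proof -
  interpret prob_space digit_measure unfolding digit_measure_def by (rule prob_space_product_pmf)
  have sp: "space digit_measure = UNIV" unfolding digit_measure_def by (simp add: space_PiM)
  have "{d. P (digit_sum d n)} = (\<Union>c\<in>{c. length c = n \<and> P (\<Sum>k<n. c ! k * fact k)}. {d. \<forall>k\<in>{..<n}. d k \<in> {c ! k}})"
  proof (intro subset_antisym subsetI)
    fix d assume d: "d \<in> {d. P (digit_sum d n)}"
    have "(\<Sum>k<n. map d [0..<n] ! k * fact k) = digit_sum d n"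
      unfolding digit_sum_def by (intro sum.cong) auto
    then show "d \<in> (\<Union>c\<in>{c. length c = n \<and> P (\<Sum>k<n. c ! k * fact k)}. {d. \<forall>k\<in>{..<n}. d k \<in> {c ! k}})"
      using d by (intro UN_I[of "map d [0..<n]"]) auto
  next
    fix d assume "d \<in> (\<Union>c\<in>{c. length c = n \<and> P (\<Sum>k<n. c ! k * fact k)}. {d. \<forall>k\<in>{..<n}. d k \<in> {c ! k}})"
    then obtain c where c: "P (\<Sum>k<n. c ! k * fact k)" "\<And>k. k < n \<Longrightarrow> d k = c ! k" by auto
    have "digit_sum d n = (\<Sum>k<n. c ! k * fact k)" unfolding digit_sum_def using c(2) by (intro sum.cong) auto
    then show "d \<in> {d. P (digit_sum d n)}" using c(1) by simp
  qed
  also have "\<dots> \<in> sets digit_measure"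
    unfolding digit_measure_def
    by (intro sets.countable_UN'' countableI_type product_pmf_cylinder(1)) auto
  finally show ?thesis .
qed

text \<open>\<open>E j\<close> fixes the first N digits to be those of j and has probability 1/N!. A
  residue class modulo n contains q = N!/n such disjoint events, so it has probability at least 1/n.
  The n classes have total mass at most 1, which forces equality; in this way the null set of
  sequences with some d k > k never has to be handled.\<close>

lemma digit_measure_eq:
  assumes n: "n > 0" "n dvd fact N" and i: "i < n"
  shows "measure digit_measure {d. digit_sum d N mod n = i} = 1 / real n"
proof -
  interpret prob_space digit_measure unfolding digit_measure_def by (rule prob_space_product_pmf)
  have sp: "space digit_measure = UNIV" unfolding digit_measure_def by (simp add: space_PiM)
  define E where "E j = {d :: nat \<Rightarrow> nat. \<forall>k\<in>{..<N}. d k \<in> {j div fact k mod Suc k}}" for j :: nat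
  have E: "E j \<in> events" for j
    unfolding E_def digit_measure_def by (rule product_pmf_cylinder(1)) simp
  have sum: "digit_sum d N = j mod fact N" if "d \<in> E j" for d j
  proof -
    have "digit_sum d N = digit_sum (\<lambda>k. (j div fact k) mod Suc k) N"
      using that unfolding digit_sum_def E_def by (intro sum.cong) auto
    then show ?thesis by (simp add: digit_sum_mod)
  qed
  have mE: "measure digit_measure (E j) = 1 / fact N" for j
  proof -
    have "measure digit_measure (E j) = (\<Prod>k<N. measure_pmf.prob (pmf_of_set {..k}) {j div fact k mod Suc k})"
      unfolding E_def digit_measure_def by (rule product_pmf_cylinder(2)) simp
    also have "\<dots> = (\<Prod>k<N. 1 / real (Suc k))"
    proof (intro prod.cong refl)
      fix k assume "k \<in> {..<N}"
      have "j div fact k mod Suc k \<in> {..k}" by (simp add: less_Suc_eq_le[symmetric])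
      then show "measure_pmf.prob (pmf_of_set {..k}) {j div fact k mod Suc k} = 1 / real (Suc k)"
        by (simp add: measure_pmf_single)
    qed
    also have "\<dots> = 1 / fact N" by (induction N) simp_all
    finally show ?thesis .
  qed
  obtain q where q: "fact N = n * q" using n(2) by blast
  have ge: "measure digit_measure {d. digit_sum d N mod n = i} \<ge> 1 / real n" if i: "i < n" for i
  proof -
    have lt: "i + n * t < fact N" if "t < q" for t
    proof -
      have "i + n * t < n + n * t" using i by simp
      also have "\<dots> \<le> n * q" using that by (metis Suc_leI mult_Suc_right mult_le_mono2)
      finally show ?thesis using q by simp
    qed
    have "(\<Union>t<q. E (i + n * t)) \<subseteq> {d. digit_sum d N mod n = i}"
      using sum lt i by fastforce
    then have "measure digit_measure (\<Union>t<q. E (i + n * t)) \<le> measure digit_measure {d. digit_sum d N mod n = i}"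
      by (rule finite_measure_mono[OF _ digit_sum_measurable])
    moreover have "disjoint_family_on (\<lambda>t. E (i + n * t)) {..<q}"
      unfolding disjoint_family_on_def
    proof (intro ballI impI)
      fix s t assume st: "s \<in> {..<q}" "t \<in> {..<q}" "s \<noteq> t"
      have "False" if "d \<in> E (i + n * s)" "d \<in> E (i + n * t)" for d
      proof -
        have "i + n * s = i + n * t" using sum[OF that(1)] sum[OF that(2)] lt[of s] lt[of t] st by simp
        then show False using st n(1) by simp
      qed
      then show "E (i + n * s) \<inter> E (i + n * t) = {}" by blast
    qed
    then have "measure digit_measure (\<Union>t<q. E (i + n * t)) = (\<Sum>t<q. measure digit_measure (E (i + n * t)))"
      using E by (intro finite_measure_finite_Union) auto
    moreover have "(\<Sum>t<q. measure digit_measure (E (i + n * t))) = real q / fact N"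
      by (simp add: mE)
    moreover have "real q / fact N = 1 / real n"
    proof -
      have "(fact N :: real) = real n * real q" using q by (metis of_nat_fact of_nat_mult)
      moreover have "q > 0" using q by (metis fact_gt_zero gr_zeroI mult_0_right less_irrefl)
      ultimately show ?thesis using n(1) by simp
    qed
    ultimately show ?thesis by simp
  qed
  have "(\<Sum>i<n. measure digit_measure {d. digit_sum d N mod n = i}) =
      measure digit_measure (\<Union>i<n. {d. digit_sum d N mod n = i})"
    by (intro finite_measure_finite_Union[symmetric])
      (auto simp: disjoint_family_on_def intro: digit_sum_measurable[where P = "\<lambda>s. s mod n = _"])
  also have "\<dots> \<le> 1" by (rule prob_le_1)
  finally have le: "(\<Sum>i<n. measure digit_measure {d. digit_sum d N mod n = i}) \<le> 1" .
  have "measure digit_measure {d. digit_sum d N mod n = i} + (\<Sum>i\<in>{..<n} - {i}. 1 / real n) \<le>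
      measure digit_measure {d. digit_sum d N mod n = i} + (\<Sum>i\<in>{..<n} - {i}. measure digit_measure {d. digit_sum d N mod n = i})"
    by (intro add_left_mono sum_mono ge) auto
  also have "\<dots> \<le> 1" using le i by (subst (asm) sum.remove[of _ i]) auto
  finally have "measure digit_measure {d. digit_sum d N mod n = i} \<le> 1 - real (n - 1) / real n"
    using i by simp
  also have "\<dots> = 1 / real n" using n(1) by (simp add: field_simps of_nat_diff)
  finally show ?thesis using ge[OF i] by simp
qed

text \<open>The exponent v has probability (1 - q) q^v with q = p powr (1 - beta), the choice for
  which the exponent is at least v with probability q^v. At beta = 1 this tail is constantly 1, and
  the law degenerates to the exponent infinity. The index p runs through all natural numbers, whence
  the default for p < 2.\<close>

definition exponent_pmf :: "real \<Rightarrow> nat \<Rightarrow> enat pmf" where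
  "exponent_pmf \<beta> p = (if \<beta> > 1 \<and> p > 1 then map_pmf enat (geometric_pmf (1 - real p powr (1 - \<beta>)))
     else return_pmf \<infinity>)"

lemma geometric_pmf_tail:
  assumes "0 \<le> q" "q < 1"
  shows "measure_pmf.prob (geometric_pmf (1 - q)) {v..} = q ^ v"
proof -
  have "measure_pmf.prob (geometric_pmf (1 - q)) (- {..<v}) = 1 - measure_pmf.prob (geometric_pmf (1 - q)) {..<v}"
    using measure_pmf.prob_compl[of "{..<v}" "geometric_pmf (1 - q)"] by (simp add: Compl_eq_Diff_UNIV)
  also have "measure_pmf.prob (geometric_pmf (1 - q)) {..<v} = (\<Sum>k<v. q ^ k * (1 - q))"
    using assms by (simp add: measure_measure_pmf_finite)
  also have "\<dots> = 1 - q ^ v" by (induction v) (auto simp: algebra_simps)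
  also have "- {..<v} = {v..}" by auto
  finally show ?thesis by simp
qed

lemma exponent_pmf_tail:
  assumes \<beta>: "\<beta> \<ge> 1" and p: "prime p"
  shows "measure_pmf.prob (exponent_pmf \<beta> p) {x. enat v \<le> x} = (real p powr (1 - \<beta>)) ^ v"
proof (cases "\<beta> > 1")
  case True
  have p1: "p > 1" using p by (rule prime_gt_1_nat)
  have "real p powr (1 - \<beta>) < real p powr 0" using True p1 by (intro powr_less_mono) auto
  then have q: "real p powr (1 - \<beta>) < 1" using p1 by simp
  have "enat -` {x. enat v \<le> x} = {v..}" by auto
  then show ?thesis using True p1 geometric_pmf_tail[OF _ q, of v] by (simp add: exponent_pmf_def)
next
  case False
  then show ?thesis using \<beta> p prime_gt_0_nat[OF p] by (simp add: exponent_pmf_def)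
qed

definition exponent_measure :: "real \<Rightarrow> (nat \<Rightarrow> enat) measure" where
  "exponent_measure \<beta> = PiM UNIV (\<lambda>p. measure_pmf (exponent_pmf \<beta> p))"

text \<open>Divisibility by n bounds the exponents at the prime factors of n from below. By
  independence the tails multiply to the product of the prime powers in n, raised to 1 -
  beta.\<close>

lemma exponent_measure_eq:
  assumes \<beta>: "\<beta> \<ge> 1" and n: "n > 0"
  shows "{e. adele_pow e \<in> zideal (of_nat n)} \<in> sets (exponent_measure \<beta>)"
    and "measure (exponent_measure \<beta>) {e. adele_pow e \<in> zideal (of_nat n)} = real n powr (1 - \<beta>)"
proof -
  have eq: "{e. adele_pow e \<in> zideal (of_nat n)} =
      {e. \<forall>p\<in>prime_factors n. e p \<in> {x. enat (multiplicity p n) \<le> x}}"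
    using adele_pow_zideal_iff[OF n] by simp
  show "{e. adele_pow e \<in> zideal (of_nat n)} \<in> sets (exponent_measure \<beta>)"
    unfolding eq exponent_measure_def by (rule product_pmf_cylinder(1)) simp
  have "measure (exponent_measure \<beta>) {e. adele_pow e \<in> zideal (of_nat n)} =
      (\<Prod>p\<in>prime_factors n. measure_pmf.prob (exponent_pmf \<beta> p) {x. enat (multiplicity p n) \<le> x})"
    unfolding eq exponent_measure_def by (rule product_pmf_cylinder(2)) simp
  also have "\<dots> = (\<Prod>p\<in>prime_factors n. (real p ^ multiplicity p n) powr (1 - \<beta>))"
  proof (intro prod.cong refl)
    fix p assume "p \<in> prime_factors n"
    then have p: "prime p" by auto
    have "(real p ^ multiplicity p n) powr (1 - \<beta>) = (real p powr (1 - \<beta>)) ^ multiplicity p n"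
      using prime_gt_0_nat[OF p] by (simp add: powr_power powr_realpow[symmetric] powr_powr mult.commute)
    then show "measure_pmf.prob (exponent_pmf \<beta> p) {x. enat (multiplicity p n) \<le> x} =
        (real p ^ multiplicity p n) powr (1 - \<beta>)"
      using exponent_pmf_tail[OF \<beta> p] by simp
  qed
  also have "\<dots> = (\<Prod>p\<in>prime_factors n. real p ^ multiplicity p n) powr (1 - \<beta>)"
    by (rule prod_powr_distrib[symmetric])
  also have "(\<Prod>p\<in>prime_factors n. real p ^ multiplicity p n) = real (\<Prod>p\<in>prime_factors n. p ^ multiplicity p n)"
    by simp
  also have "(\<Prod>p\<in>prime_factors n. p ^ multiplicity p n) = n"
    using prime_factorization_nat[OF n] by simp
  finally show "measure (exponent_measure \<beta>) {e. adele_pow e \<in> zideal (of_nat n)} = real n powr (1 - \<beta>)" .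
qed

lemma exists_scaling_probability:
  assumes \<beta>: "\<beta> \<ge> 1" shows "\<exists>\<mu>. scaling_probability \<beta> \<mu>"
proof -
  let ?D = digit_measure and ?E = "exponent_measure \<beta>"
  interpret D: prob_space ?D unfolding digit_measure_def by (rule prob_space_product_pmf)
  interpret E: prob_space ?E unfolding exponent_measure_def by (rule prob_space_product_pmf)
  interpret DE: pair_prob_space ?D ?E ..
  have sp: "space ?D = UNIV" "space ?E = UNIV"
    unfolding digit_measure_def exponent_measure_def by (simp_all add: space_PiM)
  define r where "r d = adele_lim (\<lambda>n. int (digit_sum d n))" for d
  define \<Phi> where "\<Phi> = (\<lambda>(d, e). pt (r d) (adele_pow e))"
  have r: "r d - of_int (int (digit_sum d n)) \<in> zideal (fact n)" for d n
    unfolding r_def by (rule adele_lim) (simp add: digit_sum_def)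
  \<comment> \<open>The digit sum below n already determines r modulo n, because n divides
    n!.\<close>
  have r_iff: "r d - of_int m \<in> zideal (of_nat n) \<longleftrightarrow> digit_sum d n mod n = nat (m mod int n)"
    if n: "n > 0" for d m n
  proof -
    have "n dvd fact n" using n by (intro dvd_fact) auto
    then have 1: "r d - of_int (int (digit_sum d n)) \<in> zideal (of_nat n)"
      using r[of d n] zideal_antimono_dvd[of n "fact n"] by auto
    have "r d - of_int m \<in> zideal (of_nat n) \<longleftrightarrow> of_int (int (digit_sum d n) - m) \<in> zideal (of_nat n)"
      using zideal_add[OF 1, of "of_int (int (digit_sum d n) - m)"] zideal_diff[OF _ 1, of "r d - of_int m"] by auto
    also have "\<dots> \<longleftrightarrow> int n dvd int (digit_sum d n) - m" by (rule of_int_zideal_iff[OF n])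
    also have "\<dots> \<longleftrightarrow> int (digit_sum d n mod n) = m mod int n"
      by (simp add: mod_eq_dvd_iff[symmetric] zmod_int)
    also have "\<dots> \<longleftrightarrow> digit_sum d n mod n = nat (m mod int n)"
      using n by (auto simp: nat_eq_iff2)
    finally show ?thesis .
  qed
  \<comment> \<open>A cylinder pulls back to a rectangle; this is where the independence of r and a
    enters.\<close>
  have pre: "\<Phi> -` cyl m n \<inter> space (?D \<Otimes>\<^sub>M ?E) =
      {d. digit_sum d n mod n = nat (m mod int n)} \<times> {e. adele_pow e \<in> zideal (of_nat n)}"
    if n: "n > 0" for m n
  proof (rule Set.set_eqI)
    fix x :: "(nat \<Rightarrow> nat) \<times> (nat \<Rightarrow> enat)"
    obtain d e where x: "x = (d, e)" by (cases x)
    show "x \<in> \<Phi> -` cyl m n \<inter> space (?D \<Otimes>\<^sub>M ?E) \<longleftrightarrow>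
        x \<in> {d. digit_sum d n mod n = nat (m mod int n)} \<times> {e. adele_pow e \<in> zideal (of_nat n)}"
      unfolding x by (simp add: \<Phi>_def space_pair_measure sp pt_in_cyl r_iff[OF n] conj_commute)
  qed
  have rz: "r d \<in> zhat" for d
    using zhat_add[OF _ zhat_of_int, of "r d - of_int (int (digit_sum d 0))" "int (digit_sum d 0)"] r[of d 0]
    by (simp add: zideal_1)
  have meas: "\<Phi> \<in> measurable (?D \<Otimes>\<^sub>M ?E) Omega_borel"
  proof (rule measurable_sigma_sets[OF sets_Omega_borel cyls_subset])
    show "\<Phi> \<in> space (?D \<Otimes>\<^sub>M ?E) \<rightarrow> topspace Omega_B"
      unfolding \<Phi>_def topspace_Omega_B cyl_0_1 using rz adele_pow_zhat by auto
    fix A assume "A \<in> cyls"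
    then consider "A = {}" | m n where "n > 0" "A = cyl m n" unfolding cyls_def by blast
    then show "\<Phi> -` A \<inter> space (?D \<Otimes>\<^sub>M ?E) \<in> sets (?D \<Otimes>\<^sub>M ?E)"
    proof cases
      case 2
      show ?thesis unfolding 2(2) pre[OF 2(1)]
        using exponent_measure_eq(1)[OF \<beta> 2(1)] digit_sum_measurable by (intro pair_measureI)
    qed simp
  qed
  define \<mu> where "\<mu> = distr (?D \<Otimes>\<^sub>M ?E) Omega_borel \<Phi>"
  have "scaling_probability \<beta> \<mu>"
  proof (rule scaling_probabilityI)
    show "prob_space \<mu>" unfolding \<mu>_def by (rule DE.prob_space_distr[OF meas])
    show "sets \<mu> = sets Omega_borel" by (simp add: \<mu>_def)
    fix m n assume n: "(n::nat) > 0"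
    have i: "nat (m mod int n) < n" using n by (simp add: nat_less_iff)
    have nf: "n dvd fact n" using n by (intro dvd_fact) auto
    have "measure \<mu> (cyl m n) = measure (?D \<Otimes>\<^sub>M ?E)
        ({d. digit_sum d n mod n = nat (m mod int n)} \<times> {e. adele_pow e \<in> zideal (of_nat n)})"
      unfolding \<mu>_def pre[OF n, symmetric] using measure_distr[OF meas cyl_borel[OF n]] by simp
    also have "\<dots> = measure ?D {d. digit_sum d n mod n = nat (m mod int n)} *
        measure ?E {e. adele_pow e \<in> zideal (of_nat n)}"
      using digit_sum_measurable[of "\<lambda>s. s mod n = _" n] exponent_measure_eq(1)[OF \<beta> n]
      by (simp add: measure_def E.emeasure_pair_measure_Times enn2real_mult)
    also have "\<dots> = 1 / real n * real n powr (1 - \<beta>)"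
      using digit_measure_eq[OF n nf i] exponent_measure_eq(2)[OF \<beta> n] by simp
    also have "\<dots> = real n powr - \<beta>"
      using n by (simp add: powr_diff powr_minus field_simps)
    finally show "measure \<mu> (cyl m n) = real n powr - \<beta>" .
  qed
  then show ?thesis by blast
qed

section \<open>Continuous functions\<close>

text \<open>Points are pairs of sets, and should not be split into their components.\<close>

declare split_paired_All [simp del] split_paired_Ex [simp del]

section \<open>The affine group and translation of functions\<close>

lemma affine_group_simps [simp]:
  "carrier affine_group = {(m, k). k > 0}" "\<one>\<^bsub>affine_group\<^esub> = (0, 1)"
  "(m, k) \<otimes>\<^bsub>affine_group\<^esub> (n, l) = (m + k * n, k * l)"
  by (simp_all add: affine_group_def)

lemma group_affine: "group affine_group"
proof (rule groupI)
  fix x assume "x \<in> carrier affine_group"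
  then obtain m k where x: "x = (m, k)" "k > 0" by auto
  then show "\<exists>y\<in>carrier affine_group. y \<otimes>\<^bsub>affine_group\<^esub> x = \<one>\<^bsub>affine_group\<^esub>"
    by (intro bexI[of _ "(- (m / k), 1 / k)"]) auto
qed (auto simp: algebra_simps)

lemma inv_affine:
  assumes "k > 0" shows "inv\<^bsub>affine_group\<^esub> (m, k) = (- (m / k), 1 / k)"
  by (rule group.inv_equality[OF group_affine]) (use assms in auto)

lemma act_mult: "act (g \<otimes>\<^bsub>affine_group\<^esub> h) x = act g (act h x)"
  by (cases g; cases h) (simp add: act_act)

lemma act_inv: "g \<in> carrier affine_group \<Longrightarrow> act (inv\<^bsub>affine_group\<^esub> g) (act g x) = x"
  using group.l_inv[OF group_affine, of g] act_mult[of "inv\<^bsub>affine_group\<^esub> g" g x] by simp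

lemma act_inv': "g \<in> carrier affine_group \<Longrightarrow> act g (act (inv\<^bsub>affine_group\<^esub> g) x) = x"
  using group.r_inv[OF group_affine, of g] act_mult[of g "inv\<^bsub>affine_group\<^esub> g" x] by simp

lemma translate_one [simp]: "translate (0, 1) f = f"
  using inv_affine[of 1 0] by (simp add: translate_def)

lemma translate_translate:
  assumes "g \<in> carrier affine_group" "h \<in> carrier affine_group"
  shows "translate g (translate h f) = translate (g \<otimes>\<^bsub>affine_group\<^esub> h) f"
  using group.inv_mult_group[OF group_affine assms] by (simp add: translate_def act_mult)

text \<open>Makes the limit rules applicable to continuity on an abstract topology.\<close>

lemma continuous_map_iff_tendsto:
  "continuous_map X euclidean f \<longleftrightarrow> (\<forall>x\<in>topspace X. (f \<longlongrightarrow> f x) (atin X x))"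
  by (simp add: continuous_map_atin limitin_canonical_iff)

section \<open>The function algebras and uniform continuity\<close>

abbreviation CB :: "(point \<Rightarrow> complex) set" where
  "CB \<equiv> carrier (C_alg Omega_B)"

abbreviation C0 :: "(point \<Rightarrow> complex) set" where
  "C0 \<equiv> carrier (C0_alg Omega_tilde)"

lemma CB_iff:
  "f \<in> CB \<longleftrightarrow> continuous_map Omega_B euclidean f \<and> (\<forall>x. x \<notin> topspace Omega_B \<longrightarrow> f x = 0)"
  by (simp add: C_alg_def function_cstar_def)

lemma C0_iff:
  "f \<in> C0 \<longleftrightarrow> continuous_map Omega_tilde euclidean f \<and> (\<forall>x. x \<notin> topspace Omega_tilde \<longrightarrow> f x = 0) \<and>
     (\<forall>e>0. \<exists>K. compactin Omega_tilde K \<and> (\<forall>x\<in>topspace Omega_tilde - K. cmod (f x) < e))"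
  by (simp add: C0_alg_def function_cstar_def)

lemma C_alg_simps [simp]:
  "f \<otimes>\<^bsub>C_alg X\<^esub> g = (\<lambda>x. f x * g x)" "f \<oplus>\<^bsub>C_alg X\<^esub> g = (\<lambda>x. f x + g x)"
  "scl (C_alg X) c f = (\<lambda>x. c * f x)" "adj (C_alg X) f = (\<lambda>x. cnj (f x))"
  "\<one>\<^bsub>C_alg X\<^esub> = indicator (topspace X)"
  by (simp_all add: C_alg_def function_cstar_def)

lemma CB_add: "f \<in> CB \<Longrightarrow> g \<in> CB \<Longrightarrow> (\<lambda>x. f x + g x) \<in> CB"
  and CB_diff: "f \<in> CB \<Longrightarrow> g \<in> CB \<Longrightarrow> (\<lambda>x. f x - g x) \<in> CB"
  and CB_mult: "f \<in> CB \<Longrightarrow> g \<in> CB \<Longrightarrow> (\<lambda>x. f x * g x) \<in> CB"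
  and CB_scale: "f \<in> CB \<Longrightarrow> (\<lambda>x. c * f x) \<in> CB"
  and CB_cnj: "f \<in> CB \<Longrightarrow> (\<lambda>x. cnj (f x)) \<in> CB"
  and CB_zero: "(\<lambda>x. 0) \<in> CB"
  unfolding CB_iff continuous_map_iff_tendsto by (auto intro!: tendsto_intros)

text \<open>The condition h 0 = 0 keeps the composition zero outside Omega_B.\<close>

lemma CB_real_compose:
  assumes f: "f \<in> CB" and h: "\<And>z. isCont h z" "h 0 = 0"
  shows "(\<lambda>x. h (f x)) \<in> CB"
  using f h unfolding CB_iff continuous_map_iff_tendsto by (auto intro: isCont_tendsto_compose)

lemma CB_sum: "finite I \<Longrightarrow> (\<And>i. i \<in> I \<Longrightarrow> F i \<in> CB) \<Longrightarrow> (\<lambda>x. \<Sum>i\<in>I. F i x) \<in> CB"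
  by (induction rule: finite_induct) (auto intro: CB_add CB_zero)

lemma CB_bounded:
  assumes "f \<in> CB" obtains B where "\<And>x. cmod (f x) \<le> B"
proof -
  have "compact (f ` topspace Omega_B)"
    using image_compactin[of Omega_B "topspace Omega_B" euclidean f] assms compact_space_Omega_B
    by (simp add: CB_iff compact_space_def)
  then obtain B where B: "\<And>z. z \<in> f ` topspace Omega_B \<Longrightarrow> cmod z \<le> B"
    using compact_imp_bounded bounded_iff by metis
  have "cmod (f x) \<le> max B 0" for x
  proof (cases "x \<in> topspace Omega_B")
    case True then show ?thesis using B[OF imageI[OF True, of f]] by simp
  next
    case False then show ?thesis using assms by (simp add: CB_iff)
  qed
  then show ?thesis using that by blast
qed

lemma indicator_CB:
  assumes "openin Omega_tilde U" "closedin Omega_tilde U" "U \<subseteq> cyl 0 1"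
  shows "(indicator U :: point \<Rightarrow> complex) \<in> CB"
proof -
  have o: "openin Omega_B U" using assms by (simp add: openin_Omega_B)
  have c: "openin Omega_B (topspace Omega_B - U)"
    using openin_diff[OF openin_cyl[of 1 0] assms(2)] unfolding openin_Omega_B topspace_Omega_B by auto
  have "openin Omega_B {x \<in> topspace Omega_B. (indicator U x :: complex) \<in> W}" for W :: "complex set"
  proof -
    have sub: "U \<subseteq> topspace Omega_B" using assms(3) topspace_Omega_B by simp
    have "{x \<in> topspace Omega_B. (indicator U x :: complex) \<in> W} =
        (if 1 \<in> W then U else {}) \<union> (if 0 \<in> W then topspace Omega_B - U else {})"
      using sub by (auto simp: indicator_def)
    then show ?thesis using o c by auto
  qed
  then show ?thesis unfolding CB_iff continuous_map_def topspace_Omega_B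
    using assms(3) by (auto simp: indicator_def)
qed

lemma indicator_cyl_CB: "n > 0 \<Longrightarrow> (indicator (cyl m n) :: point \<Rightarrow> complex) \<in> CB"
  by (intro indicator_CB openin_cyl closedin_cyl cyl_subset)

lemma indicator_Omega_CB: "(indicator (topspace Omega_B) :: point \<Rightarrow> complex) \<in> CB"
  unfolding topspace_Omega_B by (rule indicator_cyl_CB) simp

text \<open>Uniform continuity for the partitions by \<open>cyl_equiv\<close>. Around each x the
  function varies by less than e/2 on a class of some level; finitely many of these classes cover
  Omega_B, and the product N of their levels refines them all.\<close>

lemma CB_uniform:
  assumes f: "f \<in> CB" and e: "e > 0"
  shows "\<exists>N>0. \<forall>x\<in>topspace Omega_B. \<forall>y\<in>topspace Omega_B. cyl_equiv N x y \<longrightarrow> cmod (f x - f y) < e"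
proof -
  define cls where "cls N x = {y \<in> topspace Omega_B. cyl_equiv N x y}" for N x
  \<comment> \<open>A class at level N is invariant under shifts by N zhat, because every level n
    that it involves divides N.\<close>
  have opn: "openin Omega_B (cls N x)" if N: "N > 0" for N x
    unfolding openin_Omega_B openin_tilde_iff
  proof (intro conjI allI impI)
    show "cls N x \<subseteq> topspace Omega_tilde" "cls N x \<subseteq> cyl 0 1"
      using cyl_subset_tilde unfolding cls_def topspace_Omega_B by auto
    fix r a assume ra: "pt r a \<in> cls N x"
    have "pt (r + of_nat N * s) (a + of_nat N * t) \<in> cls N x" if st: "s \<in> zhat" "t \<in> zhat" for s t
    proof -
      have "pt (r + of_nat N * s) (a + of_nat N * t) \<in> cyl m n \<longleftrightarrow> pt r a \<in> cyl m n" if nN: "n dvd N" for m n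
      proof -
        obtain k where k: "N = n * k" using nN by blast
        have "n > 0" using N k by simp
        then show ?thesis
          using pt_shift_in_cyl[of "of_nat k * s" "of_nat k * t" n r a m] st
          unfolding k of_nat_mult mult.assoc by (simp add: zhat_mult)
      qed
      from this[of 1 0] this show ?thesis
        using ra unfolding cls_def cyl_equiv_def topspace_Omega_B by simp
    qed
    then show "\<exists>N'>0. \<forall>s\<in>zhat. \<forall>t\<in>zhat. pt (r + of_nat N' * s) (a + of_nat N' * t) \<in> cls N x"
      using N by blast
  qed
  have "\<exists>N>0. \<forall>y\<in>topspace Omega_B. cyl_equiv N x y \<longrightarrow> cmod (f y - f x) < e / 2"
    if x: "x \<in> topspace Omega_B" for x
  proof -
    have "open {z. cmod (z - f x) < e / 2}"
    proof -
      have "{z. cmod (z - f x) < e / 2} = ball (f x) (e / 2)" by (auto simp: dist_norm norm_minus_commute)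
      then show ?thesis by simp
    qed
    then have "openin Omega_B {y \<in> topspace Omega_B. f y \<in> {z. cmod (z - f x) < e / 2}}"
      using f unfolding CB_iff by (intro openin_continuous_map_preimage) auto
    then have "openin Omega_tilde {y \<in> topspace Omega_B. f y \<in> {z. cmod (z - f x) < e / 2}}"
      by (simp add: openin_Omega_B)
    from cyl_equiv_base'[OF this x] show ?thesis using x e by simp
  qed
  then obtain \<N> where \<N>: "\<And>x. x \<in> topspace Omega_B \<Longrightarrow> \<N> x > 0"
    "\<And>x y. x \<in> topspace Omega_B \<Longrightarrow> y \<in> topspace Omega_B \<Longrightarrow> cyl_equiv (\<N> x) x y \<Longrightarrow> cmod (f y - f x) < e / 2"
    by metis
  have cov: "topspace Omega_B \<subseteq> \<Union>((\<lambda>x. cls (\<N> x) x) ` topspace Omega_B)"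
    unfolding cls_def by auto
  have "\<exists>F\<subseteq>(\<lambda>x. cls (\<N> x) x) ` topspace Omega_B. finite F \<and> topspace Omega_B \<subseteq> \<Union>F"
  proof -
    have "compactin Omega_B (topspace Omega_B)"
      using compact_space_Omega_B by (simp add: compact_space_def)
    from compactinD[OF this _ cov] show ?thesis using opn \<N>(1) by blast
  qed
  then obtain F where F: "F \<subseteq> (\<lambda>x. cls (\<N> x) x) ` topspace Omega_B" "finite F" "topspace Omega_B \<subseteq> \<Union>F"
    by blast
  obtain X where X: "X \<subseteq> topspace Omega_B" "finite X" "F = (\<lambda>x. cls (\<N> x) x) ` X"
    using finite_subset_image[OF F(2,1)] by blast
  note X = X(1,2) F(3)[unfolded X(3)]
  define N where "N = (\<Prod>x\<in>X. \<N> x)"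
  have N: "N > 0" unfolding N_def using X(1) \<N>(1) by (intro prod_pos) auto
  have "cmod (f y - f z) < e"
    if yz: "y \<in> topspace Omega_B" "z \<in> topspace Omega_B" "cyl_equiv N y z" for y z
  proof -
    obtain x where x: "x \<in> X" "cyl_equiv (\<N> x) x y" using X(3) yz(1) unfolding cls_def by auto
    have xo: "x \<in> topspace Omega_B" using X(1) x(1) by blast
    have "\<N> x dvd N" unfolding N_def using X(2) x(1) by (rule dvd_prodI)
    then have "cyl_equiv (\<N> x) x z" using cyl_equiv_trans[OF x(2) cyl_equiv_dvd[OF yz(3)]] by blast
    then have "cmod (f z - f x) < e / 2" "cmod (f y - f x) < e / 2"
      using \<N>(2)[OF xo] yz x(2) by auto
    then show ?thesis using norm_triangle_ineq4[of "f y - f x" "f z - f x"] by simp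
  qed
  then show ?thesis using N by blast
qed

section \<open>Functionals on C(Omega_B) are determined on cylinders\<close>

lemma cyl_cong: "int n dvd m - m' \<Longrightarrow> n > 0 \<Longrightarrow> cyl m n = cyl m' n"
proof -
  assume a: "int n dvd m - m'" "n > 0"
  have d: "of_int m - of_int m' \<in> zideal (of_nat n)" using of_int_zideal_iff[OF a(2), of "m - m'"] a(1) by simp
  have "r - of_int m \<in> zideal (of_nat n) \<longleftrightarrow> r - of_int m' \<in> zideal (of_nat n)" for r
    using zideal_add[OF _ d, of "r - of_int m"] zideal_diff[OF _ d, of "r - of_int m'"] by auto
  then show ?thesis unfolding cyl_def by simp
qed

text \<open>Residues m matter only modulo N, so a class is cut out by finitely many cylinders; the
  finite induction in \<open>functional_zero\<close> needs this.\<close>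

lemma cyl_equiv_iff_finite:
  assumes N: "N > 0"
  shows "cyl_equiv N x y \<longleftrightarrow>
    (\<forall>(m, n)\<in>{0..<int N} \<times> {n. n dvd N}. y \<in> cyl m n \<longleftrightarrow> x \<in> cyl m n)"
proof
  assume *: "\<forall>(m, n)\<in>{0..<int N} \<times> {n. n dvd N}. y \<in> cyl m n \<longleftrightarrow> x \<in> cyl m n"
  show "cyl_equiv N x y" unfolding cyl_equiv_def
  proof (intro allI impI)
    fix n m assume n: "n dvd N"
    have "int N dvd m - m mod int N" by (simp add: mod_eq_dvd_iff[symmetric])
    then have "int n dvd m - m mod int N" by (rule dvd_trans[rotated]) (use n in simp)
    then have "cyl m n = cyl (m mod int N) n" using n N by (intro cyl_cong) (auto intro: dvd_pos_nat)
    then show "x \<in> cyl m n \<longleftrightarrow> y \<in> cyl m n" using * n N by auto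
  qed
qed (auto simp: cyl_equiv_def)

text \<open>The indicators of the \<open>cyl_equiv\<close> classes lie in the linear span of the
  indicators of cylinders, so D kills them. By uniform continuity f is within e of a finite
  combination of such indicators, and boundedness of D finishes the argument.\<close>

lemma functional_zero:
  fixes D :: "(point \<Rightarrow> complex) \<Rightarrow> complex"
  assumes add: "\<And>f g. f \<in> CB \<Longrightarrow> g \<in> CB \<Longrightarrow> D (\<lambda>x. f x + g x) = D f + D g"
    and scl: "\<And>f c. f \<in> CB \<Longrightarrow> D (\<lambda>x. c * f x) = c * D f"
    and bdd: "\<And>f B. f \<in> CB \<Longrightarrow> (\<And>x. cmod (f x) \<le> B) \<Longrightarrow> cmod (D f) \<le> K * B"
    and cyl: "\<And>m n. n > 0 \<Longrightarrow> D (indicator (cyl m n)) = 0"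
    and f: "f \<in> CB"
  shows "D f = 0"
proof -
  have D0: "D (\<lambda>x. 0) = 0" using scl[OF CB_zero, of 0] by simp
  have diff: "D (\<lambda>x. f x - g x) = D f - D g" if "f \<in> CB" "g \<in> CB" for f g
    using add[OF that(1) CB_scale[OF that(2), of "- 1"]] scl[OF that(2), of "- 1"] by simp
  have Dsum: "D (\<lambda>x. \<Sum>i\<in>I. F i x) = (\<Sum>i\<in>I. D (F i))" if "finite I" "\<And>i. i \<in> I \<Longrightarrow> F i \<in> CB"
    for I :: "point set set" and F using that
    by (induction rule: finite_induct) (auto simp: D0 add CB_sum)
  define good where "good A \<longleftrightarrow> (indicator A :: point \<Rightarrow> complex) \<in> CB \<and> D (indicator A) = 0" for A
  have cyls: "good B" if "B \<in> cyls" for B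
    using that D0 CB_zero cyl indicator_cyl_CB unfolding cyls_def good_def
    by (auto simp: indicator_def[of "{}", abs_def])
  \<comment> \<open>Inclusion and exclusion by induction on I. Intersecting with an arbitrary B from
    \<open>cyls\<close> makes it work: a complemented condition is the difference of the cases B and
    \<open>cyl m n \<inter> B\<close>.\<close>
  have atom: "good ({y \<in> topspace Omega_B. \<forall>(m, n)\<in>I. y \<in> cyl m n \<longleftrightarrow> (m, n) \<in> S} \<inter> B)"
    (is "good (?A I \<inter> B)")
    if "finite I" "\<forall>(m, n)\<in>I. n > 0" "B \<in> cyls" for I S B using that
  proof (induction I arbitrary: B rule: finite_induct)
    case empty
    have "?A {} \<inter> B = B" using empty(2) cyls_subset by auto
    then show ?case using cyls empty(2) by simp
  next
    case (insert mn I)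
    obtain m n where mn: "mn = (m, n)" by (cases mn)
    have n: "n > 0" and I: "\<forall>(m, n)\<in>I. n > 0" using insert.prems mn by auto
    have "cyl m n \<inter> B \<in> cyls" using Int_stable_cyls insert.prems n unfolding cyls_def Int_stable_def by blast
    then have 1: "good (?A I \<inter> (cyl m n \<inter> B))" using insert.IH I by blast
    have 2: "good (?A I \<inter> B)" using insert.IH I insert.prems by blast
    show ?case
    proof (cases "(m, n) \<in> S")
      case True
      then have "?A (insert mn I) \<inter> B = ?A I \<inter> (cyl m n \<inter> B)" unfolding mn by auto
      then show ?thesis using 1 by simp
    next
      case False
      then have eq: "?A (insert mn I) \<inter> B = (?A I \<inter> B) - (?A I \<inter> (cyl m n \<inter> B))" unfolding mn by auto
      have "(indicator (?A (insert mn I) \<inter> B) :: point \<Rightarrow> complex) =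
          (\<lambda>x. indicator (?A I \<inter> B) x - indicator (?A I \<inter> (cyl m n \<inter> B)) x)"
        unfolding eq by (rule ext) (auto simp: indicator_def)
      then show ?thesis using 1 2 CB_diff diff unfolding good_def by simp
    qed
  qed
  have K: "cmod (D f) \<le> K * e" if e: "e > 0" for e
  proof -
    obtain N where N: "N > 0" "\<And>x y. x \<in> topspace Omega_B \<Longrightarrow> y \<in> topspace Omega_B \<Longrightarrow>
        cyl_equiv N x y \<Longrightarrow> cmod (f x - f y) < e" using CB_uniform[OF f e] by blast
    define cls where "cls x = {y \<in> topspace Omega_B. cyl_equiv N x y}" for x
    have good_cls: "good (cls x)" for x
    proof -
      have "cls x = {y \<in> topspace Omega_B. \<forall>(m, n)\<in>{0..<int N} \<times> {n. n dvd N}.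
          y \<in> cyl m n \<longleftrightarrow> (m, n) \<in> {(m, n). x \<in> cyl m n}} \<inter> cyl 0 1"
        unfolding cls_def cyl_equiv_iff_finite[OF N(1)] using topspace_Omega_B by auto
      moreover have "cyl 0 1 \<in> cyls" unfolding cyls_def by auto
      ultimately show ?thesis
        using atom[of "{0..<int N} \<times> {n. n dvd N}" "cyl 0 1" "{(m, n). x \<in> cyl m n}"] N(1)
        by (auto intro: dvd_pos_nat)
    qed
    have cls_eq: "cls x = cls y" if "cyl_equiv N x y" for x y
      using that cyl_equiv_trans cyl_equiv_sym unfolding cls_def by blast
    have self: "x \<in> cls x" if "x \<in> topspace Omega_B" for x using that unfolding cls_def by simp
    define \<C> where "\<C> = cls ` topspace Omega_B"
    \<comment> \<open>Every class is the class of one of the N^2 integer points, which gives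
      finiteness.\<close>
    have "\<C> \<subseteq> (\<lambda>(i, j). cls (pt (of_int i) (of_int j))) ` ({0..<int N} \<times> {0..<int N})"
    proof
      fix c assume "c \<in> \<C>"
      then obtain x where x: "x \<in> topspace Omega_B" "c = cls x" unfolding \<C>_def by blast
      obtain i j where "i \<in> {0..<int N}" "j \<in> {0..<int N}" "cyl_equiv N x (pt (of_int i) (of_int j))"
        using cyl_equiv_integer_point'[OF x(1) N(1)] by blast
      then show "c \<in> (\<lambda>(i, j). cls (pt (of_int i) (of_int j))) ` ({0..<int N} \<times> {0..<int N})"
        unfolding x(2) using cls_eq by (intro image_eqI[of _ _ "(i, j)"]) auto
    qed
    then have fin: "finite \<C>" by (rule finite_subset) simp
    \<comment> \<open>The step function that takes on each class the value of f at a chosen point of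
      the class.\<close>
    define g where "g = (\<lambda>x. \<Sum>c\<in>\<C>. f (SOME y. y \<in> c) * indicator c x)"
    have trm: "(\<lambda>x. f (SOME y. y \<in> c) * indicator c x) \<in> CB" if "c \<in> \<C>" for c
      using that good_cls unfolding \<C>_def good_def by (auto intro: CB_scale)
    have gCB: "g \<in> CB" unfolding g_def using fin trm by (rule CB_sum)
    have "D g = (\<Sum>c\<in>\<C>. D (\<lambda>x. f (SOME y. y \<in> c) * indicator c x))"
      unfolding g_def by (rule Dsum[OF fin trm])
    also have "\<dots> = 0"
      using good_cls unfolding \<C>_def good_def by (intro sum.neutral) (auto simp: scl)
    finally have Dg: "D g = 0" .
    have "cmod (f x - g x) \<le> e" for x
    proof (cases "x \<in> topspace Omega_B")
      case True
      have cx: "cls x \<in> \<C>" using True unfolding \<C>_def by blast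
      have "indicator c x = (0::complex)" if c: "c \<in> \<C> - {cls x}" for c
      proof -
        obtain y where y: "c = cls y" using c unfolding \<C>_def by blast
        have "\<not> cyl_equiv N y x" using c cls_eq[of y x] y by blast
        then show ?thesis unfolding y cls_def by simp
      qed
      then have "g x = f (SOME y. y \<in> cls x) * indicator (cls x) x"
        unfolding g_def using fin cx by (subst sum.remove[OF fin cx]) simp
      then have gx: "g x = f (SOME y. y \<in> cls x)" using self[OF True] by simp
      have "(SOME y. y \<in> cls x) \<in> cls x" using self[OF True] by (rule someI)
      then have "cmod (f x - f (SOME y. y \<in> cls x)) < e"
        using N(2)[OF True, of "SOME y. y \<in> cls x"] unfolding cls_def by simp
      then show ?thesis unfolding gx by simp
    next
      case False
      then show ?thesis using f gCB e by (simp add: CB_iff)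
    qed
    then have "cmod (D (\<lambda>x. f x - g x)) \<le> K * e" using bdd[OF CB_diff[OF f gCB]] by blast
    then show ?thesis using diff[OF f gCB] Dg by simp
  qed
  have "cmod (D f) \<le> 0"
  proof (rule field_le_epsilon)
    fix e :: real assume e: "e > 0"
    \<comment> \<open>K has no sign assumption, so e is divided by the positive number |K| +
      1.\<close>
    have "K * e \<le> \<bar>K\<bar> * e" using e by (intro mult_right_mono) auto
    then have "K * e \<le> e * (\<bar>K\<bar> + 1)" using e unfolding distrib_left mult.commute[of e] by linarith
    then have "K * e / (\<bar>K\<bar> + 1) \<le> e" by (subst pos_divide_le_eq) auto
    then have "K * (e / (\<bar>K\<bar> + 1)) \<le> e" by simp
    then show "cmod (D f) \<le> 0 + e" using K[of "e / (\<bar>K\<bar> + 1)"] e by simp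
  qed
  then show ?thesis by simp
qed

lemma functional_eq:
  fixes L M :: "(point \<Rightarrow> complex) \<Rightarrow> complex"
  assumes L: "\<And>f g. f \<in> CB \<Longrightarrow> g \<in> CB \<Longrightarrow> L (\<lambda>x. f x + g x) = L f + L g"
      "\<And>f c. f \<in> CB \<Longrightarrow> L (\<lambda>x. c * f x) = c * L f"
      "\<And>f B. f \<in> CB \<Longrightarrow> (\<And>x. cmod (f x) \<le> B) \<Longrightarrow> cmod (L f) \<le> K * B"
    and M: "\<And>f g. f \<in> CB \<Longrightarrow> g \<in> CB \<Longrightarrow> M (\<lambda>x. f x + g x) = M f + M g"
      "\<And>f c. f \<in> CB \<Longrightarrow> M (\<lambda>x. c * f x) = c * M f"
      "\<And>f B. f \<in> CB \<Longrightarrow> (\<And>x. cmod (f x) \<le> B) \<Longrightarrow> cmod (M f) \<le> K' * B"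
    and eq: "\<And>m n. n > 0 \<Longrightarrow> L (indicator (cyl m n)) = M (indicator (cyl m n))"
    and f: "f \<in> CB"
  shows "L f = M f"
proof -
  have "L f - M f = 0"
  proof (rule functional_zero[where D = "\<lambda>f. L f - M f" and K = "K + K'"])
    fix f B assume fB: "f \<in> CB" "\<And>x. cmod (f x) \<le> B"
    have "cmod (L f) \<le> K * B" "cmod (M f) \<le> K' * B" using L(3) M(3) fB by blast+
    then show "cmod (L f - M f) \<le> (K + K') * B"
      using norm_triangle_ineq4[of "L f" "M f"] by (simp add: algebra_simps)
  qed (use L M eq f in \<open>auto simp: algebra_simps\<close>)
  then show ?thesis by simp
qed

section \<open>Functions vanishing at infinity and extension by zero\<close>

lemma C0_bounded:
  assumes "f \<in> C0" obtains B where "\<And>x. cmod (f x) \<le> B" "B > 0"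
proof -
  obtain K where K: "compactin Omega_tilde K" "\<And>x. x \<in> topspace Omega_tilde - K \<Longrightarrow> cmod (f x) < 1"
    using assms unfolding C0_iff by (meson zero_less_one)
  have "compact (f ` K)"
    using image_compactin[OF K(1), of euclidean f] assms by (simp add: C0_iff)
  then obtain B where B: "\<And>z. z \<in> f ` K \<Longrightarrow> cmod z \<le> B"
    using compact_imp_bounded bounded_iff by metis
  have "cmod (f x) \<le> max B 1" for x
  proof (cases "x \<in> K")
    case False
    then show ?thesis using K(2)[of x] assms by (cases "x \<in> topspace Omega_tilde") (auto simp: C0_iff)
  qed (use B[of "f x"] in auto)
  then show ?thesis using that[of "max B 1"] by simp
qed

lemma C0_mult:
  assumes f: "f \<in> C0" and g: "g \<in> C0" shows "(\<lambda>x. f x * g x) \<in> C0"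
  unfolding C0_iff
proof (intro conjI allI impI)
  show "continuous_map Omega_tilde euclidean (\<lambda>x. f x * g x)"
    using f g unfolding C0_iff continuous_map_iff_tendsto by (auto intro!: tendsto_intros)
  show "f x * g x = 0" if "x \<notin> topspace Omega_tilde" for x using f g that by (simp add: C0_iff)
  fix e :: real assume e: "e > 0"
  obtain B where B: "\<And>x. cmod (g x) \<le> B" "B > 0" using C0_bounded[OF g] by blast
  have "e / B > 0" using e B by simp
  then obtain K where K: "compactin Omega_tilde K" "\<forall>x\<in>topspace Omega_tilde - K. cmod (f x) < e / B"
    using f unfolding C0_iff by meson
  have "cmod (f x * g x) < e" if "x \<in> topspace Omega_tilde - K" for x
  proof -
    have "cmod (f x) * cmod (g x) \<le> cmod (f x) * B" using B by (intro mult_left_mono) auto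
    also have "\<dots> < e" using K(2) that B(2) by (simp add: field_simps)
    finally show ?thesis by (simp add: norm_mult)
  qed
  then show "\<exists>K. compactin Omega_tilde K \<and> (\<forall>x\<in>topspace Omega_tilde - K. cmod (f x * g x) < e)"
    using K(1) by blast
qed

lemma C0_scale:
  assumes f: "f \<in> C0" shows "(\<lambda>x. c * f x) \<in> C0"
  unfolding C0_iff
proof (intro conjI allI impI)
  show "continuous_map Omega_tilde euclidean (\<lambda>x. c * f x)"
    using f unfolding C0_iff continuous_map_iff_tendsto by (auto intro!: tendsto_intros)
  show "c * f x = 0" if "x \<notin> topspace Omega_tilde" for x using f that by (simp add: C0_iff)
  fix e :: real assume e: "e > 0"
  then have "e / (cmod c + 1) > 0" by (simp add: add_nonneg_pos)
  then obtain K where K: "compactin Omega_tilde K" "\<forall>x\<in>topspace Omega_tilde - K. cmod (f x) < e / (cmod c + 1)"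
    using f unfolding C0_iff by meson
  have "cmod (c * f x) < e" if "x \<in> topspace Omega_tilde - K" for x
  proof -
    have "cmod c * cmod (f x) \<le> (cmod c + 1) * cmod (f x)" by (intro mult_right_mono) auto
    also have "\<dots> < e"
      using K(2) that pos_less_divide_eq[of "cmod c + 1" "cmod (f x)" e]
      by (simp add: mult.commute add_nonneg_pos)
    finally show ?thesis by (simp add: norm_mult)
  qed
  then show "\<exists>K. compactin Omega_tilde K \<and> (\<forall>x\<in>topspace Omega_tilde - K. cmod (c * f x) < e)"
    using K(1) by blast
qed

lemma C0_cnj:
  assumes f: "f \<in> C0" shows "(\<lambda>x. cnj (f x)) \<in> C0"
  using f unfolding C0_iff continuous_map_iff_tendsto by (auto intro!: tendsto_intros)

lemma C0_translate:
  assumes f: "f \<in> C0" and g: "g \<in> carrier affine_group" shows "translate g f \<in> C0"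
proof -
  obtain m k where mk: "g = (m, k)" "k > 0" using g by auto
  obtain m' k' where inv: "inv\<^bsub>affine_group\<^esub> g = (m', k')" "k' > 0"
    using mk by (simp add: inv_affine)
  have c: "continuous_map Omega_tilde Omega_tilde (act g)"
    "continuous_map Omega_tilde Omega_tilde (act (inv\<^bsub>affine_group\<^esub> g))"
    unfolding inv(1) unfolding mk(1) using mk(2) inv(2) by (auto intro: continuous_map_act)
  have top: "act (inv\<^bsub>affine_group\<^esub> g) x \<in> topspace Omega_tilde \<longleftrightarrow> x \<in> topspace Omega_tilde" for x
    using continuous_map_image_subset_topspace[OF c(1)] continuous_map_image_subset_topspace[OF c(2)]
      act_inv'[OF g, of x] by (metis image_subset_iff)
  show ?thesis unfolding C0_iff
  proof (intro conjI allI impI)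
    show "continuous_map Omega_tilde euclidean (translate g f)"
      unfolding translate_def using continuous_map_compose[OF c(2), of euclidean f] f
      by (simp add: C0_iff o_def)
    show "translate g f x = 0" if "x \<notin> topspace Omega_tilde" for x
      using that f top[of x] by (simp add: C0_iff translate_def)
    fix e :: real assume "e > 0"
    then obtain K where K: "compactin Omega_tilde K" "\<forall>x\<in>topspace Omega_tilde - K. cmod (f x) < e"
      using f unfolding C0_iff by meson
    have "cmod (translate g f x) < e" if x: "x \<in> topspace Omega_tilde - act g ` K" for x
    proof -
      have "act (inv\<^bsub>affine_group\<^esub> g) x \<notin> K" using x act_inv'[OF g, of x] by force
      then show ?thesis using K(2) x top[of x] by (simp add: translate_def)
    qed
    then show "\<exists>K. compactin Omega_tilde K \<and> (\<forall>x\<in>topspace Omega_tilde - K. cmod (translate g f x) < e)"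
      using image_compactin[OF K(1) c(1)] by blast
  qed
qed

lemma C0_CB:
  assumes f: "f \<in> C0" and z: "\<And>x. x \<notin> topspace Omega_B \<Longrightarrow> f x = 0" shows "f \<in> CB"
  unfolding CB_iff using z f unfolding Omega_B_eq C0_iff
  by (auto intro: continuous_map_from_subtopology)

text \<open>Extension by zero is continuous because Omega_B is clopen, and it vanishes at infinity
  because Omega_B is compact.\<close>

lemma CB_C0:
  assumes f: "f \<in> CB" shows "f \<in> C0"
  unfolding C0_iff
proof (intro conjI allI impI)
  have sub: "topspace Omega_B \<subseteq> topspace Omega_tilde" using cyl_subset_tilde topspace_Omega_B by auto
  show "continuous_map Omega_tilde euclidean f"
    unfolding continuous_map_def
  proof (intro conjI allI impI)
    fix W :: "complex set" assume W: "openin euclidean W"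
    have 1: "openin Omega_tilde {x \<in> topspace Omega_B. f x \<in> W}"
      using f W openin_Omega_B unfolding CB_iff continuous_map_def by blast
    have 2: "openin Omega_tilde (topspace Omega_tilde - topspace Omega_B)"
      using closedin_cyl[of 1 0] by (simp add: topspace_Omega_B closedin_def)
    have "{x \<in> topspace Omega_tilde. f x \<in> W} = {x \<in> topspace Omega_B. f x \<in> W} \<union>
        (if 0 \<in> W then topspace Omega_tilde - topspace Omega_B else {})"
      using sub f by (auto simp: CB_iff)
    then show "openin Omega_tilde {x \<in> topspace Omega_tilde. f x \<in> W}" using 1 2 by auto
  qed auto
  show "f x = 0" if "x \<notin> topspace Omega_tilde" for x using that sub f by (auto simp: CB_iff)
  fix e :: real assume "e > 0"
  then show "\<exists>K. compactin Omega_tilde K \<and> (\<forall>x\<in>topspace Omega_tilde - K. cmod (f x) < e)"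
    using compactin_Omega_B f by (intro exI[of _ "cyl 0 1"]) (auto simp: CB_iff topspace_Omega_B)
qed

lemma affine_semigroup_subset: "x \<in> affine_semigroup \<Longrightarrow> x \<in> carrier affine_group"
  by (auto simp: affine_semigroup_def)

lemma translate_indicator:
  "g \<in> carrier affine_group \<Longrightarrow> translate g (indicator U) = indicator (act g ` U)"
proof
  fix x assume g: "g \<in> carrier affine_group"
  have "act (inv\<^bsub>affine_group\<^esub> g) x \<in> U \<longleftrightarrow> x \<in> act g ` U"
    using act_inv[OF g] act_inv'[OF g, of x] by (metis imageE image_eqI)
  then show "translate g (indicator U) x = indicator (act g ` U) x"
    by (simp add: translate_def indicator_def)
qed

lemma translate_CB:
  assumes x: "x \<in> affine_semigroup" and f: "f \<in> CB" shows "translate x f \<in> CB"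
proof (rule C0_CB)
  have g: "x \<in> carrier affine_group" by (rule affine_semigroup_subset[OF x])
  show "translate x f \<in> C0" by (rule C0_translate[OF CB_C0[OF f] g])
  fix y assume y: "y \<notin> topspace Omega_B"
  obtain m n where mn: "x = (of_int m, of_nat n)" "n > 0" using x by (auto simp: affine_semigroup_def)
  have "act (inv\<^bsub>affine_group\<^esub> x) y \<notin> topspace Omega_B"
  proof
    assume "act (inv\<^bsub>affine_group\<^esub> x) y \<in> topspace Omega_B"
    with act_inv'[OF g, symmetric] have "y \<in> act x ` topspace Omega_B" by (rule image_eqI)
    then have "y \<in> cyl m n" unfolding mn(1) act_image_Omega_B[OF mn(2)] .
    then have "y \<in> cyl 0 1" by (rule subsetD[OF cyl_subset])
    then show False using y unfolding topspace_Omega_B by contradiction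
  qed
  then show "translate x f y = 0" using f by (simp add: translate_def CB_iff)
qed

section \<open>C*-algebras\<close>

context cstar_algebra
begin

lemma nrm_zero [simp]: "nrm A \<zero> = 0"
  using nrm_eq_0[of \<zero>] by simp

lemma scl_minus_one: assumes x: "x \<in> carrier A" shows "scl A (- 1) x = \<ominus> x"
proof -
  have "scl A 0 x = \<zero>" using nrm_scl[OF x, of 0] nrm_eq_0[OF scl_closed[OF x]] by simp
  then have "scl A (- 1) x \<oplus> x = \<zero>" using scl_add_left[OF x, of "- 1" 1] scl_one[OF x] by simp
  then show ?thesis using x scl_closed[OF x] by (metis minus_equality)
qed

lemma scl_zero: "x \<in> carrier A \<Longrightarrow> scl A 0 x = \<zero>"
  using nrm_scl[of x 0] nrm_eq_0[OF scl_closed] by simp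

lemma minus_eq: "x \<in> carrier A \<Longrightarrow> y \<in> carrier A \<Longrightarrow> x \<ominus> y = x \<oplus> scl A (- 1) y"
  by (simp add: a_minus_def scl_minus_one)

lemma minus_zero: "x \<in> carrier A \<Longrightarrow> x \<ominus> \<zero> = x"
  using minus_equality[of \<zero> \<zero>] by (simp add: a_minus_def)

lemma nrm_minus: "x \<in> carrier A \<Longrightarrow> nrm A (\<ominus> x) = nrm A x"
  using nrm_scl[of x "- 1"] by (simp add: scl_minus_one)

lemma nrm_diff_commute:
  "x \<in> carrier A \<Longrightarrow> y \<in> carrier A \<Longrightarrow> nrm A (x \<ominus> y) = nrm A (y \<ominus> x)"
  using nrm_minus[of "x \<ominus> y"] by (simp add: a_minus_def minus_add a_comm)

lemma nrm_diff_triangle: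
  assumes "x \<in> carrier A" "y \<in> carrier A" "z \<in> carrier A"
  shows "nrm A (x \<ominus> z) \<le> nrm A (x \<ominus> y) + nrm A (y \<ominus> z)"
proof -
  have "x \<ominus> z = (x \<ominus> y) \<oplus> (y \<ominus> z)"
    using assms by (simp add: a_minus_def a_assoc r_neg1 l_neg r_neg2 )
  then show ?thesis using nrm_add[of "x \<ominus> y" "y \<ominus> z"] assms by simp
qed

lemma nrm_le_diff:
  assumes "x \<in> carrier A" "y \<in> carrier A"
  shows "nrm A x \<le> nrm A (x \<ominus> y) + nrm A y"
proof -
  have "x = (x \<ominus> y) \<oplus> y" using assms by (simp add: a_minus_def a_assoc l_neg)
  then show ?thesis using nrm_add[of "x \<ominus> y" y] assms by simp
qed

lemma add_diff_add:
  assumes "x \<in> carrier A" "y \<in> carrier A" "z \<in> carrier A" "w \<in> carrier A"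
  shows "(x \<oplus> y) \<ominus> (z \<oplus> w) = (x \<ominus> z) \<oplus> (y \<ominus> w)"
  using assms by (simp add: a_minus_def minus_add a_ac)

lemma distrib_left_diff:
  assumes "x \<in> carrier A" "y \<in> carrier A" "z \<in> carrier A"
  shows "x \<otimes> (y \<ominus> z) = (x \<otimes> y) \<ominus> (x \<otimes> z)"
  using assms by (simp add: minus_eq distrib_left scl_closed scl_mult_right mult_closed)

lemma distrib_right_diff:
  assumes "x \<in> carrier A" "y \<in> carrier A" "z \<in> carrier A"
  shows "(x \<ominus> y) \<otimes> z = (x \<otimes> z) \<ominus> (y \<otimes> z)"
  using assms by (simp add: minus_eq distrib_right scl_closed scl_mult_left mult_closed)

lemma nrm_mult_diff:
  assumes "x \<in> carrier A" "y \<in> carrier A" "z \<in> carrier A" "w \<in> carrier A"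
  shows "nrm A (x \<otimes> y \<ominus> z \<otimes> w) \<le> nrm A (x \<ominus> z) * nrm A y + nrm A z * nrm A (y \<ominus> w)"
proof -
  have "nrm A (x \<otimes> y \<ominus> z \<otimes> w) \<le> nrm A (x \<otimes> y \<ominus> z \<otimes> y) + nrm A (z \<otimes> y \<ominus> z \<otimes> w)"
    using assms by (intro nrm_diff_triangle mult_closed)
  also have "x \<otimes> y \<ominus> z \<otimes> y = (x \<ominus> z) \<otimes> y" using assms by (simp add: distrib_right_diff)
  also have "z \<otimes> y \<ominus> z \<otimes> w = z \<otimes> (y \<ominus> w)" using assms by (simp add: distrib_left_diff)
  finally show ?thesis
    using nrm_mult[of "x \<ominus> z" y] nrm_mult[of z "y \<ominus> w"] assms by simp
qed

lemma nrm_adj: assumes x: "x \<in> carrier A" shows "nrm A (adj A x) = nrm A x"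
proof -
  have le: "nrm A y \<le> nrm A (adj A y)" if y: "y \<in> carrier A" for y
  proof (cases "nrm A y = 0")
    case True then show ?thesis using nrm_nonneg[OF adj_closed[OF y]] by simp
  next
    case False
    have "nrm A y * nrm A y \<le> nrm A (adj A y) * nrm A y"
      using nrm_cstar[OF y] nrm_mult[OF adj_closed[OF y] y] by (simp add: power2_eq_square)
    then show ?thesis using False nrm_nonneg[OF y] by simp
  qed
  show ?thesis using le[OF x] le[OF adj_closed[OF x]] by (simp add: adj_adj[OF x])
qed

lemma adj_diff: "x \<in> carrier A \<Longrightarrow> y \<in> carrier A \<Longrightarrow> adj A (x \<ominus> y) = adj A x \<ominus> adj A y"
  by (simp add: minus_eq adj_add adj_scl scl_closed adj_closed)

lemma scl_diff: "x \<in> carrier A \<Longrightarrow> y \<in> carrier A \<Longrightarrow> scl A c (x \<ominus> y) = scl A c x \<ominus> scl A c y"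
  by (simp add: minus_eq scl_add_right scl_scl scl_closed mult.commute)

lemma adj_zero [simp]: "adj A \<zero> = \<zero>"
  using adj_scl[of \<zero> 0] by (simp add: scl_zero adj_closed)

text \<open>The closure of D is a closed star subalgebra that contains the generators, hence
  everything.\<close>

lemma dense_subalgebra:
  assumes D: "D \<subseteq> carrier A" "\<zero> \<in> D" "\<And>x y. x \<in> D \<Longrightarrow> y \<in> D \<Longrightarrow> x \<oplus> y \<in> D"
      "\<And>x y. x \<in> D \<Longrightarrow> y \<in> D \<Longrightarrow> x \<otimes> y \<in> D" "\<And>x. x \<in> D \<Longrightarrow> adj A x \<in> D"
      "\<And>c x. x \<in> D \<Longrightarrow> scl A c x \<in> D"
    and gen: "generated_by A S" "S \<subseteq> D" and x: "x \<in> carrier A" and e: "e > 0"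
  shows "\<exists>y\<in>D. nrm A (x \<ominus> y) < e"
proof -
  define T where "T = {x \<in> carrier A. \<forall>e>0. \<exists>y\<in>D. nrm A (x \<ominus> y) < e}"
  have DT: "D \<subseteq> T"
  proof
    fix x assume "x \<in> D"
    then have "x \<in> carrier A" "x \<ominus> x = \<zero>" using D(1) by (auto simp: a_minus_def r_neg)
    then show "x \<in> T" unfolding T_def using \<open>x \<in> D\<close> by (auto intro!: bexI[of _ x])
  qed
  have "closed_star_subalgebra A T"
    unfolding closed_star_subalgebra_def
  proof (intro conjI ballI allI impI)
    show "T \<subseteq> carrier A" by (auto simp: T_def)
    show "\<zero> \<in> T" using DT D(2) by blast
    fix x assume x: "x \<in> T"
    then have xc: "x \<in> carrier A" by (simp add: T_def)
    show "adj A x \<in> T" unfolding T_def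
    proof (intro CollectI conjI allI impI)
      fix e :: real assume "e > 0"
      then obtain y where y: "y \<in> D" "nrm A (x \<ominus> y) < e" using x unfolding T_def by blast
      then have "nrm A (adj A x \<ominus> adj A y) < e"
        using nrm_adj[of "x \<ominus> y"] xc D(1) by (auto simp: adj_diff)
      then show "\<exists>z\<in>D. nrm A (adj A x \<ominus> z) < e" using D(5) y(1) by blast
    qed (simp add: adj_closed xc)
    show "scl A c x \<in> T" for c unfolding T_def
    proof (intro CollectI conjI allI impI)
      fix e :: real assume "e > 0"
      then have "e / (cmod c + 1) > 0" by (simp add: add_nonneg_pos)
      then obtain y where y: "y \<in> D" "nrm A (x \<ominus> y) < e / (cmod c + 1)" using x unfolding T_def by blast
      have yc: "y \<in> carrier A" using y D(1) by blast
      have "nrm A (scl A c x \<ominus> scl A c y) = cmod c * nrm A (x \<ominus> y)"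
        using nrm_scl[of "x \<ominus> y" c] xc yc by (simp add: scl_diff)
      also have "\<dots> \<le> (cmod c + 1) * nrm A (x \<ominus> y)"
        using xc yc by (intro mult_right_mono nrm_nonneg) auto
      also have "\<dots> < e" using y(2) pos_less_divide_eq[of "cmod c + 1" "nrm A (x \<ominus> y)" e]
        by (simp add: add_nonneg_pos mult.commute)
      finally show "\<exists>z\<in>D. nrm A (scl A c x \<ominus> z) < e" using D(6) y(1) by blast
    qed (simp add: scl_closed xc)
    fix y assume y: "y \<in> T"
    then have yc: "y \<in> carrier A" by (simp add: T_def)
    show "x \<oplus> y \<in> T" unfolding T_def
    proof (intro CollectI conjI allI impI)
      fix e :: real assume "e > 0"
      then have "e / 2 > 0" by simp
      then obtain a b where ab: "a \<in> D" "nrm A (x \<ominus> a) < e / 2" "b \<in> D" "nrm A (y \<ominus> b) < e / 2"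
        using x y unfolding T_def by blast
      have c: "a \<in> carrier A" "b \<in> carrier A" using ab D(1) by auto
      have "nrm A ((x \<oplus> y) \<ominus> (a \<oplus> b)) \<le> nrm A (x \<ominus> a) + nrm A (y \<ominus> b)"
        using xc yc c by (simp add: add_diff_add nrm_add)
      then have "nrm A ((x \<oplus> y) \<ominus> (a \<oplus> b)) < e" using ab by simp
      then show "\<exists>z\<in>D. nrm A ((x \<oplus> y) \<ominus> z) < e" using D(3) ab by blast
    qed (simp add: xc yc)
    show "x \<otimes> y \<in> T" unfolding T_def
    proof (intro CollectI conjI allI impI)
      fix e :: real assume e: "e > 0"
      \<comment> \<open>The approximation a of x is chosen first, because the tolerance e2 for y
        depends on the norm of a.\<close>
      define e1 where "e1 = e / (2 * (nrm A y + 1))"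
      have ny: "nrm A y \<ge> 0" "nrm A x \<ge> 0" using yc xc nrm_nonneg by auto
      have e1: "e1 > 0" using e ny by (simp add: e1_def)
      then obtain a where a: "a \<in> D" "nrm A (x \<ominus> a) < e1" using x unfolding T_def by blast
      have ac: "a \<in> carrier A" using a D(1) by blast
      define e2 where "e2 = e / (2 * (nrm A a + 1))"
      have na: "nrm A a \<ge> 0" using ac nrm_nonneg by auto
      have "e2 > 0" using e na by (simp add: e2_def)
      then obtain b where b: "b \<in> D" "nrm A (y \<ominus> b) < e2" using y unfolding T_def by blast
      have bc: "b \<in> carrier A" using b D(1) by blast
      have "nrm A (x \<otimes> y \<ominus> a \<otimes> b) \<le> nrm A (x \<ominus> a) * nrm A y + nrm A a * nrm A (y \<ominus> b)"
        by (rule nrm_mult_diff[OF xc yc ac bc])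
      also have "nrm A (x \<ominus> a) * nrm A y \<le> e1 * nrm A y"
        using a(2) ny by (intro mult_right_mono) auto
      also have "e1 * nrm A y \<le> e1 * (nrm A y + 1)" using e1 by simp
      also have "e1 * (nrm A y + 1) = e / 2" using ny by (simp add: e1_def field_simps)
      also have "nrm A a * nrm A (y \<ominus> b) \<le> nrm A a * e2"
        using b(2) na by (intro mult_left_mono) auto
      also have "nrm A a * e2 < (nrm A a + 1) * e2" using \<open>e2 > 0\<close> by simp
      also have "(nrm A a + 1) * e2 = e / 2" using na by (simp add: e2_def field_simps)
      finally have "nrm A (x \<otimes> y \<ominus> a \<otimes> b) < e" by simp
      then show "\<exists>z\<in>D. nrm A (x \<otimes> y \<ominus> z) < e" using D(4) a(1) b(1) by blast
    qed (simp add: xc yc mult_closed)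
  next
    fix X x assume x: "x \<in> carrier A" and X: "(\<forall>n. X n \<in> T) \<and> (\<lambda>n. nrm A (X n \<ominus> x)) \<longlonglongrightarrow> 0"
    show "x \<in> T" unfolding T_def
    proof (intro CollectI conjI allI impI x)
      fix e :: real assume "e > 0"
      then have "e / 2 > 0" by simp
      then obtain n where n: "nrm A (X n \<ominus> x) < e / 2"
        using X order_tendstoD(2)[of _ 0 sequentially "e / 2"] unfolding eventually_sequentially by blast
      have Xc: "X n \<in> carrier A" using X by (simp add: T_def)
      obtain y where y: "y \<in> D" "nrm A (X n \<ominus> y) < e / 2" using X \<open>e / 2 > 0\<close> unfolding T_def by blast
      have "nrm A (x \<ominus> y) \<le> nrm A (x \<ominus> X n) + nrm A (X n \<ominus> y)"
        using y(1) D(1) Xc x by (intro nrm_diff_triangle) auto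
      then have "nrm A (x \<ominus> y) < e" using n y(2) nrm_diff_commute[OF x Xc] by simp
      then show "\<exists>y\<in>D. nrm A (x \<ominus> y) < e" using y(1) by blast
    qed
  qed
  then have "T = carrier A" using gen DT unfolding generated_by_def by blast
  then show ?thesis using x e unfolding T_def by blast
qed

text \<open>Finite sums, built one summand at a time to give a simple induction. In the uses below S
  is closed under scalar multiples, so this is the linear span.\<close>

inductive_set add_span :: "'a set \<Rightarrow> 'a set" for S where
  zero: "\<zero> \<in> add_span S"
| add: "x \<in> S \<Longrightarrow> y \<in> add_span S \<Longrightarrow> x \<oplus> y \<in> add_span S"

lemma add_span_closed:
  assumes S: "S \<subseteq> carrier A" and x: "x \<in> add_span S" shows "x \<in> carrier A"
  using x by induction (use S in auto)

lemma add_span_add: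
  assumes S: "S \<subseteq> carrier A" and x: "x \<in> add_span S" and y: "y \<in> add_span S"
  shows "x \<oplus> y \<in> add_span S"
  using x
proof induction
  case zero then show ?case using y add_span_closed[OF S y] by simp
next
  case (add a b)
  then have "(a \<oplus> b) \<oplus> y = a \<oplus> (b \<oplus> y)"
    using S add_span_closed[OF S] y by (auto intro!: a_assoc)
  then show ?case using add add_span.add by simp
qed

lemma add_span_base: "S \<subseteq> carrier A \<Longrightarrow> x \<in> S \<Longrightarrow> x \<in> add_span S"
  using add_span.add[OF _ add_span.zero, of x S] by auto

lemma zero_mult [simp]: "x \<in> carrier A \<Longrightarrow> \<zero> \<otimes> x = \<zero>" "x \<in> carrier A \<Longrightarrow> x \<otimes> \<zero> = \<zero>"
  using scl_mult_left[of \<zero> x 0] scl_mult_right[of x \<zero> 0] by (simp_all add: scl_zero mult_closed)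

lemma add_span_dense:
  assumes S: "S \<subseteq> carrier A" "\<And>x y. x \<in> S \<Longrightarrow> y \<in> S \<Longrightarrow> x \<otimes> y \<in> S" "\<And>x. x \<in> S \<Longrightarrow> adj A x \<in> S"
      "\<And>c x. x \<in> S \<Longrightarrow> scl A c x \<in> S"
    and gen: "generated_by A G" "G \<subseteq> S" and x: "x \<in> carrier A" and e: "e > 0"
  shows "\<exists>y\<in>add_span S. nrm A (x \<ominus> y) < e"
proof (rule dense_subalgebra[OF _ _ _ _ _ _ gen(1) _ x e])
  show sub: "add_span S \<subseteq> carrier A" using add_span_closed[OF S(1)] by blast
  show "\<zero> \<in> add_span S" by (rule add_span.zero)
  show "x \<oplus> y \<in> add_span S" if "x \<in> add_span S" "y \<in> add_span S" for x y
    using add_span_add[OF S(1)] that .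
  show "G \<subseteq> add_span S" using gen(2) add_span_base[OF S(1)] by blast
  show "adj A x \<in> add_span S" if "x \<in> add_span S" for x using that
  proof induction
    case (add a b)
    then have "adj A (a \<oplus> b) = adj A a \<oplus> adj A b" using S(1) sub by (intro adj_add) auto
    then show ?case using add_span.add[OF S(3)] add by simp
  qed (simp add: add_span.zero)
  show "scl A c x \<in> add_span S" if "x \<in> add_span S" for c x using that
  proof induction
    case zero
    have "nrm A (scl A c \<zero>) = 0" using nrm_scl[of \<zero> c] by simp
    then have "scl A c \<zero> = \<zero>" using nrm_eq_0[OF scl_closed[of \<zero>]] by simp
    then show ?case by (simp add: add_span.zero)
  next
    case (add a b)
    then have "scl A c (a \<oplus> b) = scl A c a \<oplus> scl A c b" using S(1) sub by (intro scl_add_right) auto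
    then show ?case using add_span.add[OF S(4)] add by simp
  qed
  show "x \<otimes> y \<in> add_span S" if "x \<in> add_span S" "y \<in> add_span S" for x y using that(1)
  proof induction
    case zero
    have "\<zero> \<otimes> y = \<zero>" using sub that(2) by (intro zero_mult) auto
    then show ?case by (simp add: add_span.zero)
  next
    case (add a b)
    have "a \<otimes> y \<in> add_span S" using that(2)
    proof induction
      case zero
      have "a \<otimes> \<zero> = \<zero>" using S(1) add(1) by (intro zero_mult) auto
      then show ?case by (simp add: add_span.zero)
    next
      case (add c d)
      then have "a \<otimes> (c \<oplus> d) = a \<otimes> c \<oplus> a \<otimes> d" using S(1) sub \<open>a \<in> S\<close> by (intro distrib_left) auto
      then show ?case using add_span.add[OF S(2)[OF \<open>a \<in> S\<close>]] add by simp
    qed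
    moreover have "(a \<oplus> b) \<otimes> y = a \<otimes> y \<oplus> b \<otimes> y" using add S(1) sub that(2) by (intro distrib_right) auto
    ultimately show ?case using add_span_add[OF S(1)] add by simp
  qed
qed

end

section \<open>Automatic boundedness of states\<close>

context unital_cstar_algebra
begin

lemma adj_one: "adj A \<one> = \<one>"
proof -
  have "adj A \<one> = adj A \<one> \<otimes> \<one>" using one_right[OF adj_closed[OF one_closed]] by simp
  also have "adj A (adj A \<one> \<otimes> \<one>) = adj A \<one> \<otimes> \<one>"
    using adj_mult[OF adj_closed[OF one_closed] one_closed] adj_adj[OF one_closed] by simp
  then have "adj A \<one> \<otimes> \<one> = adj A (adj A \<one> \<otimes> \<one>)" by simp
  also have "\<dots> = \<one>" using one_right[OF adj_closed[OF one_closed]] adj_adj[OF one_closed] by simp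
  finally show ?thesis .
qed

text \<open>A square root of \<open>1 - h\<close> is \<open>1 - y\<close>, where \<open>y\<close> is the fixed point of the contraction
  \<open>y \<mapsto> (h + y\<^sup>2) / 2\<close> of the ball of radius \<open>1/2\<close>.\<close>

lemma sqrt_one_minus:
  assumes h: "h \<in> carrier A" "adj A h = h" "nrm A h \<le> 3 / 4"
  shows "\<exists>z\<in>carrier A. adj A z \<otimes> z = \<one> \<ominus> h"
proof -
  define F where "F y = scl A (1 / 2) (h \<oplus> y \<otimes> y)" for y
  define Y where "Y n = (F ^^ n) \<zero>" for n
  have Y0: "Y 0 = \<zero>" and YS: "Y (Suc n) = F (Y n)" for n by (simp_all add: Y_def)
  have Fc: "F y \<in> carrier A" if "y \<in> carrier A" for y using that h by (simp add: F_def scl_closed mult_closed)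
  have Yc: "Y n \<in> carrier A" for n by (induction n) (simp_all add: Y0 YS Fc)
  have Fdiff: "nrm A (F x \<ominus> F y) \<le> 1 / 2 * ((nrm A x + nrm A y) * nrm A (x \<ominus> y))"
    if xy: "x \<in> carrier A" "y \<in> carrier A" for x y
  proof -
    have "F x \<ominus> F y = scl A (1 / 2) ((h \<oplus> x \<otimes> x) \<ominus> (h \<oplus> y \<otimes> y))"
      using xy h by (simp add: F_def scl_diff mult_closed)
    also have "(h \<oplus> x \<otimes> x) \<ominus> (h \<oplus> y \<otimes> y) = x \<otimes> x \<ominus> y \<otimes> y"
      using xy h by (simp add: add_diff_add mult_closed) (simp add: a_minus_def r_neg mult_closed)
    finally have "nrm A (F x \<ominus> F y) = 1 / 2 * nrm A (x \<otimes> x \<ominus> y \<otimes> y)"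
      using xy by (simp add: nrm_scl mult_closed)
    also have "\<dots> \<le> 1 / 2 * (nrm A (x \<ominus> y) * nrm A x + nrm A y * nrm A (x \<ominus> y))"
      using nrm_mult_diff[OF xy(1,1) xy(2,2)] by simp
    finally show ?thesis by (simp add: algebra_simps)
  qed
  have Yb: "nrm A (Y n) \<le> 1 / 2" for n
  proof (induction n)
    case (Suc n)
    have "nrm A (Y (Suc n)) = 1 / 2 * nrm A (h \<oplus> Y n \<otimes> Y n)"
      unfolding YS F_def using Yc h by (simp add: nrm_scl mult_closed)
    also have "\<dots> \<le> 1 / 2 * (nrm A h + nrm A (Y n) * nrm A (Y n))"
      using nrm_add[OF h(1) mult_closed[OF Yc Yc], of n n] nrm_mult[OF Yc Yc, of n n] by simp
    \<comment> \<open>The hypothesis with 3/4 is exactly what preserves the radius: (3/4 + 1/4) / 2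
      = 1/2.\<close>
    also have "\<dots> \<le> 1 / 2 * (3 / 4 + 1 / 2 * (1 / 2))"
      using h(3) Suc nrm_nonneg[OF Yc, of n] by (intro mult_left_mono add_mono mult_mono) auto
    finally show ?case by simp
  qed (simp add: Y0)
  have step: "nrm A (Y (Suc n) \<ominus> Y n) \<le> (1 / 2) ^ n" for n
  proof (induction n)
    case 0
    show ?case using Yb[of 1] Yc[of 1] by (simp add: Y0 minus_zero)
  next
    case (Suc n)
    have "nrm A (Y (Suc (Suc n)) \<ominus> Y (Suc n)) \<le> 1 / 2 * ((nrm A (Y (Suc n)) + nrm A (Y n)) * nrm A (Y (Suc n) \<ominus> Y n))"
      using Fdiff[OF Yc Yc, of "Suc n" n] by (simp add: YS)
    also have "\<dots> \<le> 1 / 2 * ((1 / 2 + 1 / 2) * (1 / 2) ^ n)"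
      using Suc Yb[of n] Yb[of "Suc n"] nrm_nonneg[OF Yc] Yc
      by (intro mult_left_mono mult_mono add_mono) (auto intro: nrm_nonneg add_nonneg_nonneg)
    finally show ?case by simp
  qed
  have tail: "nrm A (Y (n + k) \<ominus> Y n) \<le> 2 * (1 / 2) ^ n - 2 * (1 / 2) ^ (n + k)" for n k
  proof (induction k)
    case 0 then show ?case using Yc[of n] by (simp add: a_minus_def r_neg)
  next
    case (Suc k)
    have "nrm A (Y (n + Suc k) \<ominus> Y n) \<le> nrm A (Y (Suc (n + k)) \<ominus> Y (n + k)) + nrm A (Y (n + k) \<ominus> Y n)"
      using nrm_diff_triangle[OF Yc Yc Yc] by simp
    then show ?case using Suc step[of "n + k"] by simp
  qed
  have "\<exists>y\<in>carrier A. (\<lambda>n. nrm A (Y n \<ominus> y)) \<longlonglongrightarrow> 0"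
  proof (rule complete)
    show "Y n \<in> carrier A" for n by (rule Yc)
    fix e :: real assume e: "e > 0"
    then obtain N where N: "(1 / 2 :: real) ^ N < e / 4" using real_arch_pow_inv[of "e / 4" "1 / 2"] by auto
    have near: "nrm A (Y m \<ominus> Y N) < e / 2" if "m \<ge> N" for m
    proof -
      have "nrm A (Y m \<ominus> Y N) \<le> 2 * (1 / 2) ^ N - 2 * (1 / 2) ^ m" using tail[of N "m - N"] that by simp
      also have "\<dots> \<le> 2 * (1 / 2) ^ N" by simp
      finally show ?thesis using N by simp
    qed
    have "nrm A (Y m \<ominus> Y n) < e" if "m \<ge> N" "n \<ge> N" for m n
      using nrm_diff_triangle[of "Y m" "Y N" "Y n"] near[OF that(1)] near[OF that(2)]
        nrm_diff_commute[of "Y N" "Y n"] Yc by simp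
    then show "\<exists>N. \<forall>m\<ge>N. \<forall>n\<ge>N. nrm A (Y m \<ominus> Y n) < e" by blast
  qed
  then obtain y where y: "y \<in> carrier A" "(\<lambda>n. nrm A (Y n \<ominus> y)) \<longlonglongrightarrow> 0" by blast
  \<comment> \<open>Uniqueness of limits, allowing a shift k of the sequence. With k = 1 it yields
    that y is a fixed point, with k = 0 that y is self-adjoint.\<close>
  have uniq: "w = y" if w: "w \<in> carrier A" and lim: "(\<lambda>n. nrm A (Y (n + k) \<ominus> w)) \<longlonglongrightarrow> 0" for w k
  proof -
    have "(\<lambda>n. nrm A (Y (n + k) \<ominus> w) + nrm A (Y (n + k) \<ominus> y)) \<longlonglongrightarrow> 0"
      using tendsto_add_zero[OF lim LIMSEQ_ignore_initial_segment[OF y(2)]] .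
    moreover have "nrm A (w \<ominus> y) \<le> nrm A (Y (n + k) \<ominus> w) + nrm A (Y (n + k) \<ominus> y)" for n
      using nrm_diff_triangle[OF w Yc y(1)] nrm_diff_commute[OF w Yc] by metis
    ultimately have "nrm A (w \<ominus> y) \<le> 0" by (intro LIMSEQ_le_const) auto
    then have "w \<ominus> y = \<zero>" using nrm_nonneg[of "w \<ominus> y"] nrm_eq_0[of "w \<ominus> y"] w y(1) by simp
    then show ?thesis using w y(1) by (simp add: a_minus_def minus_equality[symmetric] r_neg l_neg)
        (metis a_minus_def minus_closed minus_minus minus_equality add.inv_closed)
  qed
  have ny: "nrm A y \<le> 1"
  proof -
    have "\<forall>\<^sub>F n in sequentially. nrm A (Y n \<ominus> y) < 1 / 2" using y(2) by (rule order_tendstoD) simp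
    then obtain n where "nrm A (Y n \<ominus> y) < 1 / 2" unfolding eventually_sequentially by blast
    then show ?thesis using nrm_le_diff[OF y(1) Yc, of n] Yb[of n] nrm_diff_commute[OF y(1) Yc, of n] by simp
  qed
  have "F y = y"
  proof (rule uniq[of _ 1])
    show "F y \<in> carrier A" by (rule Fc[OF y(1)])
    have "nrm A (Y (n + 1) \<ominus> F y) \<le> nrm A (Y n \<ominus> y)" for n
    proof -
      have "nrm A (Y (n + 1) \<ominus> F y) \<le> 1 / 2 * ((nrm A (Y n) + nrm A y) * nrm A (Y n \<ominus> y))"
        using Fdiff[OF Yc y(1), of n] by (simp add: YS)
      also have "\<dots> \<le> 1 / 2 * (2 * nrm A (Y n \<ominus> y))"
        using Yb[of n] ny Yc y(1) by (intro mult_left_mono mult_right_mono nrm_nonneg) auto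
      finally show ?thesis by simp
    qed
    then show "(\<lambda>n. nrm A (Y (n + 1) \<ominus> F y)) \<longlonglongrightarrow> 0"
      using Fc[OF y(1)] Yc
      by (intro tendsto_sandwich[OF _ _ tendsto_const y(2)]) (auto intro!: always_eventually nrm_nonneg)
  qed
  have Ya: "adj A (Y n) = Y n" for n
    by (induction n) (use h Yc in \<open>simp_all add: Y0 YS F_def adj_scl adj_add adj_mult mult_closed\<close>)
  have "adj A y = y"
  proof (rule uniq[of _ 0])
    show "adj A y \<in> carrier A" by (rule adj_closed[OF y(1)])
    have "nrm A (Y n \<ominus> adj A y) = nrm A (Y n \<ominus> y)" for n
      using nrm_adj[of "Y n \<ominus> y"] adj_diff[OF Yc y(1), of n] Yc y(1) by (simp add: Ya)
    then show "(\<lambda>n. nrm A (Y (n + 0) \<ominus> adj A y)) \<longlonglongrightarrow> 0" using y(2) by simp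
  qed
  define z where "z = \<one> \<ominus> y"
  have z: "z \<in> carrier A" using one_closed y(1) by (simp add: z_def)
  have az: "adj A z = z" using \<open>adj A y = y\<close> one_closed y(1) by (simp add: z_def adj_diff adj_one)
  have "h \<oplus> y \<otimes> y = scl A 2 (F y)"
    unfolding F_def using h y(1) by (simp add: scl_scl scl_one mult_closed)
  also have "\<dots> = y \<oplus> y" unfolding \<open>F y = y\<close> using scl_add_left[OF y(1), of 1 1] scl_one[OF y(1)] by simp
  finally have hy: "h \<oplus> y \<otimes> y = y \<oplus> y" .
  have "z \<otimes> z = (\<one> \<ominus> y) \<ominus> (y \<ominus> y \<otimes> y)"
    unfolding z_def using one_closed y(1)
    by (simp add: distrib_left_diff distrib_right_diff one_left one_right mult_closed)
  also have "\<dots> = \<one> \<ominus> h"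
  proof -
    have yy: "y \<otimes> y \<in> carrier A" using y(1) by (simp add: mult_closed)
    have "(\<one> \<ominus> y) \<ominus> (y \<ominus> y \<otimes> y) = (\<one> \<ominus> (y \<oplus> y)) \<oplus> y \<otimes> y"
      using one_closed y(1) yy by (simp add: a_minus_def minus_add a_ac)
    also have "\<dots> = \<one> \<ominus> h"
      unfolding hy[symmetric] using one_closed h(1) yy by (simp add: a_minus_def minus_add a_ac l_neg r_neg)
    finally show ?thesis .
  qed
  finally have "adj A z \<otimes> z = \<one> \<ominus> h" unfolding az .
  then show ?thesis using z by (rule bexI)
qed

text \<open>If x has norm at most 5/6, then h, the adjoint of x times x, has norm at most 25/36 <
  3/4, so 1 - h is again of the form adjoint of z times z by \<open>sqrt_one_minus\<close>.
  Positivity gives phi h <= 1, and the Cauchy-Schwarz inequality gives |phi x| <= 1. Rescaling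
  yields the constant 6/5, for which 2 is a convenient bound.\<close>

lemma state_bounded:
  assumes \<phi>: "state A \<phi>" and x: "x \<in> carrier A"
  shows "cmod (\<phi> x) \<le> 2 * nrm A x"
proof -
  have add: "\<phi> (a \<oplus> b) = \<phi> a + \<phi> b" if "a \<in> carrier A" "b \<in> carrier A" for a b
    using \<phi> that by (simp add: state_def)
  have scl: "\<phi> (scl A c a) = c * \<phi> a" if "a \<in> carrier A" for a c
    using \<phi> that by (simp add: state_def)
  have pos: "\<phi> (adj A a \<otimes> a) \<in> \<real>\<^sub>\<ge>\<^sub>0" if "a \<in> carrier A" for a
    using \<phi> that by (simp add: state_def)
  have one: "\<phi> \<one> = 1" using \<phi> by (simp add: state_def)
  have small: "cmod (\<phi> x) \<le> 2 * (5 / 6)" if x: "x \<in> carrier A" "nrm A x \<le> 5 / 6" for x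
  proof -
    have "nrm A (adj A x \<otimes> x) = (nrm A x)\<^sup>2" by (rule nrm_cstar[OF x(1)])
    also have "\<dots> \<le> (5 / 6)\<^sup>2" using x nrm_nonneg by (intro power_mono) auto
    finally have n: "nrm A (adj A x \<otimes> x) \<le> 3 / 4" by (simp add: power2_eq_square)
    have c: "adj A x \<otimes> x \<in> carrier A" using x by (simp add: mult_closed adj_closed)
    have "adj A (adj A x \<otimes> x) = adj A x \<otimes> x" using x by (simp add: adj_mult adj_closed adj_adj)
    then obtain z where z: "z \<in> carrier A" "adj A z \<otimes> z = \<one> \<ominus> adj A x \<otimes> x"
      using sqrt_one_minus[OF c _ n] by blast
    have "\<phi> (\<one> \<ominus> adj A x \<otimes> x) = 1 - \<phi> (adj A x \<otimes> x)"
      using c one_closed by (simp add: minus_eq add scl scl_closed one)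
    then have 1: "1 - \<phi> (adj A x \<otimes> x) \<in> \<real>\<^sub>\<ge>\<^sub>0" using pos[OF z(1)] z(2) by simp
    have 2: "\<phi> (adj A x \<otimes> x) \<in> \<real>\<^sub>\<ge>\<^sub>0" by (rule pos[OF x(1)])
    define c where "c = \<phi> x"
    \<comment> \<open>Hermitian symmetry is extracted from positivity on 1 + d x: the value d = 1
      controls the imaginary part, d = i the real part.\<close>
    have "\<phi> (adj A x) = cnj c"
    proof -
      have "\<phi> (adj A (\<one> \<oplus> scl A d x) \<otimes> (\<one> \<oplus> scl A d x)) =
          1 + d * c + cnj d * \<phi> (adj A x) + cnj d * d * \<phi> (adj A x \<otimes> x)" for d
      proof -
        have "adj A (\<one> \<oplus> scl A d x) \<otimes> (\<one> \<oplus> scl A d x) =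
            (\<one> \<oplus> scl A d x) \<oplus> (scl A (cnj d) (adj A x) \<oplus> scl A (cnj d * d) (adj A x \<otimes> x))"
          using x one_closed by (simp add: adj_add adj_scl adj_one distrib_left distrib_right scl_closed scl_add_right
              adj_closed mult_closed one_left one_right scl_mult_left scl_mult_right scl_scl a_ac mult.commute)
        then show ?thesis using x one_closed
          by (simp add: add scl scl_closed adj_closed mult_closed one c_def)
      qed
      note this[of 1] this[of \<i>]
      then have "1 + c + \<phi> (adj A x) + \<phi> (adj A x \<otimes> x) \<in> \<real>\<^sub>\<ge>\<^sub>0"
        "1 + \<i> * c - \<i> * \<phi> (adj A x) + \<phi> (adj A x \<otimes> x) \<in> \<real>\<^sub>\<ge>\<^sub>0"
        using pos[of "\<one> \<oplus> scl A 1 x"] pos[of "\<one> \<oplus> scl A \<i> x"] x one_closed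
        by (simp_all add: scl_closed)
      then show ?thesis using 2 by (simp add: complex_nonneg_Reals_iff complex_eq_iff)
    qed
    note adjx = this
    \<comment> \<open>The variance of x; that it is nonnegative is the Cauchy-Schwarz inequality for
      x and 1.\<close>
    have "\<phi> (adj A (x \<oplus> scl A (- c) \<one>) \<otimes> (x \<oplus> scl A (- c) \<one>)) =
        \<phi> (adj A x \<otimes> x) - c * cnj c"
    proof -
      have "adj A (x \<oplus> scl A (- c) \<one>) \<otimes> (x \<oplus> scl A (- c) \<one>) =
          (adj A x \<otimes> x \<oplus> scl A (- c) (adj A x)) \<oplus> (scl A (- cnj c) x \<oplus> scl A (cnj c * c) \<one>)"
        using x one_closed by (simp add: adj_add adj_scl adj_one distrib_left distrib_right scl_closed scl_add_right
            adj_closed mult_closed one_left one_right scl_mult_left scl_mult_right scl_scl a_ac mult.commute)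
      then show ?thesis using x one_closed adjx
        by (simp add: add scl scl_closed adj_closed mult_closed one c_def algebra_simps)
    qed
    then have "\<phi> (adj A x \<otimes> x) - c * cnj c \<in> \<real>\<^sub>\<ge>\<^sub>0"
      using pos[of "x \<oplus> scl A (- c) \<one>"] x one_closed by (simp add: scl_closed)
    then have "(cmod c)\<^sup>2 \<le> Re (\<phi> (adj A x \<otimes> x))"
      by (simp add: complex_nonneg_Reals_iff complex_mult_cnj cmod_power2)
    also have "\<dots> \<le> 1" using 1 by (simp add: complex_nonneg_Reals_iff)
    finally have "(cmod c)\<^sup>2 \<le> 1\<^sup>2" by simp
    then have "cmod c \<le> 1" by (rule power2_le_imp_le) simp
    then show ?thesis unfolding c_def by simp
  qed
  show ?thesis
  proof (cases "nrm A x = 0")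
    case True
    then have "x = \<zero>" using x nrm_eq_0 by simp
    moreover have "\<phi> \<zero> = 0" using add[of \<zero> \<zero>] by simp
    ultimately show ?thesis by simp
  next
    case False
    then have nx: "nrm A x > 0" using nrm_nonneg[OF x] by simp
    define c :: complex where "c = of_real (5 / 6 / nrm A x)"
    have "nrm A (scl A c x) = 5 / 6" using nx x by (simp add: nrm_scl c_def norm_divide norm_mult)
    then have "cmod (\<phi> (scl A c x)) \<le> 2 * (5 / 6)" using x by (intro small) (auto simp: scl_closed)
    moreover have "cmod (\<phi> (scl A c x)) = 5 / 6 / nrm A x * cmod (\<phi> x)"
      using x nx by (simp add: scl c_def norm_mult norm_divide)
    ultimately show ?thesis using nx by (simp add: field_simps)
  qed
qed

end

section \<open>States on \<open>C(\<Omega>\<^sub>B)\<close>\<close>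

text \<open>A nonnegative function is the square of its root, which is again continuous and zero
  outside Omega_B.\<close>

lemma state_CB_pos:
  assumes \<psi>: "state (C_alg Omega_B) \<psi>" and f: "f \<in> CB" and pos: "\<And>x. f x \<in> \<real>\<^sub>\<ge>\<^sub>0"
  shows "\<psi> f \<in> \<real>\<^sub>\<ge>\<^sub>0"
proof -
  have c: "(\<lambda>x. complex_of_real (sqrt (Re (f x)))) \<in> CB"
    using f by (rule CB_real_compose) (auto intro!: continuous_intros)
  have "(\<lambda>x. cnj (complex_of_real (sqrt (Re (f x)))) * complex_of_real (sqrt (Re (f x)))) = f"
  proof
    fix x
    have "Re (f x) \<ge> 0" "Im (f x) = 0" using pos[of x] by (auto simp: complex_nonneg_Reals_iff)
    then show "cnj (complex_of_real (sqrt (Re (f x)))) * complex_of_real (sqrt (Re (f x))) = f x"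
      by (simp add: complex_eq_iff)
  qed
  then show ?thesis using \<psi> c unfolding state_def by fastforce
qed

lemma
  assumes \<psi>: "state (C_alg Omega_B) \<psi>"
  shows state_CB_add: "\<And>f g. f \<in> CB \<Longrightarrow> g \<in> CB \<Longrightarrow> \<psi> (\<lambda>x. f x + g x) = \<psi> f + \<psi> g"
    and state_CB_scl: "\<And>f c. f \<in> CB \<Longrightarrow> \<psi> (\<lambda>x. c * f x) = c * \<psi> f"
    and state_CB_one: "\<psi> (indicator (topspace Omega_B)) = 1"
  using \<psi> by (simp_all add: state_def)

text \<open>For real g with |g| <= B, positivity on B 1 + g and B 1 - g gives |psi g| <= B. The
  factor 2 comes from splitting f into real and imaginary part.\<close>

lemma state_CB_bounded:
  assumes \<psi>: "state (C_alg Omega_B) \<psi>" and f: "f \<in> CB" and B: "\<And>x. cmod (f x) \<le> B"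
  shows "cmod (\<psi> f) \<le> 2 * B"
proof -
  note add = state_CB_add[OF \<psi>] and scl = state_CB_scl[OF \<psi>]
  have real: "cmod (\<psi> (\<lambda>x. complex_of_real (r (f x)))) \<le> B"
    if r: "\<And>z. isCont r z" "r 0 = 0" "\<And>z. \<bar>r z\<bar> \<le> cmod z" for r :: "complex \<Rightarrow> real"
  proof -
    define g where "g = (\<lambda>x. complex_of_real (r (f x)))"
    have g: "g \<in> CB" unfolding g_def using f
      by (rule CB_real_compose) (use r in \<open>auto intro!: continuous_intros\<close>)
    let ?I = "\<lambda>x. of_real B * (indicator (topspace Omega_B) x :: complex)"
    have I: "?I \<in> CB" by (rule CB_scale[OF indicator_Omega_CB])
    have rB: "\<bar>r (f x)\<bar> \<le> B" for x using r(3)[of "f x"] B[of x] by linarith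
    have r0: "r (f x) = 0" if "x \<notin> topspace Omega_B" for x using f that r(2) by (simp add: CB_iff)
    have "\<psi> (\<lambda>x. ?I x + c * g x) \<in> \<real>\<^sub>\<ge>\<^sub>0" if c: "c = 1 \<or> c = -1" for c :: complex
    proof (rule state_CB_pos[OF \<psi> CB_add[OF I CB_scale[OF g]]])
      fix x show "?I x + c * g x \<in> \<real>\<^sub>\<ge>\<^sub>0"
      proof (cases "x \<in> topspace Omega_B")
        case True
        then show ?thesis using rB[of x] c by (auto simp: g_def complex_nonneg_Reals_iff)
      next
        case False
        then show ?thesis using r0[of x] by (simp add: g_def)
      qed
    qed
    then have "of_real B + c * \<psi> g \<in> \<real>\<^sub>\<ge>\<^sub>0" if "c = 1 \<or> c = -1" for c :: complex
      using that add[OF I CB_scale[OF g]] scl[OF g] scl[OF indicator_Omega_CB] state_CB_one[OF \<psi>]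
      by simp
    from this[of 1] this[of "- 1"] have "of_real B + \<psi> g \<in> \<real>\<^sub>\<ge>\<^sub>0" "of_real B - \<psi> g \<in> \<real>\<^sub>\<ge>\<^sub>0"
      by simp_all
    then have im: "Im (\<psi> g) = 0" and "\<bar>Re (\<psi> g)\<bar> \<le> B" by (auto simp: complex_nonneg_Reals_iff)
    then show ?thesis using cmod_eq_Re[OF im] unfolding g_def by simp
  qed
  define g h where "g = (\<lambda>x. complex_of_real (Re (f x)))" and "h = (\<lambda>x. complex_of_real (Im (f x)))"
  have gh: "g \<in> CB" "h \<in> CB" unfolding g_def h_def
    by (rule CB_real_compose[OF f]; auto intro!: continuous_intros)+
  have "f = (\<lambda>x. g x + \<i> * h x)" unfolding g_def h_def by (rule ext) (simp add: complex_eq_iff)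
  then have "\<psi> f = \<psi> g + \<i> * \<psi> h" using add[OF gh(1) CB_scale[OF gh(2)]] scl[OF gh(2)] by metis
  moreover have "cmod (\<psi> g) \<le> B" "cmod (\<psi> h) \<le> B"
    unfolding g_def h_def by (rule real; simp add: abs_Re_le_cmod abs_Im_le_cmod)+
  ultimately show ?thesis using norm_triangle_ineq[of "\<psi> g" "\<i> * \<psi> h"] by (simp add: norm_mult)
qed

text \<open>The functional counterpart of a scaling measure. Prescribing the values on cylinders is
  enough by \<open>functional_eq\<close>; the scaling of arbitrary functions is
  \<open>scaling_state_translate\<close>.\<close>

definition scaling_state :: "real \<Rightarrow> ((point \<Rightarrow> complex) \<Rightarrow> complex) \<Rightarrow> bool" where
  "scaling_state \<beta> \<psi> \<longleftrightarrow> state (C_alg Omega_B) \<psi> \<and>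
     (\<forall>m n. n > 0 \<longrightarrow> \<psi> (indicator (cyl m n)) = of_real (real n powr - \<beta>))"

lemma scaling_state_unique:
  assumes "scaling_state \<beta> \<psi>" "scaling_state \<beta> \<psi>'" shows "\<psi> = \<psi>'"
proof -
  have s: "state (C_alg Omega_B) \<psi>" "state (C_alg Omega_B) \<psi>'" using assms by (auto simp: scaling_state_def)
  have "\<psi> f = \<psi>' f" if "f \<in> CB" for f
    by (rule functional_eq[where K = 2 and K' = 2])
      (use s assms that in \<open>auto simp: state_CB_add state_CB_scl state_CB_bounded scaling_state_def\<close>)
  then show ?thesis using s unfolding state_def by (meson extensionalityI)
qed

text \<open>Both sides are bounded and linear in f, so only cylinders have to be compared, and there
  translation multiplies the level by n.\<close>

lemma scaling_state_translate:
  assumes \<psi>: "scaling_state \<beta> \<psi>" and n: "n > 0" and f: "f \<in> CB"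
  shows "\<psi> (translate (of_int m, of_nat n) f) = of_real (real n powr - \<beta>) * \<psi> f"
proof -
  let ?x = "(of_int m, of_nat n) :: rat \<times> rat"
  have s: "state (C_alg Omega_B) \<psi>" using \<psi> by (simp add: scaling_state_def)
  have x: "?x \<in> affine_semigroup" using n by (auto simp: affine_semigroup_def)
  have lin: "translate ?x (\<lambda>y. f y + g y) = (\<lambda>y. translate ?x f y + translate ?x g y)"
    "translate ?x (\<lambda>y. c * f y) = (\<lambda>y. c * translate ?x f y)" for f g c
    by (simp_all add: translate_def)
  show ?thesis
  proof (rule functional_eq[where L = "\<lambda>f. \<psi> (translate ?x f)" and M = "\<lambda>f. of_real (real n powr - \<beta>) * \<psi> f"
        and K = 2 and K' = "real n powr - \<beta> * 2", OF _ _ _ _ _ _ _ f])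
    fix f g :: "point \<Rightarrow> complex" and c :: complex and B :: real assume f: "f \<in> CB"
    show "\<psi> (translate ?x (\<lambda>y. c * f y)) = c * \<psi> (translate ?x f)"
      unfolding lin by (rule state_CB_scl[OF s translate_CB[OF x f]])
    show "of_real (real n powr - \<beta>) * \<psi> (\<lambda>y. c * f y) = c * (of_real (real n powr - \<beta>) * \<psi> f)"
      using state_CB_scl[OF s f] by simp
    show "\<psi> (translate ?x (\<lambda>y. f y + g y)) = \<psi> (translate ?x f) + \<psi> (translate ?x g)" if g: "g \<in> CB"
      unfolding lin by (rule state_CB_add[OF s translate_CB[OF x f] translate_CB[OF x g]])
    show "of_real (real n powr - \<beta>) * \<psi> (\<lambda>y. f y + g y) =
        of_real (real n powr - \<beta>) * \<psi> f + of_real (real n powr - \<beta>) * \<psi> g" if g: "g \<in> CB"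
      using state_CB_add[OF s f g] by (simp add: algebra_simps)
    assume B: "\<And>y. cmod (f y) \<le> B"
    show "cmod (\<psi> (translate ?x f)) \<le> 2 * B"
      by (rule state_CB_bounded[OF s translate_CB[OF x f]]) (simp add: translate_def B)
    have "cmod (\<psi> f) \<le> 2 * B" by (rule state_CB_bounded[OF s f B])
    then show "cmod (of_real (real n powr - \<beta>) * \<psi> f) \<le> real n powr - \<beta> * 2 * B"
      unfolding norm_mult mult.assoc by (intro mult_mono) auto
  next
    fix l and k :: nat assume k: "k > 0"
    have "translate ?x (indicator (cyl l k)) = (indicator (cyl (m + int n * l) (n * k)) :: point \<Rightarrow> complex)"
      using translate_indicator[OF affine_semigroup_subset[OF x], of "cyl l k"] act_image_cyl[OF n k, of m l] by simp
    then show "\<psi> (translate ?x (indicator (cyl l k))) = of_real (real n powr - \<beta>) * \<psi> (indicator (cyl l k))"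
      using \<psi> n k unfolding scaling_state_def by (simp add: powr_mult)
  qed
qed

text \<open>Multiplying (m, k) from the left by (0, N), with N a common denominator, gives an
  element of the semigroup. As f and its translate both live on Omega_B, semigroup scaling applies
  to each of them, and the factor of N cancels.\<close>

lemma scaling_state_translate_group:
  assumes \<psi>: "scaling_state \<beta> \<psi>" and k: "k > 0" and f: "f \<in> CB" "translate (m, k) f \<in> CB"
  shows "\<psi> (translate (m, k) f) = of_real (of_rat k powr - \<beta>) * \<psi> f"
proof -
  obtain a b where ab: "quotient_of m = (a, b)" by fastforce
  obtain c d where cd: "quotient_of k = (c, d)" by fastforce
  have b: "b > 0" "m = of_int a / of_int b" using quotient_of_denom_pos[OF ab] quotient_of_div[OF ab] by auto
  have d: "d > 0" "k = of_int c / of_int d" using quotient_of_denom_pos[OF cd] quotient_of_div[OF cd] by auto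
  have c: "c > 0" using k d by (simp add: zero_less_divide_iff)
  define N M where "N = nat (b * d)" and "M = nat (b * c)"
  have N: "N > 0" "of_nat N = (of_int (b * d) :: rat)" using b d by (auto simp: N_def)
  have M: "M > 0" "of_nat M = (of_int (b * c) :: rat)" using b c by (auto simp: M_def)
  have kNM: "of_nat N * k = of_nat M" "of_nat N * m = of_int (a * d)"
    unfolding N M using b d by (simp_all add: field_simps)
  have "translate (of_int 0, of_nat N) (translate (m, k) f) =
      translate ((of_int 0, of_nat N) \<otimes>\<^bsub>affine_group\<^esub> (m, k)) f"
    by (rule translate_translate) (use k N in auto)
  also have "(of_int 0, of_nat N) \<otimes>\<^bsub>affine_group\<^esub> (m, k) = (of_int (a * d), of_nat M)"
    by (simp add: kNM del: of_int_mult)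
  finally have eq: "translate (of_int 0, of_nat N) (translate (m, k) f) = translate (of_int (a * d), of_nat M) f" .
  have "complex_of_real (real N powr - \<beta>) * \<psi> (translate (m, k) f) = of_real (real M powr - \<beta>) * \<psi> f"
    using scaling_state_translate[OF \<psi> N(1) f(2), of 0] scaling_state_translate[OF \<psi> M(1) f(1), of "a * d"]
    unfolding eq by simp
  moreover have "real M = real N * of_rat k"
    using arg_cong[OF kNM(1), of "of_rat :: rat \<Rightarrow> real"] by (simp add: of_rat_mult)
  then have "real M powr - \<beta> = real N powr - \<beta> * of_rat k powr - \<beta>" using k by (simp add: powr_mult)
  moreover have "complex_of_real (real N powr - \<beta>) \<noteq> 0" using N by simp
  ultimately show ?thesis by (simp add: mult.assoc)
qed

lemma scaling_state_exists:
  assumes \<beta>: "\<beta> \<ge> 1" shows "\<exists>\<psi>. scaling_state \<beta> \<psi>"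
proof -
  obtain \<mu> where \<mu>: "scaling_probability \<beta> \<mu>" using exists_scaling_probability[OF \<beta>] by blast
  interpret prob_space \<mu> using \<mu> by (simp add: scaling_probability_def)
  have s: "sets \<mu> = sets Omega_borel" using \<mu> by (simp add: scaling_probability_def)
  have sp: "space \<mu> = topspace Omega_B" using sets_eq_imp_space_eq[OF s] by simp
  have meas: "f \<in> borel_measurable \<mu>" if f: "f \<in> CB" for f
  proof (rule borel_measurableI)
    fix W :: "complex set" assume W: "open W"
    have "openin Omega_B {x \<in> topspace Omega_B. f x \<in> W}"
      using f W unfolding CB_iff by (intro openin_continuous_map_preimage) auto
    then have "{x \<in> topspace Omega_B. f x \<in> W} \<in> sets \<mu>" unfolding s sets_Omega_borel' by blast
    moreover have "f -` W \<inter> space \<mu> = {x \<in> topspace Omega_B. f x \<in> W}" unfolding sp by blast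
    ultimately show "f -` W \<inter> space \<mu> \<in> sets \<mu>" by simp
  qed
  have int: "integrable \<mu> f" if f: "f \<in> CB" for f
  proof -
    obtain B where "\<And>x. cmod (f x) \<le> B" using CB_bounded[OF f] by blast
    then show ?thesis using meas[OF f] by (intro integrable_const_bound[of _ B]) auto
  qed
  have ind: "(\<integral>x. indicator (cyl m n) x \<partial>\<mu>) = complex_of_real (measure \<mu> (cyl m n))" if "n > 0" for m n
  proof -
    have "(\<integral>x. indicator (cyl m n) x \<partial>\<mu>) = (\<integral>x. complex_of_real (indicator (cyl m n) x) \<partial>\<mu>)"
      by (intro Bochner_Integration.integral_cong refl) (simp add: indicator_def)
    also have "\<dots> = complex_of_real (\<integral>x. indicator (cyl m n) x \<partial>\<mu>)" by (rule integral_complex_of_real)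
    also have "(\<integral>x. indicator (cyl m n) x \<partial>\<mu>) = measure \<mu> (cyl m n)"
      using cyl_borel[OF that, of m] s sets.sets_into_space[of "cyl m n" \<mu>] by (simp add: Int_absorb2)
    finally show ?thesis .
  qed
  define \<psi> where "\<psi> = restrict (\<lambda>f. \<integral>x. f x \<partial>\<mu>) CB"
  have cyl: "\<psi> (indicator (cyl m n)) = complex_of_real (real n powr - \<beta>)" if "n > 0" for m n
    using ind[OF that] scaling_probability_cyl[OF \<mu> that] indicator_cyl_CB[OF that] by (simp add: \<psi>_def)
  have "scaling_state \<beta> \<psi>" unfolding scaling_state_def state_def
  proof (intro conjI ballI allI impI)
    show "\<psi> \<in> extensional CB" by (simp add: \<psi>_def)
    fix f assume f: "f \<in> CB"
    show "\<psi> (f \<oplus>\<^bsub>C_alg Omega_B\<^esub> g) = \<psi> f + \<psi> g" if "g \<in> CB" for g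
      using f that CB_add[OF f that] by (simp add: \<psi>_def int)
    show "\<psi> (scl (C_alg Omega_B) c f) = c * \<psi> f" for c
      using f CB_scale[OF f] by (simp add: \<psi>_def)
    have "\<psi> (\<lambda>x. cnj (f x) * f x) = (\<integral>x. complex_of_real ((cmod (f x))\<^sup>2) \<partial>\<mu>)"
      using CB_mult[OF CB_cnj[OF f] f] by (simp add: \<psi>_def complex_norm_square mult.commute flip: of_real_power)
    also have "\<dots> = complex_of_real (\<integral>x. (cmod (f x))\<^sup>2 \<partial>\<mu>)" by (rule integral_complex_of_real)
    finally show "\<psi> (adj (C_alg Omega_B) f \<otimes>\<^bsub>C_alg Omega_B\<^esub> f) \<in> \<real>\<^sub>\<ge>\<^sub>0"
      by (simp add: complex_nonneg_Reals_iff)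
  next
    show "\<psi> (indicator (cyl m n)) = complex_of_real (real n powr - \<beta>)" if "n > 0" for m n
      by (rule cyl[OF that])
    show "\<psi> \<one>\<^bsub>C_alg Omega_B\<^esub> = 1"
      using cyl[of 1 0] by (simp add: topspace_Omega_B)
  qed
  then show ?thesis by blast
qed

section \<open>The conditional expectation\<close>

text \<open>Grouping the indices by the value of g turns the double sum into a sum of squared
  moduli. This is the positivity of E on finite sums, evaluated at a point.\<close>

lemma sum_group_nonneg:
  fixes a :: "'i \<Rightarrow> complex"
  assumes I: "finite I"
  shows "(\<Sum>i\<in>I. \<Sum>j\<in>I. if g i = g j then cnj (a i) * a j else 0) \<in> \<real>\<^sub>\<ge>\<^sub>0"
proof -
  define S where "S k = (\<Sum>i\<in>{i \<in> I. g i = k}. a i)" for k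
  have "(\<Sum>j\<in>I. if g i = g j then cnj (a i) * a j else 0) = cnj (a i) * S (g i)" for i
    unfolding S_def sum_distrib_left using I by (subst sum.inter_filter) (auto intro!: sum.cong)
  then have "(\<Sum>i\<in>I. \<Sum>j\<in>I. if g i = g j then cnj (a i) * a j else 0) = (\<Sum>i\<in>I. cnj (a i) * S (g i))"
    by simp
  also have "\<dots> = (\<Sum>k\<in>g ` I. \<Sum>i\<in>{i \<in> I. g i = k}. cnj (a i) * S (g i))"
    by (rule sum.image_gen[OF I])
  also have "\<dots> = (\<Sum>k\<in>g ` I. cnj (S k) * S k)"
    by (intro sum.cong refl) (simp add: S_def sum_distrib_right)
  also have "\<dots> = complex_of_real (\<Sum>k\<in>g ` I. (cmod (S k))\<^sup>2)"
    by (simp add: mult.commute flip: complex_norm_square)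
  finally show ?thesis by (auto simp: complex_nonneg_Reals_iff intro!: sum_nonneg)
qed

locale expectation =
  fixes C :: "'b cstar" and w :: "rat \<times> rat \<Rightarrow> (point \<Rightarrow> complex) \<Rightarrow> 'b" and E :: "'b \<Rightarrow> point \<Rightarrow> complex"
  assumes gcp: "group_crossed_product C w" and ce: "canonical_expectation C w E"
begin

sublocale C: cstar_algebra C using gcp by (simp add: group_crossed_product_def)

abbreviation "G \<equiv> carrier affine_group"

lemma
  assumes g: "g \<in> G" and f: "f \<in> C0"
  shows w_closed: "w g f \<in> carrier C"
    and w_scl: "w g (\<lambda>x. c * f x) = scl C c (w g f)"
    and w_mult: "\<And>k h. k \<in> G \<Longrightarrow> h \<in> C0 \<Longrightarrow>
      w g f \<otimes>\<^bsub>C\<^esub> w k h = w (g \<otimes>\<^bsub>affine_group\<^esub> k) (\<lambda>x. f x * translate g h x)"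
    and w_adj: "adj C (w g f) =
      w (inv\<^bsub>affine_group\<^esub> g) (translate (inv\<^bsub>affine_group\<^esub> g) (\<lambda>x. cnj (f x)))"
proof -
  have "group_covariant C w" using gcp by (simp add: group_crossed_product_def)
  note rel = bspec[OF bspec[OF this[unfolded group_covariant_def] g] f]
  show "w g f \<in> carrier C" by (rule rel[THEN conjunct1])
  show "w g (\<lambda>x. c * f x) = scl C c (w g f)"
    by (rule rel[THEN conjunct2, THEN conjunct1, THEN spec])
  show "w g f \<otimes>\<^bsub>C\<^esub> w k h = w (g \<otimes>\<^bsub>affine_group\<^esub> k) (\<lambda>x. f x * translate g h x)"
    if "k \<in> G" "h \<in> C0" for k h
    by (rule bspec[OF bspec[OF rel[THEN conjunct2, THEN conjunct2, THEN conjunct2, THEN conjunct1] that(1)] that(2)])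
  show "adj C (w g f) =
      w (inv\<^bsub>affine_group\<^esub> g) (translate (inv\<^bsub>affine_group\<^esub> g) (\<lambda>x. cnj (f x)))"
    by (rule rel[THEN conjunct2, THEN conjunct2, THEN conjunct2, THEN conjunct2])
qed

lemma E_C0: "x \<in> carrier C \<Longrightarrow> E x \<in> C0"
  and E_nrm: "x \<in> carrier C \<Longrightarrow> nrm (C0_alg Omega_tilde) (E x) \<le> nrm C x"
  and E_add: "x \<in> carrier C \<Longrightarrow> y \<in> carrier C \<Longrightarrow> E (x \<oplus>\<^bsub>C\<^esub> y) = (\<lambda>\<omega>. E x \<omega> + E y \<omega>)"
  and E_scl: "x \<in> carrier C \<Longrightarrow> E (scl C c x) = (\<lambda>\<omega>. c * E x \<omega>)"
  and E_w: "g \<in> G \<Longrightarrow> f \<in> C0 \<Longrightarrow> E (w g f) = (if g = \<one>\<^bsub>affine_group\<^esub> then f else (\<lambda>\<omega>. 0))"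
  using ce unfolding canonical_expectation_def by blast+

lemma inv_G: "g \<in> G \<Longrightarrow> inv\<^bsub>affine_group\<^esub> g \<in> G"
  by (rule group.inv_closed[OF group_affine])

lemma mult_G: "g \<in> G \<Longrightarrow> h \<in> G \<Longrightarrow> g \<otimes>\<^bsub>affine_group\<^esub> h \<in> G"
  by (rule monoid.m_closed[OF group.is_monoid[OF group_affine]])

definition S :: "'b set" where "S = {w g f | g f. g \<in> G \<and> f \<in> C0}"

lemma E_le: assumes x: "x \<in> carrier C" shows "cmod (E x \<omega>) \<le> nrm C x"
proof (cases "\<omega> \<in> topspace Omega_tilde")
  case True
  obtain B where B: "\<And>y. cmod (E x y) \<le> B" using C0_bounded[OF E_C0[OF x]] by blast
  have "cmod (E x \<omega>) \<le> (SUP y\<in>topspace Omega_tilde. cmod (E x y))"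
    using True B by (intro cSUP_upper bdd_aboveI2[of _ _ B]) auto
  also have "\<dots> = nrm (C0_alg Omega_tilde) (E x)" by (simp add: C0_alg_def function_cstar_def)
  finally show ?thesis using E_nrm[OF x] by simp
next
  case False
  then show ?thesis using E_C0[OF x] C.nrm_nonneg[OF x] by (simp add: C0_iff)
qed

lemma E_diff: "x \<in> carrier C \<Longrightarrow> y \<in> carrier C \<Longrightarrow> E (x \<ominus>\<^bsub>C\<^esub> y) \<omega> = E x \<omega> - E y \<omega>"
  by (simp add: C.minus_eq E_add E_scl C.scl_closed)

lemma E_zero: "E \<zero>\<^bsub>C\<^esub> \<omega> = 0"
  using E_le[of "\<zero>\<^bsub>C\<^esub>" \<omega>] by simp

lemma S_subset: "S \<subseteq> carrier C" using w_closed unfolding S_def by blast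

lemma S_dense: "x \<in> carrier C \<Longrightarrow> e > 0 \<Longrightarrow> \<exists>y\<in>C.add_span S. nrm C (x \<ominus>\<^bsub>C\<^esub> y) < e"
proof (rule C.add_span_dense[OF S_subset, where G = S])
  show "x \<otimes>\<^bsub>C\<^esub> y \<in> S" if xy: "x \<in> S" "y \<in> S" for x y
  proof -
    obtain g f h k where "x = w g f" "y = w h k" "g \<in> G" "f \<in> C0" "h \<in> G" "k \<in> C0"
      using xy unfolding S_def by blast
    then have "x \<otimes>\<^bsub>C\<^esub> y = w (g \<otimes>\<^bsub>affine_group\<^esub> h) (\<lambda>x. f x * translate g k x)"
      "g \<otimes>\<^bsub>affine_group\<^esub> h \<in> G" "(\<lambda>x. f x * translate g k x) \<in> C0"
      using w_mult mult_G C0_mult C0_translate by auto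
    then show ?thesis unfolding S_def by blast
  qed
  show "adj C x \<in> S" if "x \<in> S" for x
    using that w_adj inv_G C0_translate C0_cnj unfolding S_def by blast
  show "scl C c x \<in> S" if "x \<in> S" for x c
    using that w_scl C0_scale unfolding S_def by (auto simp del: affine_group_simps) metis
  show "generated_by C S" using gcp unfolding group_crossed_product_def S_def by blast
qed auto

text \<open>The adjoint of f u_g times k u_h sits at the group element g^(-1) h, so E sees it only
  if g = h. The coefficient is translated by g^(-1), which means evaluation at g omega.\<close>

lemma E_adj_mult_w:
  assumes "g \<in> G" "f \<in> C0" "h \<in> G" "k \<in> C0"
  shows "E (adj C (w g f) \<otimes>\<^bsub>C\<^esub> w h k) \<omega> = (if g = h then cnj (f (act g \<omega>)) * k (act h \<omega>) else 0)"
proof -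
  interpret Gr: group affine_group by (rule group_affine)
  let ?i = "inv\<^bsub>affine_group\<^esub> g"
  have i: "?i \<in> G" using assms(1) by (rule inv_G)
  have c: "translate ?i (\<lambda>x. cnj (f x)) \<in> C0" using C0_translate[OF C0_cnj[OF assms(2)] i] .
  have c': "(\<lambda>x. translate ?i (\<lambda>x. cnj (f x)) x * translate ?i k x) \<in> C0"
    using C0_mult[OF c C0_translate[OF assms(4) i]] .
  have "?i \<otimes>\<^bsub>affine_group\<^esub> h = \<one>\<^bsub>affine_group\<^esub> \<longleftrightarrow> g = h"
    using assms(1,3) i by (metis Gr.inv_equality Gr.inv_inv Gr.l_inv)
  moreover have "translate ?i u \<omega> = u (act g \<omega>)" for u
    unfolding translate_def Gr.inv_inv[OF assms(1)] ..
  ultimately show ?thesis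
    unfolding w_adj[OF assms(1,2)] w_mult[OF i c assms(3,4)] E_w[OF mult_G[OF i assms(3)] c']
    by (cases "g = h") simp_all
qed

text \<open>For a finite sum of elements f_i u_(g_i) the value is the double sum of
  \<open>sum_group_nonneg\<close> with a_i = f_i(g_i omega). The general case follows by density,
  since evaluating E at a point is contractive and the nonnegative reals are closed.\<close>

lemma E_pos:
  assumes c: "c \<in> carrier C"
  shows "E (adj C c \<otimes>\<^bsub>C\<^esub> c) \<omega> \<in> \<real>\<^sub>\<ge>\<^sub>0"
proof -
  have Sc: "x \<in> carrier C" if "x \<in> C.add_span S" for x by (rule C.add_span_closed[OF S_subset that])
  \<comment> \<open>Rather than an expansion of x itself, only the effect of x as a left and a right
    factor under E is recorded; this is all that the double sum needs.\<close>
  have rep: "\<exists>(n::nat) g f. (\<forall>i<n. g i \<in> G \<and> f i \<in> C0) \<and> (\<forall>y\<in>carrier C.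
      E (adj C x \<otimes>\<^bsub>C\<^esub> y) \<omega> = (\<Sum>i<n. E (adj C (w (g i) (f i)) \<otimes>\<^bsub>C\<^esub> y) \<omega>) \<and>
      E (y \<otimes>\<^bsub>C\<^esub> x) \<omega> = (\<Sum>i<n. E (y \<otimes>\<^bsub>C\<^esub> w (g i) (f i)) \<omega>))" if "x \<in> C.add_span S" for x
    using that
  proof induction
    case zero
    show ?case by (rule exI[of _ 0]) (simp add: E_zero)
  next
    case (add a b)
    obtain g0 f0 where a: "a = w g0 f0" "g0 \<in> G" "f0 \<in> C0" using add(1) unfolding S_def by blast
    obtain n g f where IH: "\<And>i. i < (n::nat) \<Longrightarrow> g i \<in> G \<and> f i \<in> C0"
      "\<And>y. y \<in> carrier C \<Longrightarrow> E (adj C b \<otimes>\<^bsub>C\<^esub> y) \<omega> = (\<Sum>i<n. E (adj C (w (g i) (f i)) \<otimes>\<^bsub>C\<^esub> y) \<omega>)"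
      "\<And>y. y \<in> carrier C \<Longrightarrow> E (y \<otimes>\<^bsub>C\<^esub> b) \<omega> = (\<Sum>i<n. E (y \<otimes>\<^bsub>C\<^esub> w (g i) (f i)) \<omega>)"
      using add.IH by blast
    have ac: "a \<in> carrier C" "b \<in> carrier C" using add S_subset Sc by auto
    have "E (adj C (a \<oplus>\<^bsub>C\<^esub> b) \<otimes>\<^bsub>C\<^esub> y) \<omega> = E (adj C a \<otimes>\<^bsub>C\<^esub> y) \<omega> + E (adj C b \<otimes>\<^bsub>C\<^esub> y) \<omega>"
      "E (y \<otimes>\<^bsub>C\<^esub> (a \<oplus>\<^bsub>C\<^esub> b)) \<omega> = E (y \<otimes>\<^bsub>C\<^esub> a) \<omega> + E (y \<otimes>\<^bsub>C\<^esub> b) \<omega>" if "y \<in> carrier C" for y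
      using that ac by (simp_all add: C.adj_add C.distrib_left C.distrib_right C.adj_closed C.mult_closed E_add)
    then show ?case
      using a IH
      by (intro exI[of _ "Suc n"] exI[of _ "g(n := g0)"] exI[of _ "f(n := f0)"])
        (auto simp: less_Suc_eq simp del: affine_group_simps)
  qed
  have span: "E (adj C x \<otimes>\<^bsub>C\<^esub> x) \<omega> \<in> \<real>\<^sub>\<ge>\<^sub>0" if x: "x \<in> C.add_span S" for x
  proof -
    obtain n g f where r: "\<And>i. i < (n::nat) \<Longrightarrow> g i \<in> G \<and> f i \<in> C0"
      "\<And>y. y \<in> carrier C \<Longrightarrow> E (adj C x \<otimes>\<^bsub>C\<^esub> y) \<omega> = (\<Sum>i<n. E (adj C (w (g i) (f i)) \<otimes>\<^bsub>C\<^esub> y) \<omega>)"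
      "\<And>y. y \<in> carrier C \<Longrightarrow> E (y \<otimes>\<^bsub>C\<^esub> x) \<omega> = (\<Sum>i<n. E (y \<otimes>\<^bsub>C\<^esub> w (g i) (f i)) \<omega>)"
      using rep[OF x] by blast
    have "E (adj C x \<otimes>\<^bsub>C\<^esub> x) \<omega> = (\<Sum>i<n. E (adj C (w (g i) (f i)) \<otimes>\<^bsub>C\<^esub> x) \<omega>)"
      by (rule r(2)[OF Sc[OF x]])
    also have "\<dots> = (\<Sum>i<n. \<Sum>j<n. E (adj C (w (g i) (f i)) \<otimes>\<^bsub>C\<^esub> w (g j) (f j)) \<omega>)"
      using r(1) w_closed by (intro sum.cong refl r(3) C.adj_closed) blast
    also have "\<dots> = (\<Sum>i<n. \<Sum>j<n. if g i = g j then cnj (f i (act (g i) \<omega>)) * f j (act (g j) \<omega>) else 0)"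
      using r(1) by (intro sum.cong refl E_adj_mult_w) blast+
    finally show ?thesis using sum_group_nonneg[of "{..<n}" g "\<lambda>i. f i (act (g i) \<omega>)"] by simp
  qed
  have "\<forall>n. \<exists>y. y \<in> C.add_span S \<and> nrm C (c \<ominus>\<^bsub>C\<^esub> y) < 1 / real (Suc n)"
    using S_dense[OF c, of "1 / real (Suc _)"] by auto
  from choice[OF this] obtain Y where
    Y: "\<And>n. Y n \<in> C.add_span S" "\<And>n. nrm C (c \<ominus>\<^bsub>C\<^esub> Y n) < 1 / real (Suc n)" by auto
  have Yc: "Y n \<in> carrier C" for n by (rule Sc[OF Y(1)])
  have lim: "(\<lambda>n. nrm C (c \<ominus>\<^bsub>C\<^esub> Y n)) \<longlonglongrightarrow> 0"
  proof (rule tendsto_sandwich[OF _ _ tendsto_const LIMSEQ_inverse_real_of_nat])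
    show "\<forall>\<^sub>F n in sequentially. 0 \<le> nrm C (c \<ominus>\<^bsub>C\<^esub> Y n)"
      using c Yc by (intro always_eventually allI C.nrm_nonneg C.minus_closed)
    show "\<forall>\<^sub>F n in sequentially. nrm C (c \<ominus>\<^bsub>C\<^esub> Y n) \<le> inverse (real (Suc n))"
      using Y(2) by (auto simp: inverse_eq_divide intro!: always_eventually less_imp_le)
  qed
  have "(\<lambda>n. E (adj C (Y n) \<otimes>\<^bsub>C\<^esub> Y n) \<omega>) \<longlonglongrightarrow> E (adj C c \<otimes>\<^bsub>C\<^esub> c) \<omega>"
  proof (rule LIM_zero_cancel, rule Lim_null_comparison)
    show "(\<lambda>n. nrm C (c \<ominus>\<^bsub>C\<^esub> Y n) * nrm C c + (1 + nrm C c) * nrm C (c \<ominus>\<^bsub>C\<^esub> Y n)) \<longlonglongrightarrow> 0"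
      using tendsto_add[OF tendsto_mult_right[OF lim, of "nrm C c"] tendsto_mult_left[OF lim, of "1 + nrm C c"]] by simp
    show "\<forall>\<^sub>F n in sequentially. cmod (E (adj C (Y n) \<otimes>\<^bsub>C\<^esub> Y n) \<omega> - E (adj C c \<otimes>\<^bsub>C\<^esub> c) \<omega>) \<le>
        nrm C (c \<ominus>\<^bsub>C\<^esub> Y n) * nrm C c + (1 + nrm C c) * nrm C (c \<ominus>\<^bsub>C\<^esub> Y n)"
    proof (intro always_eventually allI)
      fix n
      have cl: "adj C c \<in> carrier C" "adj C (Y n) \<in> carrier C" using c Yc by (auto intro: C.adj_closed)
      have "cmod (E (adj C (Y n) \<otimes>\<^bsub>C\<^esub> Y n) \<omega> - E (adj C c \<otimes>\<^bsub>C\<^esub> c) \<omega>) =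
          cmod (E (adj C c \<otimes>\<^bsub>C\<^esub> c \<ominus>\<^bsub>C\<^esub> adj C (Y n) \<otimes>\<^bsub>C\<^esub> Y n) \<omega>)"
        using c Yc cl by (subst E_diff) (auto intro: C.mult_closed simp: norm_minus_commute)
      also have "\<dots> \<le> nrm C (adj C c \<otimes>\<^bsub>C\<^esub> c \<ominus>\<^bsub>C\<^esub> adj C (Y n) \<otimes>\<^bsub>C\<^esub> Y n)"
        using c Yc cl by (intro E_le) (auto intro: C.mult_closed)
      also have "\<dots> \<le> nrm C (adj C c \<ominus>\<^bsub>C\<^esub> adj C (Y n)) * nrm C c + nrm C (adj C (Y n)) * nrm C (c \<ominus>\<^bsub>C\<^esub> Y n)"
        using c Yc cl by (intro C.nrm_mult_diff)
      also have "nrm C (adj C c \<ominus>\<^bsub>C\<^esub> adj C (Y n)) = nrm C (c \<ominus>\<^bsub>C\<^esub> Y n)"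
        using C.nrm_adj[of "c \<ominus>\<^bsub>C\<^esub> Y n"] c Yc by (simp add: C.adj_diff)
      also have "nrm C (adj C (Y n)) = nrm C (Y n)" by (rule C.nrm_adj[OF Yc])
      also have "nrm C (Y n) \<le> 1 + nrm C c"
      proof -
        have "1 / real (Suc n) \<le> 1" by simp
        then show ?thesis
          using C.nrm_le_diff[OF Yc c, of n] C.nrm_diff_commute[OF Yc c, of n] Y(2)[of n] by linarith
      qed
      finally show "cmod (E (adj C (Y n) \<otimes>\<^bsub>C\<^esub> Y n) \<omega> - E (adj C c \<otimes>\<^bsub>C\<^esub> c) \<omega>) \<le>
        nrm C (c \<ominus>\<^bsub>C\<^esub> Y n) * nrm C c + (1 + nrm C c) * nrm C (c \<ominus>\<^bsub>C\<^esub> Y n)"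
        using C.nrm_nonneg[of "c \<ominus>\<^bsub>C\<^esub> Y n"] c Yc by (simp add: mult_right_mono)
    qed
  qed
  then show ?thesis
    by (rule closed_sequentially[OF closed_nonneg_Reals_complex, rotated]) (use span Y(1) in auto)
qed

text \<open>Compressing f u_g by the projection p multiplies its coefficient by the indicator of
  Omega_B; density and continuity of the compression give the general case. So E maps the corner
  into C(Omega_B), where a state can be applied to it.\<close>

lemma E_corner:
  assumes c: "c \<in> carrier C" and \<omega>: "\<omega> \<notin> topspace Omega_B"
  shows "E (w \<one>\<^bsub>affine_group\<^esub> (indicator (topspace Omega_B)) \<otimes>\<^bsub>C\<^esub> c \<otimes>\<^bsub>C\<^esub>
    w \<one>\<^bsub>affine_group\<^esub> (indicator (topspace Omega_B))) \<omega> = 0"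
proof -
  let ?one = "\<one>\<^bsub>affine_group\<^esub>"
  define I where "I = (indicator (topspace Omega_B) :: point \<Rightarrow> complex)"
  have I: "I \<in> C0" unfolding I_def by (rule CB_C0[OF indicator_Omega_CB])
  have one: "?one \<in> G" by simp
  define p where "p = w ?one I"
  have p: "p \<in> carrier C" unfolding p_def by (rule w_closed[OF one I])
  interpret Gr: group affine_group by (rule group_affine)
  have tr: "translate ?one f = f" for f by simp
  have base: "E (p \<otimes>\<^bsub>C\<^esub> w g f \<otimes>\<^bsub>C\<^esub> p) \<omega> = 0" if g: "g \<in> G" and f: "f \<in> C0" for g f
  proof -
    have If: "(\<lambda>x. I x * f x) \<in> C0" by (rule C0_mult[OF I f])
    have "p \<otimes>\<^bsub>C\<^esub> w g f = w g (\<lambda>x. I x * f x)"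
      unfolding p_def w_mult[OF one I g f] tr using Gr.l_one[OF g] by simp
    then have "p \<otimes>\<^bsub>C\<^esub> w g f \<otimes>\<^bsub>C\<^esub> p = w g (\<lambda>x. I x * f x * translate g I x)"
      unfolding p_def using w_mult[OF g If one I] Gr.r_one[OF g] by simp
    moreover have "(\<lambda>x. I x * f x * translate g I x) \<in> C0" by (rule C0_mult[OF If C0_translate[OF I g]])
    ultimately show ?thesis using E_w[OF g, of "\<lambda>x. I x * f x * translate g I x"] \<omega>
      by (simp add: I_def del: affine_group_simps)
  qed
  have span: "E (p \<otimes>\<^bsub>C\<^esub> y \<otimes>\<^bsub>C\<^esub> p) \<omega> = 0" if "y \<in> C.add_span S" for y using that
  proof induction
    case zero then show ?case using p by (simp add: E_zero)
  next
    case (add a b)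
    have c: "a \<in> carrier C" "b \<in> carrier C" using add S_subset C.add_span_closed[OF S_subset] by auto
    have "E (p \<otimes>\<^bsub>C\<^esub> a \<otimes>\<^bsub>C\<^esub> p) \<omega> = 0" using add(1) base unfolding S_def by blast
    moreover have "p \<otimes>\<^bsub>C\<^esub> (a \<oplus>\<^bsub>C\<^esub> b) \<otimes>\<^bsub>C\<^esub> p = p \<otimes>\<^bsub>C\<^esub> a \<otimes>\<^bsub>C\<^esub> p \<oplus>\<^bsub>C\<^esub> p \<otimes>\<^bsub>C\<^esub> b \<otimes>\<^bsub>C\<^esub> p"
      using p c by (simp add: C.distrib_left C.distrib_right C.mult_closed)
    ultimately show ?case using add p c by (simp add: E_add C.mult_closed)
  qed
  have "cmod (E (p \<otimes>\<^bsub>C\<^esub> c \<otimes>\<^bsub>C\<^esub> p) \<omega>) \<le> e" if e: "e > 0" for e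
  proof -
    define K where "K = nrm C p * nrm C p + 1"
    have K: "K > 0" unfolding K_def by (simp add: add_nonneg_pos)
    obtain y where y: "y \<in> C.add_span S" "nrm C (c \<ominus>\<^bsub>C\<^esub> y) < e / K" using S_dense[OF c, of "e / K"] e K by auto
    have yc: "y \<in> carrier C" by (rule C.add_span_closed[OF S_subset y(1)])
    have "p \<otimes>\<^bsub>C\<^esub> (c \<ominus>\<^bsub>C\<^esub> y) \<otimes>\<^bsub>C\<^esub> p = p \<otimes>\<^bsub>C\<^esub> c \<otimes>\<^bsub>C\<^esub> p \<ominus>\<^bsub>C\<^esub> p \<otimes>\<^bsub>C\<^esub> y \<otimes>\<^bsub>C\<^esub> p"
      using p c yc by (simp add: C.distrib_left_diff C.distrib_right_diff C.mult_closed)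
    then have "E (p \<otimes>\<^bsub>C\<^esub> c \<otimes>\<^bsub>C\<^esub> p) \<omega> = E (p \<otimes>\<^bsub>C\<^esub> (c \<ominus>\<^bsub>C\<^esub> y) \<otimes>\<^bsub>C\<^esub> p) \<omega>"
      using p c yc span[OF y(1)] by (simp add: E_diff C.mult_closed)
    also have "cmod \<dots> \<le> nrm C (p \<otimes>\<^bsub>C\<^esub> (c \<ominus>\<^bsub>C\<^esub> y) \<otimes>\<^bsub>C\<^esub> p)"
      using p c yc by (intro E_le) (auto intro: C.mult_closed)
    also have "\<dots> \<le> nrm C (p \<otimes>\<^bsub>C\<^esub> (c \<ominus>\<^bsub>C\<^esub> y)) * nrm C p" using p c yc by (intro C.nrm_mult) (auto intro: C.mult_closed)
    also have "\<dots> \<le> nrm C p * nrm C (c \<ominus>\<^bsub>C\<^esub> y) * nrm C p"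
      using p c yc by (intro mult_right_mono C.nrm_mult C.nrm_nonneg) auto
    also have "\<dots> = (nrm C p * nrm C p) * nrm C (c \<ominus>\<^bsub>C\<^esub> y)" by simp
    also have "\<dots> \<le> K * nrm C (c \<ominus>\<^bsub>C\<^esub> y)"
      unfolding K_def using c yc by (intro mult_right_mono C.nrm_nonneg) auto
    also have "\<dots> \<le> e" using mult_strict_left_mono[OF y(2) K] K by simp
    finally show ?thesis .
  qed
  then have "cmod (E (p \<otimes>\<^bsub>C\<^esub> c \<otimes>\<^bsub>C\<^esub> p) \<omega>) \<le> 0 + e" if "e > 0" for e
    using that unfolding add_0 .
  then have "cmod (E (p \<otimes>\<^bsub>C\<^esub> c \<otimes>\<^bsub>C\<^esub> p) \<omega>) \<le> 0" by (rule field_le_epsilon)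
  then show ?thesis unfolding p_def I_def norm_le_zero_iff .
qed

end

section \<open>KMS states\<close>

locale crossed_product =
  fixes A :: "'a cstar" and \<iota> :: "(point \<Rightarrow> complex) \<Rightarrow> 'a" and v :: "rat \<times> rat \<Rightarrow> 'a"
    and \<sigma> :: "real \<Rightarrow> 'a \<Rightarrow> 'a"
  assumes scp: "semigroup_crossed_product A \<iota> v" and dyn: "crossed_dynamics A \<iota> v \<sigma>"
begin

sublocale A: unital_cstar_algebra A using scp by (simp add: semigroup_crossed_product_def)

lemma \<iota>_closed: "f \<in> CB \<Longrightarrow> \<iota> f \<in> carrier A"
  and \<iota>_add: "f \<in> CB \<Longrightarrow> g \<in> CB \<Longrightarrow> \<iota> (\<lambda>x. f x + g x) = \<iota> f \<oplus>\<^bsub>A\<^esub> \<iota> g"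
  and \<iota>_mult: "f \<in> CB \<Longrightarrow> g \<in> CB \<Longrightarrow> \<iota> (\<lambda>x. f x * g x) = \<iota> f \<otimes>\<^bsub>A\<^esub> \<iota> g"
  and \<iota>_scl: "f \<in> CB \<Longrightarrow> \<iota> (\<lambda>x. c * f x) = scl A c (\<iota> f)"
  and \<iota>_adj: "f \<in> CB \<Longrightarrow> \<iota> (\<lambda>x. cnj (f x)) = adj A (\<iota> f)"
  and \<iota>_one: "\<iota> (indicator (topspace Omega_B)) = \<one>\<^bsub>A\<^esub>"
  using scp unfolding semigroup_crossed_product_def semigroup_covariant_def unital_star_hom_def star_hom_def
  by simp_all

lemma v_closed: "x \<in> affine_semigroup \<Longrightarrow> v x \<in> carrier A"
  and v_isometry: "x \<in> affine_semigroup \<Longrightarrow> adj A (v x) \<otimes>\<^bsub>A\<^esub> v x = \<one>\<^bsub>A\<^esub>"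
  and v_covariant: "x \<in> affine_semigroup \<Longrightarrow> f \<in> CB \<Longrightarrow>
    v x \<otimes>\<^bsub>A\<^esub> \<iota> f \<otimes>\<^bsub>A\<^esub> adj A (v x) = \<iota> (translate x f)"
  using scp unfolding semigroup_crossed_product_def semigroup_covariant_def by blast+

lemma \<sigma>_closed: "x \<in> carrier A \<Longrightarrow> \<sigma> t x \<in> carrier A"
  and \<sigma>_add: "x \<in> carrier A \<Longrightarrow> y \<in> carrier A \<Longrightarrow> \<sigma> t (x \<oplus>\<^bsub>A\<^esub> y) = \<sigma> t x \<oplus>\<^bsub>A\<^esub> \<sigma> t y"
  and \<sigma>_mult: "x \<in> carrier A \<Longrightarrow> y \<in> carrier A \<Longrightarrow> \<sigma> t (x \<otimes>\<^bsub>A\<^esub> y) = \<sigma> t x \<otimes>\<^bsub>A\<^esub> \<sigma> t y"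
  and \<sigma>_scl: "x \<in> carrier A \<Longrightarrow> \<sigma> t (scl A c x) = scl A c (\<sigma> t x)"
  and \<sigma>_adj: "x \<in> carrier A \<Longrightarrow> \<sigma> t (adj A x) = adj A (\<sigma> t x)"
  and \<sigma>_one: "\<sigma> t \<one>\<^bsub>A\<^esub> = \<one>\<^bsub>A\<^esub>"
  and \<sigma>_\<iota>: "f \<in> CB \<Longrightarrow> \<sigma> t (\<iota> f) = \<iota> f"
  and \<sigma>_v: "n > 0 \<Longrightarrow> \<sigma> t (v (of_int m, of_nat n)) =
      scl A (of_nat n powr (\<i> * of_real t)) (v (of_int m, of_nat n))"
  using dyn unfolding crossed_dynamics_def unital_star_hom_def star_hom_def by simp_all

text \<open>Eigenvectors of the dynamics supply the analytic elements to which the KMS condition is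
  applied in \<open>KMS_cyl\<close>.\<close>

lemma entire_extension_eigenvector:
  assumes x: "x \<in> carrier A" and c: "\<And>t. \<sigma> t x = scl A (exp (\<i> * of_real t * c)) x"
  shows "entire_extension A \<sigma> x (\<lambda>z. scl A (exp (\<i> * z * c)) x)"
  unfolding entire_extension_def
proof (intro conjI allI)
  show "scl A (exp (\<i> * z * c)) x \<in> carrier A" for z by (rule A.scl_closed[OF x])
  show "scl A (exp (\<i> * of_real t * c)) x = \<sigma> t x" for t by (simp add: c)
  fix z
  let ?d = "\<i> * c * exp (\<i> * z * c)"
  have "((\<lambda>z. exp (\<i> * z * c)) has_field_derivative ?d) (at z)"
    by (auto intro!: derivative_eq_intros)
  then have "(\<lambda>h. (exp (\<i> * (z + h) * c) - exp (\<i> * z * c)) / h - ?d) \<midarrow>0\<rightarrow> 0"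
    unfolding DERIV_def by (rule LIM_zero)
  then have "(\<lambda>h. cmod ((exp (\<i> * (z + h) * c) - exp (\<i> * z * c)) / h - ?d) * nrm A x) \<midarrow>0\<rightarrow> 0"
    by (intro tendsto_mult_left_zero tendsto_norm_zero)
  moreover have "nrm A (scl A (1 / h) (scl A (exp (\<i> * (z + h) * c)) x \<ominus>\<^bsub>A\<^esub> scl A (exp (\<i> * z * c)) x) \<ominus>\<^bsub>A\<^esub> scl A ?d x)
     = cmod ((exp (\<i> * (z + h) * c) - exp (\<i> * z * c)) / h - ?d) * nrm A x" for h
  proof -
    have diff: "scl A a x \<ominus>\<^bsub>A\<^esub> scl A b x = scl A (a - b) x" for a b
      using A.scl_add_left[OF x, of a "- b"] x by (simp add: A.minus_eq A.scl_closed A.scl_scl)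
    show ?thesis unfolding diff A.scl_scl[OF x] by (simp add: A.nrm_scl[OF x])
  qed
  ultimately show "\<exists>D\<in>carrier A. ((\<lambda>h. nrm A (scl A (1 / h) (scl A (exp (\<i> * (z + h) * c)) x \<ominus>\<^bsub>A\<^esub>
      scl A (exp (\<i> * z * c)) x) \<ominus>\<^bsub>A\<^esub> D)) \<longlongrightarrow> 0) (at 0)"
    using A.scl_closed[OF x] by (intro bexI[of _ "scl A ?d x"]) simp_all
qed

text \<open>Apply the KMS condition to the isometry v and its adjoint. In one order their product is
  the indicator of the cylinder, in the other it is 1, and moving v to time i beta multiplies it by
  exp(i (i beta) ln n) = n powr (-beta).\<close>

lemma KMS_cyl:
  assumes \<phi>: "KMS_state A \<sigma> \<beta> \<phi>" and n: "n > 0"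
  shows "\<phi> (\<iota> (indicator (cyl m n))) = of_real (real n powr - \<beta>)"
proof -
  let ?x = "(of_int m, of_nat n) :: rat \<times> rat"
  have x: "?x \<in> affine_semigroup" using n by (auto simp: affine_semigroup_def)
  have st: "state A \<phi>" using \<phi> by (simp add: KMS_state_def)
  have vc: "v ?x \<in> carrier A" "adj A (v ?x) \<in> carrier A" using v_closed[OF x] A.adj_closed by auto
  let ?l = "complex_of_real (ln (real n))"
  have pw: "of_nat n powr (\<i> * of_real t) = exp (\<i> * of_real t * ?l)" for t
    using n Ln_of_nat[OF n] by (simp add: powr_def)
  have e1: "\<sigma> t (v ?x) = scl A (exp (\<i> * of_real t * ?l)) (v ?x)" for t
    using \<sigma>_v[OF n, of t m] by (simp add: pw)
  have e2: "\<sigma> t (adj A (v ?x)) = scl A (exp (\<i> * of_real t * (- ?l))) (adj A (v ?x))" for t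
    unfolding \<sigma>_adj[OF vc(1)] e1 A.adj_scl[OF vc(1)] by (simp add: exp_cnj)
  have "\<forall>x\<in>carrier A. \<forall>y\<in>carrier A. \<forall>F F'.
        entire_extension A \<sigma> x F \<and> entire_extension A \<sigma> y F' \<longrightarrow>
        \<phi> (x \<otimes>\<^bsub>A\<^esub> y) = \<phi> (y \<otimes>\<^bsub>A\<^esub> F (\<i> * of_real \<beta>))"
    using \<phi> by (simp add: KMS_state_def)
  then have "\<phi> (v ?x \<otimes>\<^bsub>A\<^esub> adj A (v ?x)) = \<phi> (adj A (v ?x) \<otimes>\<^bsub>A\<^esub> scl A (exp (\<i> * (\<i> * of_real \<beta>) * ?l)) (v ?x))"
    using entire_extension_eigenvector[OF vc(1) e1] entire_extension_eigenvector[OF vc(2) e2] vc by blast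
  also have "\<dots> = exp (\<i> * (\<i> * of_real \<beta>) * ?l) * \<phi> \<one>\<^bsub>A\<^esub>"
    using st vc A.one_closed by (simp add: A.scl_mult_right v_isometry[OF x] state_def)
  also have "exp (\<i> * (\<i> * of_real \<beta>) * ?l) = of_real (real n powr - \<beta>)"
    using n by (simp add: powr_def flip: mult.assoc exp_of_real)
  also have "\<phi> \<one>\<^bsub>A\<^esub> = 1" using st by (simp add: state_def)
  also have "v ?x \<otimes>\<^bsub>A\<^esub> adj A (v ?x) = \<iota> (indicator (cyl m n))"
    using v_covariant[OF x indicator_Omega_CB] A.one_right[OF vc(1)]
      translate_indicator[OF affine_semigroup_subset[OF x], of "topspace Omega_B"] act_image_Omega_B[OF n, of m]
    by (simp add: \<iota>_one)
  finally show ?thesis by simp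
qed

lemma KMS_ge_1:
  assumes \<phi>: "KMS_state A \<sigma> \<beta> \<phi>" shows "\<beta> \<ge> 1"
proof -
  have st: "state A \<phi>" using \<phi> by (simp add: KMS_state_def)
  define p where "p m = (indicator (cyl m 2) :: point \<Rightarrow> complex)" for m
  define I where "I = (indicator (topspace Omega_B) :: point \<Rightarrow> complex)"
  \<comment> \<open>The indicator of the complement of two disjoint cylinders, hence a projection;
    positivity on it says 2 (2 powr (-beta)) <= 1.\<close>
  define h where "h = (\<lambda>x. I x + (-1) * (p 0 x + p 1 x))"
  have c: "p m \<in> CB" "I \<in> CB" for m unfolding p_def I_def by (simp_all add: indicator_cyl_CB indicator_Omega_CB)
  have h: "h \<in> CB" unfolding h_def by (intro CB_add CB_scale c)
  have "(\<lambda>x. cnj (h x) * h x) = h"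
  proof
    fix x
    have "cyl 0 2 \<subseteq> topspace Omega_B" "cyl 1 2 \<subseteq> topspace Omega_B" "x \<notin> cyl 0 2 \<or> x \<notin> cyl 1 2"
      using cyl_subset cyl_disjoint by (auto simp: topspace_Omega_B)
    then show "cnj (h x) * h x = h x" by (auto simp: h_def I_def p_def indicator_def)
  qed
  then have "\<iota> h = adj A (\<iota> h) \<otimes>\<^bsub>A\<^esub> \<iota> h" using \<iota>_mult[OF CB_cnj[OF h] h] \<iota>_adj[OF h] by simp
  then have pos: "\<phi> (\<iota> h) \<in> \<real>\<^sub>\<ge>\<^sub>0" using st \<iota>_closed[OF h] unfolding state_def by metis
  have "\<iota> h = \<iota> I \<oplus>\<^bsub>A\<^esub> scl A (-1) (\<iota> (p 0) \<oplus>\<^bsub>A\<^esub> \<iota> (p 1))"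
    unfolding h_def \<iota>_add[OF c(2) CB_scale[OF CB_add[OF c(1) c(1)]]] \<iota>_scl[OF CB_add[OF c(1) c(1)]] \<iota>_add[OF c(1) c(1)] ..
  then have "\<phi> (\<iota> h) = \<phi> (\<iota> I) - (\<phi> (\<iota> (p 0)) + \<phi> (\<iota> (p 1)))"
    using st \<iota>_closed c by (simp add: state_def A.scl_closed)
  also have "\<dots> = of_real (1 - 2 * 2 powr - \<beta>)"
    using KMS_cyl[OF \<phi>, of 2] st unfolding p_def I_def by (simp add: \<iota>_one state_def)
  finally have "2 * 2 powr - \<beta> \<le> (1 :: real)" using pos by (simp add: complex_nonneg_Reals_iff)
  then have "2 powr (1 - \<beta>) \<le> (2::real) powr 0" by (simp add: powr_diff powr_minus field_simps)
  then show ?thesis by (subst (asm) powr_le_cancel_iff) auto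
qed

end

section \<open>The corner and its homogeneous elements\<close>

locale crossed_product_expectation = crossed_product A \<iota> v \<sigma> + expectation C w E
  for A :: "'a cstar" and \<iota> v \<sigma> and C :: "'b cstar" and w E +
  fixes \<pi> :: "'a \<Rightarrow> 'b"
  assumes cor: "corner_identification A \<iota> v C w \<pi>"
begin

lemma \<pi>_closed: "x \<in> carrier A \<Longrightarrow> \<pi> x \<in> carrier C"
  and \<pi>_add: "x \<in> carrier A \<Longrightarrow> y \<in> carrier A \<Longrightarrow> \<pi> (x \<oplus>\<^bsub>A\<^esub> y) = \<pi> x \<oplus>\<^bsub>C\<^esub> \<pi> y"
  and \<pi>_mult: "x \<in> carrier A \<Longrightarrow> y \<in> carrier A \<Longrightarrow> \<pi> (x \<otimes>\<^bsub>A\<^esub> y) = \<pi> x \<otimes>\<^bsub>C\<^esub> \<pi> y"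
  and \<pi>_scl: "x \<in> carrier A \<Longrightarrow> \<pi> (scl A c x) = scl C c (\<pi> x)"
  and \<pi>_adj: "x \<in> carrier A \<Longrightarrow> \<pi> (adj A x) = adj C (\<pi> x)"
  and \<pi>_\<iota>: "f \<in> CB \<Longrightarrow> \<pi> (\<iota> f) = w \<one>\<^bsub>affine_group\<^esub> f"
  and \<pi>_v: "s \<in> affine_semigroup \<Longrightarrow> \<pi> (v s) = w s (translate s (indicator (topspace Omega_B)))"
  using cor unfolding corner_identification_def star_hom_def by blast+

lemma E_\<pi>_CB: assumes x: "x \<in> carrier A" shows "E (\<pi> x) \<in> CB"
proof (rule C0_CB)
  show "E (\<pi> x) \<in> C0" by (rule E_C0[OF \<pi>_closed[OF x]])
  fix \<omega> assume \<omega>: "\<omega> \<notin> topspace Omega_B"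
  have "\<pi> ` carrier A = {w \<one>\<^bsub>affine_group\<^esub> (indicator (topspace Omega_B)) \<otimes>\<^bsub>C\<^esub> c \<otimes>\<^bsub>C\<^esub>
      w \<one>\<^bsub>affine_group\<^esub> (indicator (topspace Omega_B)) | c. c \<in> carrier C}"
    using cor unfolding corner_identification_def Let_def by (intro bij_betw_imp_surj_on) blast
  then obtain c where "c \<in> carrier C" "\<pi> x = w \<one>\<^bsub>affine_group\<^esub> (indicator (topspace Omega_B)) \<otimes>\<^bsub>C\<^esub> c \<otimes>\<^bsub>C\<^esub>
      w \<one>\<^bsub>affine_group\<^esub> (indicator (topspace Omega_B))" using x by blast
  then show "E (\<pi> x) \<omega> = 0" using E_corner \<omega> by metis
qed

lemma E_\<pi>_\<iota>: assumes f: "f \<in> CB" shows "E (\<pi> (\<iota> f)) = f"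
proof -
  have "\<one>\<^bsub>affine_group\<^esub> \<in> G" by simp
  then show ?thesis unfolding \<pi>_\<iota>[OF f] using E_w CB_C0[OF f] by presburger
qed

text \<open>The eigenvalue k powr (i z) for g = (m, k), written so that it is visibly entire in z
  and multiplicative in g.\<close>

definition lam :: "rat \<times> rat \<Rightarrow> complex \<Rightarrow> complex" where
  "lam g z = exp (\<i> * z * of_real (ln (of_rat (snd g))))"

text \<open>Degree g in two senses at once: as a term f u_g of the corner and as an eigenvector of
  the dynamics. Generators are of this kind, \<open>\<iota> f\<close> with the unit of the group as
  degree and \<open>v x\<close> with degree x.\<close>

definition homog :: "rat \<times> rat \<Rightarrow> 'a set" where
  "homog g = {a \<in> carrier A. (\<exists>f\<in>C0. \<pi> a = w g f) \<and> (\<forall>t::real. \<sigma> t a = scl A (lam g (of_real t)) a)}"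

definition homogs :: "'a set" where "homogs = (\<Union>g\<in>G. homog g)"

lemma lam_mult:
  assumes "g \<in> G" "h \<in> G" shows "lam (g \<otimes>\<^bsub>affine_group\<^esub> h) z = lam g z * lam h z"
proof -
  obtain m k n l where gh: "g = (m, k)" "k > 0" "h = (n, l)" "l > 0" using assms by auto
  then have "ln (of_rat (k * l)) = ln (of_rat k) + ln (of_rat l :: real)" by (simp add: of_rat_mult ln_mult)
  then show ?thesis using gh by (simp add: lam_def distrib_left exp_add)
qed

lemma lam_inv:
  assumes g: "g \<in> G" shows "lam (inv\<^bsub>affine_group\<^esub> g) (of_real t) = cnj (lam g (of_real t))"
proof -
  obtain m k where mk: "g = (m, k)" "k > 0" using g by auto
  have "ln (of_rat (1 / k)) = - ln (of_rat k :: real)" using mk by (simp add: of_rat_divide ln_div)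
  then show ?thesis using mk by (simp add: lam_def inv_affine exp_cnj)
qed

lemma homog_closed: "a \<in> homog g \<Longrightarrow> a \<in> carrier A"
  by (simp add: homog_def)

lemma homogs_subset: "homogs \<subseteq> carrier A"
  unfolding homogs_def using homog_closed by blast

lemma homogs_dense:
  assumes "x \<in> carrier A" "e > 0" shows "\<exists>y\<in>A.add_span homogs. nrm A (x \<ominus>\<^bsub>A\<^esub> y) < e"
proof (rule A.add_span_dense[OF homogs_subset _ _ _ _ _ assms, where G = "\<iota> ` CB \<union> v ` affine_semigroup"])
  show "generated_by A (\<iota> ` CB \<union> v ` affine_semigroup)"
    using scp unfolding semigroup_crossed_product_def by blast
  show "x \<otimes>\<^bsub>A\<^esub> y \<in> homogs" if xy: "x \<in> homogs" "y \<in> homogs" for x y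
  proof -
    obtain g h where gh: "g \<in> G" "h \<in> G" "x \<in> homog g" "y \<in> homog h" using xy unfolding homogs_def by blast
    then obtain f k where fk: "f \<in> C0" "k \<in> C0" "\<pi> x = w g f" "\<pi> y = w h k" unfolding homog_def by blast
    have c: "x \<in> carrier A" "y \<in> carrier A" using gh homog_closed by auto
    have "\<pi> (x \<otimes>\<^bsub>A\<^esub> y) = w (g \<otimes>\<^bsub>affine_group\<^esub> h) (\<lambda>x. f x * translate g k x)"
      unfolding \<pi>_mult[OF c] fk(3,4) by (rule w_mult[OF gh(1) fk(1) gh(2) fk(2)])
    moreover have "(\<lambda>x. f x * translate g k x) \<in> C0" by (rule C0_mult[OF fk(1) C0_translate[OF fk(2) gh(1)]])
    moreover have "\<sigma> t (x \<otimes>\<^bsub>A\<^esub> y) = scl A (lam (g \<otimes>\<^bsub>affine_group\<^esub> h) (of_real t)) (x \<otimes>\<^bsub>A\<^esub> y)" for t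
      using gh(3,4) c unfolding \<sigma>_mult[OF c] lam_mult[OF gh(1,2)] homog_def
      by (simp add: A.scl_mult_left A.scl_mult_right A.scl_scl A.scl_closed A.mult_closed mult.commute)
    ultimately have "x \<otimes>\<^bsub>A\<^esub> y \<in> homog (g \<otimes>\<^bsub>affine_group\<^esub> h)" unfolding homog_def using A.mult_closed[OF c] by blast
    then show ?thesis unfolding homogs_def using mult_G[OF gh(1,2)] by blast
  qed
  show "adj A x \<in> homogs" if x: "x \<in> homogs" for x
  proof -
    obtain g where g: "g \<in> G" "x \<in> homog g" using x unfolding homogs_def by blast
    then obtain f where f: "f \<in> C0" "\<pi> x = w g f" unfolding homog_def by blast
    have c: "x \<in> carrier A" using g homog_closed by auto
    have "\<pi> (adj A x) = w (inv\<^bsub>affine_group\<^esub> g) (translate (inv\<^bsub>affine_group\<^esub> g) (\<lambda>x. cnj (f x)))"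
      unfolding \<pi>_adj[OF c] f(2) by (rule w_adj[OF g(1) f(1)])
    moreover have "translate (inv\<^bsub>affine_group\<^esub> g) (\<lambda>x. cnj (f x)) \<in> C0"
      by (rule C0_translate[OF C0_cnj[OF f(1)] inv_G[OF g(1)]])
    moreover have "\<sigma> t (adj A x) = scl A (lam (inv\<^bsub>affine_group\<^esub> g) (of_real t)) (adj A x)" for t
      using g(2) c unfolding \<sigma>_adj[OF c] lam_inv[OF g(1)] homog_def by (simp add: A.adj_scl)
    ultimately have "adj A x \<in> homog (inv\<^bsub>affine_group\<^esub> g)" unfolding homog_def using A.adj_closed[OF c] by blast
    then show ?thesis unfolding homogs_def using inv_G[OF g(1)] by blast
  qed
  show "scl A c x \<in> homogs" if x: "x \<in> homogs" for c x
  proof -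
    obtain g where g: "g \<in> G" "x \<in> homog g" using x unfolding homogs_def by blast
    then obtain f where f: "f \<in> C0" "\<pi> x = w g f" unfolding homog_def by blast
    have xc: "x \<in> carrier A" using g homog_closed by auto
    have "\<pi> (scl A c x) = w g (\<lambda>x. c * f x)" unfolding \<pi>_scl[OF xc] f(2) w_scl[OF g(1) f(1)] ..
    moreover have "\<sigma> t (scl A c x) = scl A (lam g (of_real t)) (scl A c x)" for t
      using g(2) xc unfolding \<sigma>_scl[OF xc] homog_def by (simp add: A.scl_scl mult.commute)
    ultimately have "scl A c x \<in> homog g" unfolding homog_def using A.scl_closed[OF xc] C0_scale[OF f(1)] by blast
    then show ?thesis unfolding homogs_def using g(1) by blast
  qed
  show "\<iota> ` CB \<union> v ` affine_semigroup \<subseteq> homogs"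
  proof (intro Un_least image_subsetI)
    fix f assume f: "f \<in> CB"
    have "\<iota> f \<in> homog \<one>\<^bsub>affine_group\<^esub>" unfolding homog_def
      using \<iota>_closed[OF f] \<pi>_\<iota>[OF f] CB_C0[OF f] \<sigma>_\<iota>[OF f] A.scl_one by (auto simp: lam_def)
    then show "\<iota> f \<in> homogs" unfolding homogs_def by force
  next
    fix x assume x: "x \<in> affine_semigroup"
    then obtain m n where mn: "x = (of_int m, of_nat n)" "n > 0" by (auto simp: affine_semigroup_def)
    have "\<sigma> t (v x) = scl A (lam x (of_real t)) (v x)" for t
    proof -
      have "of_nat n powr (\<i> * of_real t) = lam x (of_real t)"
        using mn(2) Ln_of_nat[OF mn(2)] by (simp add: powr_def lam_def mn(1))
      then show ?thesis using \<sigma>_v[OF mn(2), of t m] mn(1) by simp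
    qed
    then have "v x \<in> homog x" unfolding homog_def
      using v_closed[OF x] \<pi>_v[OF x] CB_C0[OF translate_CB[OF x indicator_Omega_CB]] by blast
    then show "v x \<in> homogs" unfolding homogs_def using affine_semigroup_subset[OF x] by blast
  qed
qed

text \<open>Additivity and boundedness suffice, because scalars are absorbed: the homogeneous
  elements are closed under scalar multiples, so their sums are already dense.\<close>

lemma homogs_functional_eq:
  fixes f g :: "'a \<Rightarrow> complex"
  assumes f: "\<And>x y. x \<in> carrier A \<Longrightarrow> y \<in> carrier A \<Longrightarrow> f (x \<oplus>\<^bsub>A\<^esub> y) = f x + f y"
      "\<And>x. x \<in> carrier A \<Longrightarrow> cmod (f x) \<le> K * nrm A x"
    and g: "\<And>x y. x \<in> carrier A \<Longrightarrow> y \<in> carrier A \<Longrightarrow> g (x \<oplus>\<^bsub>A\<^esub> y) = g x + g y"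
      "\<And>x. x \<in> carrier A \<Longrightarrow> cmod (g x) \<le> L * nrm A x"
    and eq: "\<And>x. x \<in> homogs \<Longrightarrow> f x = g x" and x: "x \<in> carrier A"
  shows "f x = g x"
proof -
  have zero: "f \<zero>\<^bsub>A\<^esub> = g \<zero>\<^bsub>A\<^esub>" using f(1)[of "\<zero>\<^bsub>A\<^esub>" "\<zero>\<^bsub>A\<^esub>"] g(1)[of "\<zero>\<^bsub>A\<^esub>" "\<zero>\<^bsub>A\<^esub>"] by simp
  have span: "f y = g y" if "y \<in> A.add_span homogs" for y using that
  proof induction
    case (add a b)
    then have "a \<in> carrier A" "b \<in> carrier A" using homogs_subset A.add_span_closed[OF homogs_subset] by auto
    then show ?case using add eq f(1) g(1) by simp
  qed (rule zero)
  have "cmod (f x - g x) \<le> e" if e: "e > 0" for e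
  proof -
    define M where "M = \<bar>K\<bar> + \<bar>L\<bar> + 1"
    have M: "M > 0" by (simp add: M_def add_nonneg_pos)
    obtain y where y: "y \<in> A.add_span homogs" "nrm A (x \<ominus>\<^bsub>A\<^esub> y) < e / M"
      using homogs_dense[OF x, of "e / M"] e M by auto
    have yc: "y \<in> carrier A" by (rule A.add_span_closed[OF homogs_subset y(1)])
    have d: "x \<ominus>\<^bsub>A\<^esub> y \<in> carrier A" using x yc by simp
    have "x = (x \<ominus>\<^bsub>A\<^esub> y) \<oplus>\<^bsub>A\<^esub> y" using x yc by (simp add: a_minus_def A.a_assoc A.l_neg)
    then have "f x = f (x \<ominus>\<^bsub>A\<^esub> y) + f y" "g x = g (x \<ominus>\<^bsub>A\<^esub> y) + g y" using f(1)[OF d yc] g(1)[OF d yc] by metis+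
    then have "cmod (f x - g x) = cmod (f (x \<ominus>\<^bsub>A\<^esub> y) - g (x \<ominus>\<^bsub>A\<^esub> y))" using span[OF y(1)] by simp
    also have "\<dots> \<le> K * nrm A (x \<ominus>\<^bsub>A\<^esub> y) + L * nrm A (x \<ominus>\<^bsub>A\<^esub> y)"
      using norm_triangle_ineq4[of "f (x \<ominus>\<^bsub>A\<^esub> y)" "g (x \<ominus>\<^bsub>A\<^esub> y)"] f(2)[OF d] g(2)[OF d] by linarith
    also have "\<dots> \<le> M * nrm A (x \<ominus>\<^bsub>A\<^esub> y)"
      unfolding M_def distrib_right[symmetric] using A.nrm_nonneg[OF d] by (intro mult_right_mono) auto
    also have "\<dots> \<le> e" using mult_strict_left_mono[OF y(2) M] M by simp
    finally show ?thesis .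
  qed
  then have "cmod (f x - g x) \<le> 0 + e" if "e > 0" for e using that unfolding add_0 .
  then have "cmod (f x - g x) \<le> 0" by (rule field_le_epsilon)
  then show ?thesis by simp
qed

section \<open>The KMS state of a scaling state\<close>

context
  fixes \<psi> :: "(point \<Rightarrow> complex) \<Rightarrow> complex" and \<beta> :: real
  assumes \<psi>: "scaling_state \<beta> \<psi>"
begin

lemma state_\<psi>: "state (C_alg Omega_B) \<psi>" using \<psi> by (simp add: scaling_state_def)

definition phi :: "'a \<Rightarrow> complex" where
  "phi = restrict (\<lambda>a. \<psi> (E (\<pi> a))) (carrier A)"

lemma phi_add: "x \<in> carrier A \<Longrightarrow> y \<in> carrier A \<Longrightarrow> phi (x \<oplus>\<^bsub>A\<^esub> y) = phi x + phi y"
  by (simp add: phi_def \<pi>_add E_add \<pi>_closed E_\<pi>_CB state_CB_add[OF state_\<psi>])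

lemma phi_scl: "x \<in> carrier A \<Longrightarrow> phi (scl A c x) = c * phi x"
  by (simp add: phi_def \<pi>_scl E_scl \<pi>_closed E_\<pi>_CB state_CB_scl[OF state_\<psi>] A.scl_closed)

lemma state_phi: "state A phi"
  unfolding state_def
proof (intro conjI ballI allI)
  show "phi \<in> extensional (carrier A)" by (simp add: phi_def)
  show "phi (x \<oplus>\<^bsub>A\<^esub> y) = phi x + phi y" if "x \<in> carrier A" "y \<in> carrier A" for x y
    using that by (rule phi_add)
  show "phi (scl A c x) = c * phi x" if "x \<in> carrier A" for x c using that by (rule phi_scl)
  show "phi (adj A x \<otimes>\<^bsub>A\<^esub> x) \<in> \<real>\<^sub>\<ge>\<^sub>0" if x: "x \<in> carrier A" for x
  proof -
    have c: "adj A x \<otimes>\<^bsub>A\<^esub> x \<in> carrier A" using x by (simp add: A.mult_closed A.adj_closed)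
    have "\<pi> (adj A x \<otimes>\<^bsub>A\<^esub> x) = adj C (\<pi> x) \<otimes>\<^bsub>C\<^esub> \<pi> x" using x by (simp add: \<pi>_mult \<pi>_adj A.adj_closed)
    then have "E (\<pi> (adj A x \<otimes>\<^bsub>A\<^esub> x)) \<omega> \<in> \<real>\<^sub>\<ge>\<^sub>0" for \<omega> using E_pos[OF \<pi>_closed[OF x]] by simp
    then show ?thesis using state_CB_pos[OF state_\<psi> E_\<pi>_CB[OF c]] c by (simp add: phi_def)
  qed
  show "phi \<one>\<^bsub>A\<^esub> = 1"
    using E_\<pi>_\<iota>[OF indicator_Omega_CB] state_CB_one[OF state_\<psi>] A.one_closed by (simp add: phi_def \<iota>_one)
qed

lemma phi_bounded: "x \<in> carrier A \<Longrightarrow> cmod (phi x) \<le> 2 * nrm A x"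
  by (rule A.state_bounded[OF state_phi])

lemma phi_\<sigma>:
  assumes x: "x \<in> carrier A" shows "phi (\<sigma> t x) = phi x"
proof -
  \<comment> \<open>The composition with the automorphism is again a state and therefore bounded, so
    it can be compared with \<open>phi\<close> on homogeneous elements. There \<open>phi\<close>
    vanishes unless g is the unit, and then the dynamics acts trivially.\<close>
  define \<phi>' where "\<phi>' = restrict (\<lambda>x. phi (\<sigma> t x)) (carrier A)"
  have "state A \<phi>'" unfolding state_def
  proof (intro conjI ballI allI)
    fix x assume x: "x \<in> carrier A"
    show "\<phi>' (adj A x \<otimes>\<^bsub>A\<^esub> x) \<in> \<real>\<^sub>\<ge>\<^sub>0"
      using x state_phi \<sigma>_closed[OF x] unfolding state_def
      by (simp add: \<phi>'_def \<sigma>_mult \<sigma>_adj A.mult_closed A.adj_closed)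
  qed (use state_phi in \<open>auto simp: \<phi>'_def \<sigma>_add \<sigma>_scl \<sigma>_one \<sigma>_closed phi_add phi_scl A.scl_closed A.one_closed state_def\<close>)
  note bdd = A.state_bounded[OF this]
  show ?thesis
  proof (rule homogs_functional_eq[where f = "\<lambda>x. phi (\<sigma> t x)" and g = phi and K = 2 and L = 2, OF _ _ _ _ _ x])
    fix x assume "x \<in> homogs"
    then obtain g where g: "g \<in> G" "x \<in> homog g" unfolding homogs_def by blast
    then obtain f where f: "f \<in> C0" "\<pi> x = w g f" unfolding homog_def by blast
    have xc: "x \<in> carrier A" using g homog_closed by auto
    have \<sigma>x: "\<sigma> t x = scl A (lam g (of_real t)) x" using g unfolding homog_def by blast
    show "phi (\<sigma> t x) = phi x"
    proof (cases "g = \<one>\<^bsub>affine_group\<^esub>")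
      case True
      then show ?thesis using phi_scl[OF xc] by (simp add: \<sigma>x lam_def)
    next
      case False
      then have "E (\<pi> x) = (\<lambda>\<omega>. 0)" unfolding f(2) using E_w[OF g(1) f(1)] by presburger
      then have "phi x = 0" using xc state_CB_scl[OF state_\<psi> CB_zero, of 0] by (simp add: phi_def)
      then show ?thesis using phi_scl[OF xc] by (simp add: \<sigma>x)
    qed
  qed (use bdd phi_bounded in \<open>auto simp: \<phi>'_def phi_add \<sigma>_add \<sigma>_closed\<close>)
qed

text \<open>For x of degree g both sides vanish unless g h = 1. In that case the coefficient of y x
  is the translate by h of the coefficient of x y; both lie in C(Omega_B) because they come from the
  corner, so the scaling property of psi applies.\<close>

lemma phi_twist:
  assumes x: "x \<in> carrier A" and h: "h \<in> G" and y: "y \<in> homog h"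
  shows "phi (x \<otimes>\<^bsub>A\<^esub> y) = of_real (of_rat (snd h) powr \<beta>) * phi (y \<otimes>\<^bsub>A\<^esub> x)"
proof -
  have yc: "y \<in> carrier A" by (rule homog_closed[OF y])
  obtain f' where f': "f' \<in> C0" "\<pi> y = w h f'" using y unfolding homog_def by blast
  let ?c = "complex_of_real (of_rat (snd h) powr \<beta>)"
  interpret Gr: group affine_group by (rule group_affine)
  show ?thesis
  proof (rule homogs_functional_eq[where f = "\<lambda>x. phi (x \<otimes>\<^bsub>A\<^esub> y)" and g = "\<lambda>x. ?c * phi (y \<otimes>\<^bsub>A\<^esub> x)"
      and K = "2 * nrm A y" and L = "cmod ?c * (2 * nrm A y)", OF _ _ _ _ _ x])
    fix x assume x: "x \<in> carrier A"
    have n: "nrm A (x \<otimes>\<^bsub>A\<^esub> y) \<le> nrm A x * nrm A y" "nrm A (y \<otimes>\<^bsub>A\<^esub> x) \<le> nrm A y * nrm A x"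
      using A.nrm_mult x yc by auto
    show "cmod (phi (x \<otimes>\<^bsub>A\<^esub> y)) \<le> 2 * nrm A y * nrm A x"
      using phi_bounded[OF A.mult_closed[OF x yc]] n(1) by (simp add: mult.commute)
    have "cmod (phi (y \<otimes>\<^bsub>A\<^esub> x)) \<le> 2 * nrm A y * nrm A x"
      using phi_bounded[OF A.mult_closed[OF yc x]] n(2) by simp
    then show "cmod (?c * phi (y \<otimes>\<^bsub>A\<^esub> x)) \<le> cmod ?c * (2 * nrm A y) * nrm A x"
      unfolding norm_mult mult.assoc by (intro mult_left_mono) auto
    fix z assume z: "z \<in> carrier A"
    show "phi ((x \<oplus>\<^bsub>A\<^esub> z) \<otimes>\<^bsub>A\<^esub> y) = phi (x \<otimes>\<^bsub>A\<^esub> y) + phi (z \<otimes>\<^bsub>A\<^esub> y)"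
      using x z yc by (simp add: A.distrib_right phi_add A.mult_closed)
    show "?c * phi (y \<otimes>\<^bsub>A\<^esub> (x \<oplus>\<^bsub>A\<^esub> z)) = ?c * phi (y \<otimes>\<^bsub>A\<^esub> x) + ?c * phi (y \<otimes>\<^bsub>A\<^esub> z)"
      using x z yc by (simp add: A.distrib_left phi_add A.mult_closed distrib_left)
  next
    fix x assume "x \<in> homogs"
    then obtain g where g: "g \<in> G" "x \<in> homog g" unfolding homogs_def by blast
    then obtain f where f: "f \<in> C0" "\<pi> x = w g f" unfolding homog_def by blast
    have xc: "x \<in> carrier A" using g homog_closed by auto
    have c: "x \<otimes>\<^bsub>A\<^esub> y \<in> carrier A" "y \<otimes>\<^bsub>A\<^esub> x \<in> carrier A" using xc yc A.mult_closed by auto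
    let ?F = "\<lambda>\<omega>. f \<omega> * translate g f' \<omega>" and ?F' = "\<lambda>\<omega>. f' \<omega> * translate h f \<omega>"
    have FC: "?F \<in> C0" "?F' \<in> C0" using C0_mult C0_translate f f' g h by auto
    have E1: "E (\<pi> (x \<otimes>\<^bsub>A\<^esub> y)) = (if g \<otimes>\<^bsub>affine_group\<^esub> h = \<one>\<^bsub>affine_group\<^esub> then ?F else (\<lambda>\<omega>. 0))"
      unfolding \<pi>_mult[OF xc yc] f(2) f'(2) w_mult[OF g(1) f(1) h f'(1)] by (rule E_w[OF mult_G[OF g(1) h] FC(1)])
    have E2: "E (\<pi> (y \<otimes>\<^bsub>A\<^esub> x)) = (if h \<otimes>\<^bsub>affine_group\<^esub> g = \<one>\<^bsub>affine_group\<^esub> then ?F' else (\<lambda>\<omega>. 0))"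
      unfolding \<pi>_mult[OF yc xc] f(2) f'(2) w_mult[OF h f'(1) g(1) f(1)] by (rule E_w[OF mult_G[OF h g(1)] FC(2)])
    show "phi (x \<otimes>\<^bsub>A\<^esub> y) = ?c * phi (y \<otimes>\<^bsub>A\<^esub> x)"
    proof (cases "g \<otimes>\<^bsub>affine_group\<^esub> h = \<one>\<^bsub>affine_group\<^esub>")
      case False
      then have "h \<otimes>\<^bsub>affine_group\<^esub> g \<noteq> \<one>\<^bsub>affine_group\<^esub>" using Gr.inv_comm[OF _ h g(1)] by blast
      then have "E (\<pi> (x \<otimes>\<^bsub>A\<^esub> y)) = (\<lambda>\<omega>. 0)" "E (\<pi> (y \<otimes>\<^bsub>A\<^esub> x)) = (\<lambda>\<omega>. 0)"
        unfolding E1 E2 using False by presburger+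
      then show ?thesis using c state_CB_scl[OF state_\<psi> CB_zero, of 0] by (simp add: phi_def)
    next
      case True
      then have hg: "h \<otimes>\<^bsub>affine_group\<^esub> g = \<one>\<^bsub>affine_group\<^esub>" using Gr.inv_comm[OF _ g(1) h] by blast
      have EF: "E (\<pi> (x \<otimes>\<^bsub>A\<^esub> y)) = ?F" "E (\<pi> (y \<otimes>\<^bsub>A\<^esub> x)) = ?F'"
        unfolding E1 E2 using True hg by presburger+
      have "translate h (translate g f') = f'" unfolding translate_translate[OF h g(1)] hg by simp
      then have F': "?F' = translate h ?F" by (auto simp: translate_def fun_eq_iff mult.commute)
      obtain m k where mk: "h = (m, k)" "k > 0" using h by auto
      have CBs: "?F \<in> CB" "translate h ?F \<in> CB"
        using E_\<pi>_CB[OF c(1)] E_\<pi>_CB[OF c(2)] unfolding EF F' by auto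
      have eq: "\<psi> ?F' = of_real (of_rat k powr - \<beta>) * \<psi> ?F"
        unfolding F' using scaling_state_translate_group[OF \<psi> mk(2) CBs(1)] CBs(2) mk(1) by simp
      have "(of_rat k :: real) powr \<beta> * of_rat k powr - \<beta> = 1"
        using mk(2) by (simp add: powr_add[symmetric])
      then have "complex_of_real (of_rat k powr \<beta>) * of_real (of_rat k powr - \<beta>) = 1"
        by (metis of_real_1 of_real_mult)
      then have "?c * \<psi> ?F' = \<psi> ?F" unfolding eq mult.assoc[symmetric] by (simp add: mk(1))
      then show ?thesis unfolding phi_def using c EF by simp
    qed
  qed
qed

lemma phi_KMS: "KMS_state A \<sigma> \<beta> phi"
  unfolding KMS_state_def
proof (intro conjI ballI allI impI)
  show "state A phi" by (rule state_phi)
  show "phi (\<sigma> t a) = phi a" if "a \<in> carrier A" for t a using that by (rule phi_\<sigma>)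
  fix x y F F'
  assume x: "x \<in> carrier A" and y: "y \<in> carrier A"
    and "entire_extension A \<sigma> x F \<and> entire_extension A \<sigma> y F'"
  then have F: "entire_extension A \<sigma> x F" by blast
  have Fc: "F z \<in> carrier A" for z using F unfolding entire_extension_def by blast
  have F\<sigma>: "F (of_real t) = \<sigma> t x" for t using F unfolding entire_extension_def by blast
  let ?z = "\<i> * complex_of_real \<beta>"
  \<comment> \<open>With x and F fixed, both sides are additive and bounded in y, so y may be taken
    homogeneous.\<close>
  show "phi (x \<otimes>\<^bsub>A\<^esub> y) = phi (y \<otimes>\<^bsub>A\<^esub> F ?z)"
  proof (rule homogs_functional_eq[where f = "\<lambda>y. phi (x \<otimes>\<^bsub>A\<^esub> y)" and g = "\<lambda>y. phi (y \<otimes>\<^bsub>A\<^esub> F ?z)"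
      and K = "2 * nrm A x" and L = "2 * nrm A (F ?z)", OF _ _ _ _ _ y])
    fix y assume y: "y \<in> carrier A"
    show "cmod (phi (x \<otimes>\<^bsub>A\<^esub> y)) \<le> 2 * nrm A x * nrm A y"
      using phi_bounded[OF A.mult_closed[OF x y]] A.nrm_mult[OF x y] by simp
    show "cmod (phi (y \<otimes>\<^bsub>A\<^esub> F ?z)) \<le> 2 * nrm A (F ?z) * nrm A y"
      using phi_bounded[OF A.mult_closed[OF y Fc[of ?z]]] A.nrm_mult[OF y Fc[of ?z]]
      by (simp add: mult.commute mult.left_commute)
    fix z assume z: "z \<in> carrier A"
    show "phi (x \<otimes>\<^bsub>A\<^esub> (y \<oplus>\<^bsub>A\<^esub> z)) = phi (x \<otimes>\<^bsub>A\<^esub> y) + phi (x \<otimes>\<^bsub>A\<^esub> z)"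
      using x y z by (simp add: A.distrib_left phi_add A.mult_closed)
    show "phi ((y \<oplus>\<^bsub>A\<^esub> z) \<otimes>\<^bsub>A\<^esub> F ?z) = phi (y \<otimes>\<^bsub>A\<^esub> F ?z) + phi (z \<otimes>\<^bsub>A\<^esub> F ?z)"
      using y z Fc by (simp add: A.distrib_right phi_add A.mult_closed)
  next
    fix y assume "y \<in> homogs"
    then obtain h where h: "h \<in> G" "y \<in> homog h" unfolding homogs_def by blast
    have yc: "y \<in> carrier A" using h homog_closed by auto
    obtain m k where mk: "h = (m, k)" "k > 0" using h(1) by auto
    define l where "l = ln (of_rat k :: real)"
    have lam: "lam h z = exp (\<i> * z * of_real l)" for z by (simp add: lam_def mk l_def)
    define q where "q z = phi (y \<otimes>\<^bsub>A\<^esub> F z)" for z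
    \<comment> \<open>Differentiability of F in norm passes to q because left multiplication by y
      followed by \<open>phi\<close> is linear and bounded.\<close>
    have "(q has_field_derivative phi (y \<otimes>\<^bsub>A\<^esub> D)) (at z)"
      if D: "D \<in> carrier A" "((\<lambda>h. nrm A (scl A (1 / h) (F (z + h) \<ominus>\<^bsub>A\<^esub> F z) \<ominus>\<^bsub>A\<^esub> D)) \<longlongrightarrow> 0) (at 0)" for z D
      unfolding DERIV_def
    proof (rule LIM_zero_cancel, rule Lim_null_comparison)
      show "((\<lambda>h. 2 * nrm A y * nrm A (scl A (1 / h) (F (z + h) \<ominus>\<^bsub>A\<^esub> F z) \<ominus>\<^bsub>A\<^esub> D)) \<longlongrightarrow> 0) (at 0)"
        using D(2) by (rule tendsto_mult_right_zero)
      have "cmod ((q (z + h) - q z) / h - phi (y \<otimes>\<^bsub>A\<^esub> D)) \<le>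
          2 * nrm A y * nrm A (scl A (1 / h) (F (z + h) \<ominus>\<^bsub>A\<^esub> F z) \<ominus>\<^bsub>A\<^esub> D)" for h
      proof -
        let ?u = "scl A (1 / h) (F (z + h) \<ominus>\<^bsub>A\<^esub> F z) \<ominus>\<^bsub>A\<^esub> D"
        have u: "?u \<in> carrier A" using Fc D(1) by (simp add: A.scl_closed)
        have "y \<otimes>\<^bsub>A\<^esub> ?u = scl A (1 / h) ((y \<otimes>\<^bsub>A\<^esub> F (z + h)) \<ominus>\<^bsub>A\<^esub> (y \<otimes>\<^bsub>A\<^esub> F z)) \<ominus>\<^bsub>A\<^esub> (y \<otimes>\<^bsub>A\<^esub> D)"
          using yc Fc D(1) by (simp add: A.distrib_left_diff A.scl_closed A.scl_mult_right)
        then have "phi (y \<otimes>\<^bsub>A\<^esub> ?u) = (q (z + h) - q z) / h - phi (y \<otimes>\<^bsub>A\<^esub> D)"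
          using yc Fc D(1) by (simp add: A.minus_eq phi_add phi_scl A.mult_closed A.scl_closed q_def)
        then show ?thesis using phi_bounded[OF A.mult_closed[OF yc u]] A.nrm_mult[OF yc u] by simp
      qed
      then show "\<forall>\<^sub>F h in at 0. cmod ((q (z + h) - q z) / h - phi (y \<otimes>\<^bsub>A\<^esub> D)) \<le>
          2 * nrm A y * nrm A (scl A (1 / h) (F (z + h) \<ominus>\<^bsub>A\<^esub> F z) \<ominus>\<^bsub>A\<^esub> D)"
        by (intro always_eventually allI)
    qed
    then have "\<exists>d. (q has_field_derivative d) (at z)" for z
      using F unfolding entire_extension_def by blast
    then have hol: "q holomorphic_on UNIV" by (simp add: holomorphic_on_open)
    define r where "r z = q z - exp (- (\<i> * z * of_real l)) * phi (y \<otimes>\<^bsub>A\<^esub> x)" for z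
    have rhol: "r holomorphic_on UNIV" unfolding r_def by (intro holomorphic_intros hol)
    \<comment> \<open>On the real line F is the orbit of x, so invariance of \<open>phi\<close>
      together with the eigenvalue of y gives the identity.\<close>
    have r0: "r (of_real t) = 0" for t
    proof -
      have "phi (y \<otimes>\<^bsub>A\<^esub> x) = phi (\<sigma> t (y \<otimes>\<^bsub>A\<^esub> x))" using phi_\<sigma>[OF A.mult_closed[OF yc x]] by simp
      also have "\<sigma> t (y \<otimes>\<^bsub>A\<^esub> x) = scl A (lam h (of_real t)) (y \<otimes>\<^bsub>A\<^esub> F (of_real t))"
        using h(2) unfolding \<sigma>_mult[OF yc x] F\<sigma> homog_def by (simp add: A.scl_mult_left yc \<sigma>_closed[OF x])
      also have "phi \<dots> = exp (\<i> * of_real t * of_real l) * q (of_real t)"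
        using phi_scl[OF A.mult_closed[OF yc Fc]] by (simp add: q_def lam)
      finally show ?thesis by (simp add: r_def exp_minus field_simps)
    qed
    \<comment> \<open>The real line accumulates at 0, so the identity theorem carries the vanishing
      of r to i beta.\<close>
    have "r ?z = 0"
    proof (rule analytic_continuation[OF rhol, of "\<real>" 0])
      show "0 islimpt (\<real> :: complex set)"
        unfolding islimpt_approachable
      proof (intro allI impI)
        fix e :: real assume e: "e > 0"
        show "\<exists>x'\<in>\<real>. x' \<noteq> (0::complex) \<and> dist x' 0 < e"
          using e by (intro bexI[of _ "complex_of_real (e / 2)"]) auto
      qed
      show "r z = 0" if "z \<in> \<real>" for z using that r0 by (auto elim: Reals_cases)
    qed auto
    then have "q ?z = exp (- (\<i> * ?z * of_real l)) * phi (y \<otimes>\<^bsub>A\<^esub> x)" by (simp add: r_def)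
    \<comment> \<open>At z = i beta the exponent -i z l equals beta ln k.\<close>
    also have "exp (- (\<i> * ?z * of_real l)) = of_real (of_rat (snd h) powr \<beta>)"
      using mk(2) by (simp add: mk(1) powr_def l_def exp_of_real[symmetric] flip: mult.assoc)
    also have "\<dots> * phi (y \<otimes>\<^bsub>A\<^esub> x) = phi (x \<otimes>\<^bsub>A\<^esub> y)" using phi_twist[OF x h] by simp
    finally show "phi (x \<otimes>\<^bsub>A\<^esub> y) = phi (y \<otimes>\<^bsub>A\<^esub> F ?z)" by (simp add: q_def)
  qed
qed

end

text \<open>Since E recovers f from \<open>\<pi> (\<iota> f)\<close>, the values of a KMS state on
  cylinders are those of psi. So psi is a scaling state, and there is only one.\<close>

lemma KMS_factors_unique:
  assumes "KMS_state A \<sigma> \<beta> \<phi>" "factors_through_expectation A \<pi> E \<phi>"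
    "KMS_state A \<sigma> \<beta> \<phi>'" "factors_through_expectation A \<pi> E \<phi>'"
  shows "\<phi> = \<phi>'"
proof -
  have sc: "\<exists>\<psi>. scaling_state \<beta> \<psi> \<and> \<phi> = restrict (\<lambda>a. \<psi> (E (\<pi> a))) (carrier A)"
    if k: "KMS_state A \<sigma> \<beta> \<phi>" "factors_through_expectation A \<pi> E \<phi>" for \<phi>
  proof -
    obtain \<psi> where \<psi>: "state (C_alg Omega_B) \<psi>" "\<And>a. a \<in> carrier A \<Longrightarrow> \<phi> a = \<psi> (E (\<pi> a))"
      using k(2) unfolding factors_through_expectation_def by blast
    have "\<psi> (indicator (cyl m n)) = of_real (real n powr - \<beta>)" if n: "n > 0" for m n
      using KMS_cyl[OF k(1) n, of m] \<psi>(2)[OF \<iota>_closed[OF indicator_cyl_CB[OF n]]] E_\<pi>_\<iota>[OF indicator_cyl_CB[OF n]]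
      by simp
    then have "scaling_state \<beta> \<psi>" using \<psi>(1) by (simp add: scaling_state_def)
    moreover have "\<phi> = restrict (\<lambda>a. \<psi> (E (\<pi> a))) (carrier A)"
      using k(1) \<psi>(2) unfolding KMS_state_def state_def
      by (intro extensionalityI[of _ "carrier A"]) auto
    ultimately show ?thesis by blast
  qed
  show ?thesis using sc[OF assms(1,2)] sc[OF assms(3,4)] scaling_state_unique by blast
qed

lemma KMS_factors_exists:
  assumes "\<beta> \<ge> 1" shows "\<exists>\<phi>. KMS_state A \<sigma> \<beta> \<phi> \<and> factors_through_expectation A \<pi> E \<phi>"
proof -
  obtain \<psi> where \<psi>: "scaling_state \<beta> \<psi>" using scaling_state_exists[OF assms] by blast
  have "factors_through_expectation A \<pi> E (phi \<psi>)"
    unfolding factors_through_expectation_def using state_\<psi>[OF \<psi>] phi_def[OF \<psi>] by auto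
  then show ?thesis using phi_KMS[OF \<psi>] by blast
qed

end

theorem proposition2p1:
  shows "(\<forall>\<beta>::real. \<beta> \<ge> 1 \<longrightarrow> (\<exists>!\<mu>. scaling_probability \<beta> \<mu>)) \<and>
    (\<forall>\<beta>::real. \<beta> < 1 \<longrightarrow> \<not> (\<exists>\<mu>. scaling_probability \<beta> \<mu>)) \<and>
    (\<forall>(A :: 'a cstar) \<iota> v \<sigma>.
       semigroup_crossed_product A \<iota> v \<and> crossed_dynamics A \<iota> v \<sigma> \<longrightarrow>
       (\<forall>(C :: 'b cstar) w \<pi> E.
          group_crossed_product C w \<and> corner_identification A \<iota> v C w \<pi> \<and>
          canonical_expectation C w E \<longrightarrow>
          (\<forall>\<beta>::real. \<beta> \<ge> 1 \<longrightarrow>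
             (\<exists>!\<phi>. KMS_state A \<sigma> \<beta> \<phi> \<and> factors_through_expectation A \<pi> E \<phi>))) \<and>
       (\<forall>\<beta>::real. \<beta> < 1 \<longrightarrow> \<not> (\<exists>\<phi>. KMS_state A \<sigma> \<beta> \<phi>)))"
proof (intro conjI allI impI)
  show "\<exists>!\<mu>. scaling_probability \<beta> \<mu>" if "\<beta> \<ge> 1" for \<beta>
    using exists_scaling_probability[OF that] scaling_probability_unique by blast
  show "\<not> (\<exists>\<mu>. scaling_probability \<beta> \<mu>)" if "\<beta> < 1" for \<beta>
    using that scaling_probability_ge_1 by force
  fix A :: "'a cstar" and \<iota> v \<sigma>
  assume "semigroup_crossed_product A \<iota> v \<and> crossed_dynamics A \<iota> v \<sigma>"
  then interpret crossed_product A \<iota> v \<sigma> by unfold_locales auto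
  show "\<not> (\<exists>\<phi>. KMS_state A \<sigma> \<beta> \<phi>)" if "\<beta> < 1" for \<beta>
    using that KMS_ge_1 by force
  fix C :: "'b cstar" and w \<pi> E and \<beta> :: real
  assume "group_crossed_product C w \<and> corner_identification A \<iota> v C w \<pi> \<and> canonical_expectation C w E"
  then interpret crossed_product_expectation A \<iota> v \<sigma> C w E \<pi> by unfold_locales auto
  assume "\<beta> \<ge> 1"
  then show "\<exists>!\<phi>. KMS_state A \<sigma> \<beta> \<phi> \<and> factors_through_expectation A \<pi> E \<phi>"
    using KMS_factors_exists KMS_factors_unique by blast
qed

end
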